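(* Let $I^2=(0,1)\times(0,1)$, let $\varphi\in L^2(I^2)$, regarded as a function on $\mathbb{R}^2$ that is odd and $2$-periodic in each variable, let $\varphi_{m,n}(x,y)=\varphi(mx,ny)$ for $m,n\in\mathbb{N}$, and set $D=S\varphi$ and $f=\mathcal{B}^{-1}(D)$. The following statements are equivalent: (i) The system $\{\varphi_{m,n}\}_{m,n}$ is a Riesz sequence in $L^2(I^2)$. (ii) The function $f$ belongs to $H^\infty(\mathbb{T}^\infty\times\mathbb{T}^\infty)$ and there exist $\varepsilon>0$ and a set $B\subseteq\mathbb{T}^\infty\times\mathbb{T}^\infty$ of total measure such that $|f(z_1,z_2)|\ge\varepsilon$ for all $(z_1,z_2)\in B$. In this case (with $\varepsilon$ as in (ii)), $$\varepsilon\Big(\sum|b_{m,n}|^2\Big)^{1/2}\le\Big\|\sum b_{m,n}\varphi_{m,n}\Big\|_{L^2(I^2)}\le\|D\|_{\mathcal{H}^\infty}\Big(\sum|b_{m,n}|^2\Big)^{1/2}$$ for every finite family of scalars $(b_{m,n})$.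
   Context: All spaces are over $\mathbb{C}$. Let $e_n(x)=\sqrt2\sin(\pi nx)$ and $e_{m,n}(x,y)=e_m(x)e_n(y)$, an orthonormal basis of $L^2(I^2)$. $\mathcal{H}^2_2$ is the Hilbert space of double Dirichlet series $\sum_{m,n\ge1}a_{m,n}m^{-s}n^{-t}$ with norm $(\sum_{m,n}|a_{m,n}|^2)^{1/2}<\infty$, and $S:L^2(I^2)\to\mathcal{H}^2_2$ is the isometric isomorphism with $Se_{m,n}=m^{-s}n^{-t}$. $\mathbb{T}^\infty$ is the countably infinite product of unit circles with normalized Haar measure; "total measure" means measure $1$. For $q=2,\infty$, $H^q(\mathbb{T}^\infty\times\mathbb{T}^\infty)$ is the subspace of $g\in L^q(\mathbb{T}^\infty\times\mathbb{T}^\infty)$ whose Fourier coefficients $\widehat g(\alpha,\beta)=\int g(w,u)w^{-\alpha}u^{-\beta}\,dw\,du$ ($\alpha,\beta$ finitely supported integer sequences) vanish unless $\alpha_i\ge0$ and $\beta_j\ge0$ for all $i,j$. Let $p_1<p_2<\cdots$ be the primes and, for $n=p_1^{\alpha_1}\cdots p_k^{\alpha_k}$, write $\alpha(n)=(\alpha_1,\dots,\alpha_k,0,\dots)$. The Bohr transform $\mathcal{B}:H^2(\mathbb{T}^\infty\times\mathbb{T}^\infty)\to\mathcal{H}^2_2$ is the isometric isomorphism $g\mapsto\sum_{m,n}\widehat g(\alpha(m),\alpha(n))\,m^{-s}n^{-t}$. If $f\in H^\infty(\mathbb{T}^\infty\times\mathbb{T}^\infty)$, then $D=\mathcal{B}f$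 defines a bounded holomorphic function on $\{(s,t)\in\mathbb{C}^2:\operatorname{Re}s>0,\operatorname{Re}t>0\}$, and $\|D\|_{\mathcal{H}^\infty}$ denotes the supremum of $|D(s,t)|$ over this set (it equals $\|f\|_{L^\infty}$). A countable system $\{g_j\}$ in a Hilbert space is a Riesz sequence if there are constants $0<A\le B$ with $A(\sum|c_j|^2)^{1/2}\le\|\sum c_jg_j\|\le B(\sum|c_j|^2)^{1/2}$ for all finite scalar families $(c_j)$. *)

theory Defs
  imports
    "HOL-Probability.Probability"
    "HOL-Computational_Algebra.Primes"
    "HOL-Library.Infinite_Set"
begin

text \<open>
  Elements of the Lebesgue spaces are represented by Borel measurable functions; every class
  contains such a representative, and all statements are made for arbitrary representatives.
\<close>

definition L2 :: "'a measure \<Rightarrow> ('a \<Rightarrow> complex) set" where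
  "L2 M = {g \<in> borel_measurable M. integrable M (\<lambda>x. (cmod (g x))\<^sup>2)}"

definition L2_norm :: "'a measure \<Rightarrow> ('a \<Rightarrow> complex) \<Rightarrow> real" where
  "L2_norm M g = sqrt (\<integral>x. (cmod (g x))\<^sup>2 \<partial>M)"

definition Linfty :: "'a measure \<Rightarrow> ('a \<Rightarrow> complex) set" where
  "Linfty M = {g \<in> borel_measurable M. \<exists>C. AE x in M. cmod (g x) \<le> C}"

definition riesz_sequence :: "'a measure \<Rightarrow> 'i set \<Rightarrow> ('i \<Rightarrow> 'a \<Rightarrow> complex) \<Rightarrow> bool" where
  "riesz_sequence M J g \<longleftrightarrow>
     countable J \<and> (\<forall>j\<in>J. g j \<in> L2 M) \<and>
     (\<exists>A B. 0 < A \<and> A \<le> B \<and>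
        (\<forall>F c. finite F \<and> F \<subseteq> J \<longrightarrow>
           A * sqrt (\<Sum>j\<in>F. (cmod (c j))\<^sup>2) \<le> L2_norm M (\<lambda>x. \<Sum>j\<in>F. c j * g j x) \<and>
           L2_norm M (\<lambda>x. \<Sum>j\<in>F. c j * g j x) \<le> B * sqrt (\<Sum>j\<in>F. (cmod (c j))\<^sup>2)))"


definition unit_square :: "(real \<times> real) set" where
  "unit_square = {0<..<1} \<times> {0<..<1}"

definition square_measure :: "(real \<times> real) measure" where
  "square_measure = restrict_space lborel unit_square"

definition odd_periodic :: "(real \<times> real \<Rightarrow> complex) \<Rightarrow> bool" where
  "odd_periodic \<phi> \<longleftrightarrow>
     (\<forall>x y. \<phi> (- x, y) = - \<phi> (x, y) \<and> \<phi> (x, - y) = - \<phi> (x, y) \<and>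
            \<phi> (x + 2, y) = \<phi> (x, y) \<and> \<phi> (x, y + 2) = \<phi> (x, y))"

definition index_pairs :: "(nat \<times> nat) set" where
  "index_pairs = {1..} \<times> {1..}"

definition dilation :: "(real \<times> real \<Rightarrow> complex) \<Rightarrow> nat \<times> nat \<Rightarrow> real \<times> real \<Rightarrow> complex" where
  "dilation \<phi> = (\<lambda>(m, n) (x, y). \<phi> (real m * x, real n * y))"

definition sine :: "nat \<Rightarrow> real \<Rightarrow> real" where
  "sine n x = sqrt 2 * sin (pi * real n * x)"

definition sine2 :: "nat \<Rightarrow> nat \<Rightarrow> real \<times> real \<Rightarrow> complex" where
  "sine2 m n = (\<lambda>(x, y). of_real (sine m x * sine n y))"

text \<open>
  A double Dirichlet series is represented by its coefficients \<open>a m n\<close> with \<open>m, n \<ge> 1\<close>; by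
  convention \<open>a m n = 0\<close> if \<open>m = 0\<close> or \<open>n = 0\<close>. The isomorphism \<open>S\<close> sends a function to its
  coefficients in the orthonormal basis \<open>sine2 m n\<close>, which is real valued.
\<close>

definition S_map :: "(real \<times> real \<Rightarrow> complex) \<Rightarrow> nat \<Rightarrow> nat \<Rightarrow> complex" where
  "S_map \<phi> m n =
     (if m = 0 \<or> n = 0 then 0 else \<integral>p. \<phi> p * cnj (sine2 m n p) \<partial>square_measure)"


definition circle_measure :: "complex measure" where
  "circle_measure =
     distr (uniform_measure lborel {0..1::real}) (restrict_space borel (sphere 0 1))
       (\<lambda>t. cis (2 * pi * t))"

definition torus_measure :: "(nat \<Rightarrow> complex) measure" where
  "torus_measure = PiM UNIV (\<lambda>_. circle_measure)"

definition torus2_measure :: "((nat \<Rightarrow> complex) \<times> (nat \<Rightarrow> complex)) measure" where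
  "torus2_measure = torus_measure \<Otimes>\<^sub>M torus_measure"

definition torus_monomial :: "(nat \<Rightarrow> int) \<Rightarrow> (nat \<Rightarrow> complex) \<Rightarrow> complex" where
  "torus_monomial \<alpha> w = (\<Prod>i | \<alpha> i \<noteq> 0. w i powi \<alpha> i)"

definition fourier_coeff ::
  "((nat \<Rightarrow> complex) \<times> (nat \<Rightarrow> complex) \<Rightarrow> complex) \<Rightarrow> (nat \<Rightarrow> int) \<Rightarrow> (nat \<Rightarrow> int) \<Rightarrow> complex" where
  "fourier_coeff g \<alpha> \<beta> =
     (\<integral>(w, u). g (w, u) * torus_monomial (\<lambda>i. - \<alpha> i) w * torus_monomial (\<lambda>j. - \<beta> j) u
        \<partial>torus2_measure)"

definition analytic_spectrum :: "((nat \<Rightarrow> complex) \<times> (nat \<Rightarrow> complex) \<Rightarrow> complex) \<Rightarrow> bool" where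
  "analytic_spectrum g \<longleftrightarrow>
     (\<forall>\<alpha> \<beta>. finite {i. \<alpha> i \<noteq> 0} \<and> finite {j. \<beta> j \<noteq> 0} \<and>
        ((\<exists>i. \<alpha> i < 0) \<or> (\<exists>j. \<beta> j < 0)) \<longrightarrow> fourier_coeff g \<alpha> \<beta> = 0)"

definition H2_torus :: "((nat \<Rightarrow> complex) \<times> (nat \<Rightarrow> complex) \<Rightarrow> complex) set" where
  "H2_torus = {g \<in> L2 torus2_measure. analytic_spectrum g}"

definition Hinfty_torus :: "((nat \<Rightarrow> complex) \<times> (nat \<Rightarrow> complex) \<Rightarrow> complex) set" where
  "Hinfty_torus = {g \<in> Linfty torus2_measure. analytic_spectrum g}"

definition prime_exponents :: "nat \<Rightarrow> nat \<Rightarrow> int" where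
  "prime_exponents n i = int (multiplicity (enumerate {p::nat. prime p} i) n)"

definition bohr ::
  "((nat \<Rightarrow> complex) \<times> (nat \<Rightarrow> complex) \<Rightarrow> complex) \<Rightarrow> nat \<Rightarrow> nat \<Rightarrow> complex" where
  "bohr g m n =
     (if m = 0 \<or> n = 0 then 0 else fourier_coeff g (prime_exponents m) (prime_exponents n))"


definition half_planes :: "real \<Rightarrow> (complex \<times> complex) set" where
  "half_planes \<sigma> = {(s, t). \<sigma> < Re s \<and> \<sigma> < Re t}"

definition holomorphic2_on :: "(complex \<times> complex \<Rightarrow> complex) \<Rightarrow> (complex \<times> complex) set \<Rightarrow> bool" where
  "holomorphic2_on F \<Omega> \<longleftrightarrow>
     (\<forall>p\<in>\<Omega>. \<exists>a b. (F has_derivative (\<lambda>(h, k). a * h + b * k)) (at p within \<Omega>))"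

text \<open>
  A double Dirichlet series with square summable coefficients converges absolutely for
  \<open>Re s, Re t > 1/2\<close> by the Cauchy-Schwarz inequality, but in general not for \<open>Re s, Re t > 0\<close>.
  The function it defines on the larger set is its holomorphic extension, which is unique on
  \<open>half_planes 0\<close> if it exists (its values elsewhere are irrelevant).
\<close>

definition dirichlet_function :: "(nat \<Rightarrow> nat \<Rightarrow> complex) \<Rightarrow> complex \<times> complex \<Rightarrow> complex" where
  "dirichlet_function a =
     (SOME F. holomorphic2_on F (half_planes 0) \<and>
        (\<forall>(s, t) \<in> half_planes (1/2).
           ((\<lambda>(m, n). a m n * of_nat m powr (- s) * of_nat n powr (- t)) has_sum F (s, t))
             index_pairs))"

definition dirichlet_sup_norm :: "(nat \<Rightarrow> nat \<Rightarrow> complex) \<Rightarrow> real" where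
  "dirichlet_sup_norm a = (SUP p \<in> half_planes 0. cmod (dirichlet_function a p))"


text \<open>
  Every function on the open unit square is the restriction of a function that is odd and
  2-periodic in each variable.
\<close>

lemma odd_periodic_extension_exists:
  fixes u :: "real \<times> real \<Rightarrow> complex"
  shows "\<exists>\<phi>. odd_periodic \<phi> \<and> (\<forall>p\<in>unit_square. \<phi> p = u p)"
proof -
  define r where "r = (\<lambda>x::real. arccos (cos (pi * x)) / pi)"
  define \<phi> where "\<phi> = (\<lambda>(x, y). of_real (sgn (sin (pi * x)) * sgn (sin (pi * y))) * u (r x, r y))"
  have "pi * (x + 2) = pi * x + 2 * pi" for x :: real
    by (simp add: algebra_simps)
  then have "odd_periodic \<phi>"
    unfolding odd_periodic_def \<phi>_def r_def by (simp add: sgn_minus)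
  moreover have "\<phi> p = u p" if "p \<in> unit_square" for p
  proof -
    obtain x y where p: "p = (x, y)"
      by (cases p)
    then have xy: "0 < x" "x < 1" "0 < y" "y < 1"
      using that by (simp_all add: unit_square_def)
    then have "sin (pi * x) > 0" "sin (pi * y) > 0" "r x = x" "r y = y"
      by (auto simp: r_def arccos_cos intro!: sin_gt_zero)
    with p xy show ?thesis
      by (simp add: \<phi>_def)
  qed
  ultimately show ?thesis
    by blast
qed

text \<open>The map \<open>S_map\<close> sends the basis function \<open>sine2 k l\<close> to the monomial \<open>k\<^sup>-\<^sup>s l\<^sup>-\<^sup>t\<close>.\<close>

lemma sine_orthonormal:
  assumes "m > 0" "n > 0"
  shows "((\<lambda>x. sine m x * sine n x) has_integral (if m = n then 1 else 0)) {0..1}"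
proof -
  have eq: "sine m x * sine n x = cos (pi * (real m - real n) * x) - cos (pi * (real m + real n) * x)"
    for x
    by (simp add: sine_def algebra_simps cos_add cos_diff)
  have cos_int: "((\<lambda>x. cos (c * x)) has_integral (sin c / c)) {0..1}" if "c \<noteq> 0" for c :: real
  proof -
    have "((\<lambda>x. cos (c * x)) has_integral (sin (c * 1) / c - sin (c * 0) / c)) {0..1}"
      using that
      by (intro fundamental_theorem_of_calculus)
         (auto intro!: derivative_eq_intros simp flip: has_real_derivative_iff_has_vector_derivative)
    then show ?thesis by simp
  qed
  have sin0: "sin (pi * (real m + real n)) = 0" "sin (pi * (real m - real n)) = 0"
    by (simp_all add: algebra_simps sin_add sin_diff)
  have plus: "((\<lambda>x. cos (pi * (real m + real n) * x)) has_integral 0) {0..1}"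
    using cos_int[of "pi * (real m + real n)"] assms sin0 by simp
  have minus: "((\<lambda>x. cos (pi * (real m - real n) * x)) has_integral (if m = n then 1 else 0)) {0..1}"
  proof (cases "m = n")
    case True
    then show ?thesis using has_integral_const_real[of "1::real" 0 1] by simp
  next
    case False
    then show ?thesis using cos_int[of "pi * (real m - real n)"] sin0 by simp
  qed
  show ?thesis
    unfolding eq using has_integral_diff[OF minus plus] by simp
qed

lemma S_map_sine2:
  assumes "k > 0" "l > 0"
  shows "S_map (sine2 k l) m n = (if m = k \<and> n = l then 1 else 0)"
proof (cases "m = 0 \<or> n = 0")
  case True
  with assms show ?thesis by (auto simp: S_map_def)
next
  case False
  define h where "h = (\<lambda>i j x. indicator {0<..<1::real} x * (sine i x * sine j x))"
  have cont: "continuous_on {0..1} (\<lambda>x. sine i x * sine j x)" for i j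
    unfolding sine_def by (intro continuous_intros)
  have int: "integrable lborel (h i j)" for i j
  proof -
    have "set_integrable lborel {0..1} (\<lambda>x. sine i x * sine j x)"
      by (rule borel_integrable_atLeastAtMost'[OF cont])
    then have "set_integrable lborel {0<..<1} (\<lambda>x. sine i x * sine j x)"
      by (rule set_integrable_subset) auto
    then show ?thesis by (simp add: set_integrable_def h_def)
  qed
  have val: "integral\<^sup>L lborel (h i j) = (if i = j then 1 else 0)" if "i > 0" "j > 0" for i j
  proof -
    have "set_integrable lborel {0<..<1} (\<lambda>x. sine i x * sine j x)"
      using int[of i j] by (simp add: set_integrable_def h_def)
    then have "integral\<^sup>L lborel (h i j) = integral {0<..<1} (\<lambda>x. sine i x * sine j x)"
      using set_borel_integral_eq_integral(2)[of "{0<..<1}" "\<lambda>x. sine i x * sine j x"]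
      by (simp add: set_lebesgue_integral_def h_def)
    also have "\<dots> = (if i = j then 1 else 0)"
      by (rule integral_unique, rule iffD1[OF has_integral_Icc_iff_Ioo], rule sine_orthonormal[OF that])
    finally show ?thesis .
  qed
  have "S_map (sine2 k l) m n = (\<integral>p. sine2 k l p * cnj (sine2 m n p) \<partial>square_measure)"
    using False by (simp add: S_map_def)
  also have "\<dots> = (\<integral>p. indicator unit_square p *\<^sub>R (sine2 k l p * cnj (sine2 m n p)) \<partial>lborel)"
    unfolding square_measure_def
    by (subst integral_restrict_space) (auto simp: unit_square_def intro!: borel_open open_Times)
  also have "\<dots> = (\<integral>p. complex_of_real (h k m (fst p) * h l n (snd p)) \<partial>lborel)"
    by (intro Bochner_Integration.integral_cong)
       (auto simp: h_def sine2_def unit_square_def indicator_def)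
  also have "\<dots> = of_real (\<integral>p. h k m (fst p) * h l n (snd p) \<partial>(lborel \<Otimes>\<^sub>M lborel))"
    by (subst lborel_prod) (rule integral_complex_of_real)
  also have "(\<integral>p. h k m (fst p) * h l n (snd p) \<partial>(lborel \<Otimes>\<^sub>M lborel)) =
      (\<integral>x. (\<integral>y. h k m x * h l n y \<partial>lborel) \<partial>lborel)"
  proof -
    have [measurable]: "h i j \<in> borel_measurable lborel" for i j
      using int[of i j] by (rule borel_measurable_integrable)
    have "integrable (lborel \<Otimes>\<^sub>M lborel) (\<lambda>p. h k m (fst p) * h l n (snd p))"
    proof (rule lborel_pair.Fubini_integrable)
      show "integrable lborel (\<lambda>x. \<integral>y. norm (h k m (fst (x, y)) * h l n (snd (x, y))) \<partial>lborel)"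
        using int by (simp add: abs_mult)
      show "AE x in lborel. integrable lborel (\<lambda>y. h k m (fst (x, y)) * h l n (snd (x, y)))"
        using int by simp
    qed measurable
    from lborel_pair.integral_fst'[OF this] show ?thesis
      by simp
  qed
  also have "\<dots> = integral\<^sup>L lborel (h k m) * integral\<^sup>L lborel (h l n)"
    by simp
  finally show ?thesis
    using val[of k m] val[of l n] False assms by auto
qed

end

theory Submission
  imports Defs "HOL-Complex_Analysis.Complex_Analysis"
begin

text \<open>
  The norms on the square and on the torus depend only on the coefficients \<open>a = D\<close>: dilating \<open>sine2 k l\<close> by
  \<open>(m, n)\<close> gives \<open>sine2 (k m) (l n)\<close>, so by Parseval's identity on the square and on the torus
  \<open>\<parallel>\<Sum> b j \<phi> j\<parallel> = \<parallel>a * b\<parallel> = \<parallel>f P\<parallel>\<close>, where \<open>a * b\<close> is the Dirichlet convolution and \<open>P\<close> is the analytic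
  polynomial with coefficients \<open>b\<close>. Multiplication by a monomial turns every trigonometric polynomial
  into an analytic one, and trigonometric polynomials are dense in the \<open>L\<^sup>2\<close> space of any finite
  measure on the torus, so the Riesz bounds are equivalent to bounds for \<open>\<bar>f\<bar>\<close> almost everywhere.
  For the upper bound by the supremum norm, a reproducing kernel argument on the smooth numbers
  bounds the smooth parts of \<open>D\<close> on \<open>Re s, Re t > 0\<close>, and Montel's theorem gives a bounded extension;
  conversely a mean value over vertical translations shows that the supremum of the extension bounds
  convolution with \<open>a\<close>.
\<close>

section \<open>Square integrable functions\<close>

text \<open>The right-hand constant is the delicate one. \<open>dirichlet_sup_norm\<close> is the
  supremum of a function picked by choice, so it says nothing until a holomorphic extension exists
  and is bounded. Hence two passes: the essential bound of \<open>f\<close> first yields some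
  multiplier bound, which produces the extension; the supremum of the extension then gives back the
  sharp multiplier bound. The kernel vector at a point is square summable over all pairs only for
  real parts above 1/2; with finitely many primes it is so for all positive real parts, which is why
  smooth numbers enter. For the equivalence the obstacle is that \<open>f\<close> is at first only
  square integrable: approximating an indicator by polynomials in plain mean square says nothing
  about the products with \<open>f\<close>. Density is therefore proved for measures with an
  integrable density, and applied with a density that contains the squared modulus of
  \<open>f\<close>. Analytic polynomials alone could be far from dense for such a measure.\<close>

lemma cmod_add_square_le: "(cmod (a + b))\<^sup>2 \<le> 2 * (cmod a)\<^sup>2 + 2 * (cmod b)\<^sup>2"
proof -
  have "(cmod (a + b))\<^sup>2 \<le> (cmod a + cmod b)\<^sup>2"
    by (intro power_mono norm_triangle_ineq) auto
  also have "\<dots> \<le> 2 * (cmod a)\<^sup>2 + 2 * (cmod b)\<^sup>2"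
    using sum_squares_bound[of "cmod a" "cmod b"] by (simp add: power2_sum)
  finally show ?thesis .
qed

lemma L2_measurable [measurable_dest]: "g \<in> L2 M \<Longrightarrow> g \<in> borel_measurable M"
  by (simp add: L2_def)

lemma L2_integrable: "g \<in> L2 M \<Longrightarrow> integrable M (\<lambda>x. (cmod (g x))\<^sup>2)"
  by (simp add: L2_def)

lemma L2_add: assumes "f \<in> L2 M" "g \<in> L2 M" shows "(\<lambda>x. f x + g x) \<in> L2 M"
  unfolding L2_def
proof (intro CollectI conjI)
  note [measurable] = L2_measurable[OF assms(1)] L2_measurable[OF assms(2)]
  show "(\<lambda>x. f x + g x) \<in> borel_measurable M" by measurable
  show "integrable M (\<lambda>x. (cmod (f x + g x))\<^sup>2)"
  proof (rule Bochner_Integration.integrable_bound)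
    show "integrable M (\<lambda>x. 2 * (cmod (f x))\<^sup>2 + 2 * (cmod (g x))\<^sup>2)"
      using L2_integrable[OF assms(1)] L2_integrable[OF assms(2)] by simp
    show "AE x in M. norm ((cmod (f x + g x))\<^sup>2) \<le> norm (2 * (cmod (f x))\<^sup>2 + 2 * (cmod (g x))\<^sup>2)"
      using cmod_add_square_le by (intro AE_I2) auto
  qed measurable
qed

lemma L2_scale: assumes "f \<in> L2 M" shows "(\<lambda>x. c * f x) \<in> L2 M"
  using L2_integrable[OF assms] L2_measurable[OF assms]
  by (simp add: L2_def norm_mult power_mult_distrib)

lemma L2_zero: "(\<lambda>x. 0) \<in> L2 M"
  by (simp add: L2_def)

lemma L2_sum: assumes "\<And>i. i \<in> F \<Longrightarrow> f i \<in> L2 M" shows "(\<lambda>x. \<Sum>i\<in>F. c i * f i x) \<in> L2 M"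
  using assms by (induction F rule: infinite_finite_induct) (auto simp: L2_zero intro!: L2_add L2_scale)

lemma L2_diff: assumes "f \<in> L2 M" "g \<in> L2 M" shows "(\<lambda>x. f x - g x) \<in> L2 M"
  using L2_add[OF assms(1) L2_scale[OF assms(2), of "-1"]] by simp

lemma L2_bounded_mult:
  assumes "f \<in> L2 M" "g \<in> borel_measurable M" "AE x in M. cmod (g x) \<le> C"
  shows "(\<lambda>x. f x * g x) \<in> L2 M"
  unfolding L2_def
proof (intro CollectI conjI)
  note [measurable] = L2_measurable[OF assms(1)] assms(2)
  show "(\<lambda>x. f x * g x) \<in> borel_measurable M" by measurable
  show "integrable M (\<lambda>x. (cmod (f x * g x))\<^sup>2)"
  proof (rule Bochner_Integration.integrable_bound)
    show "integrable M (\<lambda>x. C\<^sup>2 * (cmod (f x))\<^sup>2)"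
      using L2_integrable[OF assms(1)] by simp
    show "AE x in M. norm ((cmod (f x * g x))\<^sup>2) \<le> norm (C\<^sup>2 * (cmod (f x))\<^sup>2)"
      using assms(3) by eventually_elim
        (auto simp: norm_mult power_mult_distrib mult.commute[of _ "C\<^sup>2"] mult.commute[of "(cmod (f _))\<^sup>2"]
          intro!: mult_right_mono power_mono)
  qed measurable
qed

lemma (in finite_measure) L2_bounded:
  assumes "g \<in> borel_measurable M" "AE x in M. cmod (g x) \<le> C"
  shows "g \<in> L2 M"
proof -
  have "(\<lambda>x. 1 * g x) \<in> L2 M"
    using assms by (intro L2_bounded_mult[of "\<lambda>_. 1"]) (auto simp: L2_def)
  then show ?thesis by simp
qed

lemma L2_inner_integrable:
  assumes "f \<in> L2 M" "g \<in> L2 M" shows "integrable M (\<lambda>x. f x * cnj (g x))"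
proof (rule Bochner_Integration.integrable_bound)
  note [measurable] = L2_measurable[OF assms(1)] L2_measurable[OF assms(2)]
  show "integrable M (\<lambda>x. (cmod (f x))\<^sup>2 + (cmod (g x))\<^sup>2)"
    using L2_integrable[OF assms(1)] L2_integrable[OF assms(2)] by simp
  have "cmod a * cmod b \<le> (cmod a)\<^sup>2 + (cmod b)\<^sup>2" for a b
    using sum_squares_bound[of "cmod a" "cmod b"] mult_nonneg_nonneg[OF norm_ge_zero[of a] norm_ge_zero[of b]]
    by linarith
  then show "AE x in M. norm (f x * cnj (g x)) \<le> norm ((cmod (f x))\<^sup>2 + (cmod (g x))\<^sup>2)"
    by (intro AE_I2) (auto simp: norm_mult)
  show "(\<lambda>x. f x * cnj (g x)) \<in> borel_measurable M"
    using L2_measurable[OF assms(1)] L2_measurable[OF assms(2)]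
    by (intro borel_measurable_times measurable_compose[OF _ borel_measurable_continuous_onI[OF continuous_on_cnj[OF continuous_on_id]], of g]) auto
qed

lemma L2_norm_nonneg [simp]: "0 \<le> L2_norm M g"
  by (simp add: L2_norm_def)

lemma L2_norm_square: "(L2_norm M g)\<^sup>2 = (\<integral>x. (cmod (g x))\<^sup>2 \<partial>M)"
  by (simp add: L2_norm_def)

section \<open>Orthonormal systems: best approximation, Bessel, Parseval\<close>

locale orthonormal_system =
  fixes M :: "'a measure" and I :: "'i set" and e :: "'i \<Rightarrow> 'a \<Rightarrow> complex"
  assumes in_L2: "i \<in> I \<Longrightarrow> e i \<in> L2 M"
    and orthonormal: "i \<in> I \<Longrightarrow> j \<in> I \<Longrightarrow> (\<integral>x. e i x * cnj (e j x) \<partial>M) = (if i = j then 1 else 0)"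
begin

definition coeff :: "('a \<Rightarrow> complex) \<Rightarrow> 'i \<Rightarrow> complex" where
  "coeff g i = (\<integral>x. g x * cnj (e i x) \<partial>M)"

lemma coeff_diff: "f \<in> L2 M \<Longrightarrow> g \<in> L2 M \<Longrightarrow> i \<in> I \<Longrightarrow>
    coeff (\<lambda>x. f x - g x) i = coeff f i - coeff g i"
  unfolding coeff_def by (simp add: left_diff_distrib L2_inner_integrable in_L2)

lemma coeff_sum:
  assumes "\<And>j. j \<in> F \<Longrightarrow> f j \<in> L2 M" "i \<in> I"
  shows "coeff (\<lambda>x. \<Sum>j\<in>F. c j * f j x) i = (\<Sum>j\<in>F. c j * coeff (f j) i)"
  unfolding coeff_def
  by (simp add: sum_distrib_right mult.assoc)
     (subst Bochner_Integration.integral_sum, auto intro!: L2_inner_integrable in_L2 assms)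

text \<open>Pythagoras for an arbitrary trial combination. The coefficients \<open>c\<close> enter
  only through the last sum, so the Fourier coefficients are the best choice. Taking
  \<open>c = coeff g\<close> gives Bessel, \<open>g = 0\<close> gives the norm of a finite
  combination, and a small left side gives Parseval.\<close>

lemma integral_diff_square:
  assumes g: "g \<in> L2 M" and F: "finite F" "F \<subseteq> I"
  shows "(\<integral>x. (cmod (g x - (\<Sum>i\<in>F. c i * e i x)))\<^sup>2 \<partial>M) =
    (\<integral>x. (cmod (g x))\<^sup>2 \<partial>M) - (\<Sum>i\<in>F. (cmod (coeff g i))\<^sup>2) + (\<Sum>i\<in>F. (cmod (coeff g i - c i))\<^sup>2)"
proof -
  define p where "p = (\<lambda>x. \<Sum>i\<in>F. c i * e i x)"
  have e: "e i \<in> L2 M" if "i \<in> F" for i using that F in_L2 by auto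
  have p: "p \<in> L2 M" unfolding p_def by (intro L2_sum e)
  have sq: "complex_of_real (\<integral>x. (cmod (u x))\<^sup>2 \<partial>M) = (\<integral>x. u x * cnj (u x) \<partial>M)" for u
    by (subst integral_complex_of_real[symmetric]) (simp only: complex_norm_square)
  have gp: "(\<integral>x. g x * cnj (p x) \<partial>M) = (\<Sum>i\<in>F. cnj (c i) * coeff g i)"
  proof -
    have "g x * cnj (p x) = (\<Sum>i\<in>F. cnj (c i) * (g x * cnj (e i x)))" for x
      by (simp add: p_def sum_distrib_left mult_ac)
    then show ?thesis
      unfolding coeff_def by (simp add: L2_inner_integrable g e)
  qed
  have "(\<integral>x. p x * cnj (g x) \<partial>M) = (\<integral>x. cnj (g x * cnj (p x)) \<partial>M)"
    by (simp add: mult.commute)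
  also have "\<dots> = (\<Sum>i\<in>F. c i * cnj (coeff g i))"
    by (subst Bochner_Integration.integral_cnj) (simp add: gp)
  finally have pg: "(\<integral>x. p x * cnj (g x) \<partial>M) = (\<Sum>i\<in>F. c i * cnj (coeff g i))" .
  have "(\<integral>x. p x * cnj (p x) \<partial>M) = (\<Sum>i\<in>F. c i * (\<integral>x. e i x * cnj (p x) \<partial>M))"
  proof -
    have "p x * cnj (p x) = (\<Sum>i\<in>F. c i * (e i x * cnj (p x)))" for x
      by (subst (1) p_def) (simp add: sum_distrib_right mult.assoc)
    then show ?thesis by (simp add: L2_inner_integrable p e)
  qed
  also have "\<dots> = (\<Sum>i\<in>F. c i * cnj (c i))"
  proof (intro sum.cong refl)
    fix i assume i: "i \<in> F"
    have "(\<integral>x. e i x * cnj (p x) \<partial>M) = (\<Sum>j\<in>F. cnj (c j) * (\<integral>x. e i x * cnj (e j x) \<partial>M))"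
    proof -
      have "e i x * cnj (p x) = (\<Sum>j\<in>F. cnj (c j) * (e i x * cnj (e j x)))" for x
        by (simp add: p_def sum_distrib_left mult_ac)
      then show ?thesis by (simp add: L2_inner_integrable i e)
    qed
    also have "\<dots> = (\<Sum>j\<in>F. if i = j then cnj (c j) else 0)"
      using i F by (intro sum.cong refl, subst orthonormal) auto
    also have "\<dots> = cnj (c i)" using i F by simp
    finally show "c i * (\<integral>x. e i x * cnj (p x) \<partial>M) = c i * cnj (c i)" by simp
  qed
  finally have pp: "(\<integral>x. p x * cnj (p x) \<partial>M) = (\<Sum>i\<in>F. c i * cnj (c i))" .
  have "complex_of_real (\<integral>x. (cmod (g x - p x))\<^sup>2 \<partial>M) =
      (\<integral>x. ((g x * cnj (g x) - g x * cnj (p x)) - p x * cnj (g x)) + p x * cnj (p x) \<partial>M)"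
    unfolding sq by (simp add: algebra_simps)
  also have "\<dots> = (\<integral>x. g x * cnj (g x) \<partial>M) - (\<integral>x. g x * cnj (p x) \<partial>M)
      - (\<integral>x. p x * cnj (g x) \<partial>M) + (\<integral>x. p x * cnj (p x) \<partial>M)"
    by (simp add: L2_inner_integrable g p)
  also have "\<dots> = of_real ((\<integral>x. (cmod (g x))\<^sup>2 \<partial>M) - (\<Sum>i\<in>F. (cmod (coeff g i))\<^sup>2)
      + (\<Sum>i\<in>F. (cmod (coeff g i - c i))\<^sup>2))"
    unfolding gp pg pp sq[symmetric] of_real_add of_real_diff of_real_sum complex_norm_square
    by (simp add: algebra_simps sum.distrib sum_subtractf)
  finally show ?thesis by (simp only: p_def of_real_eq_iff)
qed

lemma bessel:
  assumes "g \<in> L2 M" "finite F" "F \<subseteq> I"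
  shows "(\<Sum>i\<in>F. (cmod (coeff g i))\<^sup>2) \<le> (\<integral>x. (cmod (g x))\<^sup>2 \<partial>M)"
proof -
  have "0 \<le> (\<integral>x. (cmod (g x - (\<Sum>i\<in>F. coeff g i * e i x)))\<^sup>2 \<partial>M)" by simp
  then show ?thesis unfolding integral_diff_square[OF assms] by simp
qed

lemma norm_finite_combination:
  assumes "finite F" "F \<subseteq> I"
  shows "L2_norm M (\<lambda>x. \<Sum>i\<in>F. c i * e i x) = sqrt (\<Sum>i\<in>F. (cmod (c i))\<^sup>2)"
  using integral_diff_square[OF L2_zero assms, of c] by (simp add: L2_norm_def coeff_def)

text \<open>Totality is asked of the single function \<open>g\<close>, the form in which the density
  theorems deliver it. For every finite \<open>Y\<close> above \<open>F\<close> the partial sum lies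
  between the one over \<open>F\<close>, which is within \<epsilon> by
  \<open>integral_diff_square\<close>, and the Bessel bound.\<close>

lemma parseval:
  assumes total: "\<And>\<epsilon>. \<epsilon> > 0 \<Longrightarrow> \<exists>F c. finite F \<and> F \<subseteq> I \<and>
      (\<integral>x. (cmod (g x - (\<Sum>i\<in>F. c i * e i x)))\<^sup>2 \<partial>M) < \<epsilon>"
    and g: "g \<in> L2 M"
  shows "((\<lambda>i. (cmod (coeff g i))\<^sup>2) has_sum (L2_norm M g)\<^sup>2) I"
  unfolding has_sum_def tendsto_iff eventually_finite_subsets_at_top L2_norm_square
proof (intro allI impI)
  fix \<epsilon> :: real assume "\<epsilon> > 0"
  then obtain F c where F: "finite F" "F \<subseteq> I"
    and lt: "(\<integral>x. (cmod (g x - (\<Sum>i\<in>F. c i * e i x)))\<^sup>2 \<partial>M) < \<epsilon>"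
    using total by meson
  show "\<exists>X. finite X \<and> X \<subseteq> I \<and> (\<forall>Y. finite Y \<and> X \<subseteq> Y \<and> Y \<subseteq> I \<longrightarrow>
      dist (\<Sum>i\<in>Y. (cmod (coeff g i))\<^sup>2) (\<integral>x. (cmod (g x))\<^sup>2 \<partial>M) < \<epsilon>)"
  proof (intro exI[of _ F] conjI allI impI F)
    fix Y assume Y: "finite Y \<and> F \<subseteq> Y \<and> Y \<subseteq> I"
    have "(\<integral>x. (cmod (g x))\<^sup>2 \<partial>M) - (\<Sum>i\<in>F. (cmod (coeff g i))\<^sup>2) < \<epsilon>"
      using lt unfolding integral_diff_square[OF g F]
      using sum_nonneg[of F "\<lambda>i. (cmod (coeff g i - c i))\<^sup>2"] by simp
    moreover have "(\<Sum>i\<in>F. (cmod (coeff g i))\<^sup>2) \<le> (\<Sum>i\<in>Y. (cmod (coeff g i))\<^sup>2)"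
      using Y by (intro sum_mono2) auto
    moreover have "(\<Sum>i\<in>Y. (cmod (coeff g i))\<^sup>2) \<le> (\<integral>x. (cmod (g x))\<^sup>2 \<partial>M)"
      using Y by (intro bessel g) auto
    ultimately show "dist (\<Sum>i\<in>Y. (cmod (coeff g i))\<^sup>2) (\<integral>x. (cmod (g x))\<^sup>2 \<partial>M) < \<epsilon>"
      by (simp add: dist_real_def)
  qed
qed

end

text \<open>\<open>R\<close> is dense in \<open>L\<^sup>2\<close>: the indicators of finite intersections of sets
  \<open>{g > c}\<close> with \<open>g \<in> R\<close> are bounded limits of products of continuous functions of elements of \<open>R\<close>,
  which are uniform limits of elements of \<open>R\<close> by the Weierstrass theorem; a \<open>\<lambda>\<close>-system
  argument then gives all indicators.\<close>

locale generating_algebra = finite_measure M for M :: "'a measure" +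
  fixes R :: "('a \<Rightarrow> real) set"
  assumes const: "(\<lambda>_. c) \<in> R"
    and add: "f \<in> R \<Longrightarrow> g \<in> R \<Longrightarrow> (\<lambda>x. f x + g x) \<in> R"
    and mult: "f \<in> R \<Longrightarrow> g \<in> R \<Longrightarrow> (\<lambda>x. f x * g x) \<in> R"
    and bounded: "g \<in> R \<Longrightarrow> \<exists>B. \<forall>x\<in>space M. \<bar>g x\<bar> \<le> B"
    and meas: "g \<in> R \<Longrightarrow> g \<in> borel_measurable M"
    and generating: "space N = space M \<Longrightarrow> (\<And>g. g \<in> R \<Longrightarrow> g \<in> borel_measurable N) \<Longrightarrow>
        sets M \<subseteq> sets N"
begin

definition sq :: "('a \<Rightarrow> real) set" where
  "sq = {h \<in> borel_measurable M. integrable M (\<lambda>x. (h x)\<^sup>2)}"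

definition appr :: "('a \<Rightarrow> real) set" where
  "appr = {h \<in> sq. \<forall>\<epsilon>>0. \<exists>g\<in>R. (\<integral>x. (h x - g x)\<^sup>2 \<partial>M) < \<epsilon>}"

lemma apprE:
  assumes "f \<in> appr" "\<epsilon> > 0"
  obtains g where "g \<in> R" "(\<integral>x. (f x - g x)\<^sup>2 \<partial>M) < \<epsilon>"
  using assms by (auto simp: appr_def)

lemma square_add_le: "(a + b)\<^sup>2 \<le> 2 * a\<^sup>2 + 2 * (b::real)\<^sup>2"
  using sum_squares_bound[of a b] by (simp add: power2_sum)

lemma sq_bounded:
  assumes "h \<in> borel_measurable M" "\<And>x. x \<in> space M \<Longrightarrow> \<bar>h x\<bar> \<le> B"
  shows "h \<in> sq"
proof -
  have "(h x)\<^sup>2 \<le> B\<^sup>2" if "x \<in> space M" for x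
    using power_mono[OF assms(2)[OF that], of 2] by simp
  then show ?thesis
    using assms(1) unfolding sq_def by (auto intro!: integrable_const_bound[of _ "B\<^sup>2"])
qed

lemma R_sq: "g \<in> R \<Longrightarrow> g \<in> sq"
  using bounded meas sq_bounded by metis

lemma sq_add: assumes "f \<in> sq" "g \<in> sq" shows "(\<lambda>x. f x + g x) \<in> sq"
proof -
  have [measurable]: "f \<in> borel_measurable M" "g \<in> borel_measurable M"
    using assms by (auto simp: sq_def)
  have "integrable M (\<lambda>x. (f x + g x)\<^sup>2)"
  proof (rule Bochner_Integration.integrable_bound)
    show "integrable M (\<lambda>x. 2 * (f x)\<^sup>2 + 2 * (g x)\<^sup>2)"
      using assms by (simp add: sq_def)
    show "AE x in M. norm ((f x + g x)\<^sup>2) \<le> norm (2 * (f x)\<^sup>2 + 2 * (g x)\<^sup>2)"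
      using square_add_le by (intro AE_I2) auto
  qed measurable
  then show ?thesis by (simp add: sq_def)
qed

lemma sq_scale: "f \<in> sq \<Longrightarrow> (\<lambda>x. c * f x) \<in> sq"
  by (auto simp: sq_def power_mult_distrib)

lemma sq_diff: "f \<in> sq \<Longrightarrow> g \<in> sq \<Longrightarrow> (\<lambda>x. f x - g x) \<in> sq"
  using sq_add[OF _ sq_scale[of g "-1"]] by simp

lemma sq_integrable: "f \<in> sq \<Longrightarrow> integrable M (\<lambda>x. (f x)\<^sup>2)"
  by (simp add: sq_def)

lemma integral_add_square_le:
  assumes "f \<in> sq" "g \<in> sq"
  shows "(\<integral>x. (f x + g x)\<^sup>2 \<partial>M) \<le> 2 * (\<integral>x. (f x)\<^sup>2 \<partial>M) + 2 * (\<integral>x. (g x)\<^sup>2 \<partial>M)"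
proof -
  have "(\<integral>x. (f x + g x)\<^sup>2 \<partial>M) \<le> (\<integral>x. 2 * (f x)\<^sup>2 + 2 * (g x)\<^sup>2 \<partial>M)"
    using assms sq_add[OF assms] square_add_le
    by (intro integral_mono) (auto simp: sq_integrable)
  also have "\<dots> = 2 * (\<integral>x. (f x)\<^sup>2 \<partial>M) + 2 * (\<integral>x. (g x)\<^sup>2 \<partial>M)"
    using assms by (simp add: sq_integrable)
  finally show ?thesis .
qed

lemma R_subset_appr: "g \<in> R \<Longrightarrow> g \<in> appr"
  by (auto simp: appr_def R_sq intro!: bexI[of _ g])

lemma appr_cong:
  assumes "h \<in> appr" "\<And>x. x \<in> space M \<Longrightarrow> h' x = h x"
  shows "h' \<in> appr"
proof -
  have "h' \<in> sq"
    using assms measurable_cong[of M h' h borel]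
      Bochner_Integration.integrable_cong[OF refl, of M "\<lambda>x. (h' x)\<^sup>2" "\<lambda>x. (h x)\<^sup>2"]
    by (simp add: appr_def sq_def)
  moreover have "(\<integral>x. (h' x - g x)\<^sup>2 \<partial>M) = (\<integral>x. (h x - g x)\<^sup>2 \<partial>M)" for g
    by (intro Bochner_Integration.integral_cong) (auto simp: assms(2))
  ultimately show ?thesis using assms(1) by (simp add: appr_def)
qed

text \<open>The closure is its own closure, so limits can be taken repeatedly: from \<open>R\<close>
  to continuous functions of its members, to indicators, to simple functions, to all of
  \<open>sq\<close>.\<close>

lemma appr_closed:
  assumes h: "h \<in> sq" and ex: "\<And>\<epsilon>. \<epsilon> > 0 \<Longrightarrow> \<exists>u\<in>appr. (\<integral>x. (h x - u x)\<^sup>2 \<partial>M) < \<epsilon>"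
  shows "h \<in> appr"
proof -
  have "\<exists>g\<in>R. (\<integral>x. (h x - g x)\<^sup>2 \<partial>M) < \<epsilon>" if "\<epsilon> > 0" for \<epsilon>
  proof -
    have "\<epsilon> / 4 > 0" using that by simp
    from ex[OF this] obtain u where u: "u \<in> appr" "(\<integral>x. (h x - u x)\<^sup>2 \<partial>M) < \<epsilon> / 4"
      by blast
    then obtain g where g: "g \<in> R" "(\<integral>x. (u x - g x)\<^sup>2 \<partial>M) < \<epsilon> / 4"
      by (elim apprE[of u "\<epsilon> / 4"]) (use \<open>\<epsilon> > 0\<close> in auto)
    have "u \<in> sq" "g \<in> sq" using u(1) g(1) R_sq by (auto simp: appr_def)
    then have "(\<integral>x. ((h x - u x) + (u x - g x))\<^sup>2 \<partial>M) < \<epsilon>"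
      using integral_add_square_le[OF sq_diff[OF h] sq_diff, of u u g] u(2) g(2) by linarith
    with g(1) show ?thesis by auto
  qed
  with h show ?thesis by (simp add: appr_def)
qed

lemma appr_add: assumes "f \<in> appr" "g \<in> appr" shows "(\<lambda>x. f x + g x) \<in> appr"
proof -
  have fg: "f \<in> sq" "g \<in> sq" using assms by (auto simp: appr_def)
  have "\<exists>w\<in>R. (\<integral>x. ((f x + g x) - w x)\<^sup>2 \<partial>M) < \<epsilon>" if "\<epsilon> > 0" for \<epsilon>
  proof -
    obtain u where u: "u \<in> R" "(\<integral>x. (f x - u x)\<^sup>2 \<partial>M) < \<epsilon> / 4"
      by (rule apprE[OF assms(1), of "\<epsilon> / 4"]) (use \<open>\<epsilon> > 0\<close> in auto)
    obtain v where v: "v \<in> R" "(\<integral>x. (g x - v x)\<^sup>2 \<partial>M) < \<epsilon> / 4"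
      by (rule apprE[OF assms(2), of "\<epsilon> / 4"]) (use \<open>\<epsilon> > 0\<close> in auto)
    have "(\<integral>x. ((f x - u x) + (g x - v x))\<^sup>2 \<partial>M) < \<epsilon>"
      using integral_add_square_le[OF sq_diff[OF fg(1) R_sq[OF u(1)]] sq_diff[OF fg(2) R_sq[OF v(1)]]]
        u(2) v(2) by linarith
    then show ?thesis using add[OF u(1) v(1)] by (intro bexI[of _ "\<lambda>x. u x + v x"]) (auto simp: algebra_simps)
  qed
  with sq_add[OF fg] show ?thesis by (simp add: appr_def)
qed

lemma appr_scale: assumes "f \<in> appr" shows "(\<lambda>x. c * f x) \<in> appr"
proof (rule appr_closed)
  have f: "f \<in> sq" using assms by (simp add: appr_def)
  then show "(\<lambda>x. c * f x) \<in> sq" by (rule sq_scale)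
  fix \<epsilon> :: real assume "\<epsilon> > 0"
  have pos: "c\<^sup>2 + 1 > 0" by (simp add: add_nonneg_pos)
  obtain u where u: "u \<in> R" "(\<integral>x. (f x - u x)\<^sup>2 \<partial>M) < \<epsilon> / (c\<^sup>2 + 1)"
    by (rule apprE[OF assms, of "\<epsilon> / (c\<^sup>2 + 1)"]) (use \<open>\<epsilon> > 0\<close> pos in auto)
  have "(\<integral>x. (c * f x - c * u x)\<^sup>2 \<partial>M) = c\<^sup>2 * (\<integral>x. (f x - u x)\<^sup>2 \<partial>M)"
    by (simp add: power_mult_distrib flip: right_diff_distrib)
  also have "\<dots> \<le> (c\<^sup>2 + 1) * (\<integral>x. (f x - u x)\<^sup>2 \<partial>M)"
    by (intro mult_right_mono) auto
  also have "\<dots> < \<epsilon>" using u(2) pos by (simp add: pos_less_divide_eq mult.commute)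
  finally show "\<exists>u\<in>appr. (\<integral>x. (c * f x - u x)\<^sup>2 \<partial>M) < \<epsilon>"
    using R_subset_appr[OF mult[OF const[of c] u(1)]] by (intro bexI[of _ "\<lambda>x. c * u x"]) auto
qed

text \<open>Dominated convergence for the squared errors. The function \<open>w\<close> dominates
  the error rather than \<open>u k\<close>, which fits simple approximations of an unbounded
  \<open>h\<close>.\<close>

lemma appr_limit:
  assumes u: "\<And>k. u k \<in> appr" and h: "h \<in> borel_measurable M"
    and w: "w \<in> sq" "\<And>k x. x \<in> space M \<Longrightarrow> \<bar>h x - u k x\<bar> \<le> w x"
    and hsq: "h \<in> sq"
    and lim: "\<And>x. x \<in> space M \<Longrightarrow> (\<lambda>k. u k x) \<longlonglongrightarrow> h x"
  shows "h \<in> appr"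
proof (rule appr_closed[OF hsq])
  fix \<epsilon> :: real assume "\<epsilon> > 0"
  have [measurable]: "u k \<in> borel_measurable M" for k using u by (auto simp: appr_def sq_def)
  note [measurable] = h
  have "(\<lambda>k. \<integral>x. (h x - u k x)\<^sup>2 \<partial>M) \<longlonglongrightarrow> (\<integral>x. 0 \<partial>M)"
  proof (rule integral_dominated_convergence)
    show "integrable M (\<lambda>x. (w x)\<^sup>2)" using w(1) by (rule sq_integrable)
    show "AE x in M. (\<lambda>k. (h x - u k x)\<^sup>2) \<longlonglongrightarrow> 0"
    proof (rule AE_I2)
      fix x assume "x \<in> space M"
      have "(\<lambda>k. (h x - u k x)\<^sup>2) \<longlonglongrightarrow> (h x - h x)\<^sup>2"
        by (intro tendsto_intros lim \<open>x \<in> space M\<close>)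
      then show "(\<lambda>k. (h x - u k x)\<^sup>2) \<longlonglongrightarrow> 0" by simp
    qed
    show "AE x in M. norm ((h x - u k x)\<^sup>2) \<le> (w x)\<^sup>2" for k
    proof (rule AE_I2)
      fix x assume "x \<in> space M"
      from power_mono[OF w(2)[OF this, of k], of 2] show "norm ((h x - u k x)\<^sup>2) \<le> (w x)\<^sup>2" by simp
    qed
  qed measurable
  then have "\<forall>\<^sub>F k in sequentially. (\<integral>x. (h x - u k x)\<^sup>2 \<partial>M) < \<epsilon>"
    using \<open>\<epsilon> > 0\<close> by (intro order_tendstoD(2)[of _ 0]) auto
  then obtain k where "(\<integral>x. (h x - u k x)\<^sup>2 \<partial>M) < \<epsilon>"
    by (meson eventually_sequentially order_refl)
  with u show "\<exists>u\<in>appr. (\<integral>x. (h x - u x)\<^sup>2 \<partial>M) < \<epsilon>" by blast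
qed

text \<open>Approximation in mean does not pass to products, uniform approximation of bounded
  functions does. Products are therefore formed inside \<open>unif\<close>, and only the result is
  carried over to \<open>appr\<close>.\<close>

definition unif :: "('a \<Rightarrow> real) set" where
  "unif = {u \<in> borel_measurable M. \<forall>e>0. \<exists>g\<in>R. \<forall>x\<in>space M. \<bar>u x - g x\<bar> < e}"

lemma unifE:
  assumes "u \<in> unif" "e > 0"
  obtains g where "g \<in> R" "\<forall>x\<in>space M. \<bar>u x - g x\<bar> < e"
  using assms by (auto simp: unif_def)

lemma unif_bounded: assumes "u \<in> unif" shows "\<exists>B>0. \<forall>x\<in>space M. \<bar>u x\<bar> \<le> B"
proof -
  obtain g where "g \<in> R" "\<forall>x\<in>space M. \<bar>u x - g x\<bar> < 1"
    by (rule unifE[OF assms, of 1]) auto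
  moreover obtain B where "\<forall>x\<in>space M. \<bar>g x\<bar> \<le> B" using bounded[OF \<open>g \<in> R\<close>] by auto
  ultimately have "\<bar>u x\<bar> \<le> \<bar>B\<bar> + 1" if "x \<in> space M" for x using that by (smt (verit))
  then show ?thesis by (intro exI[of _ "\<bar>B\<bar> + 1"]) auto
qed

lemma unif_mult: assumes "u \<in> unif" "v \<in> unif" shows "(\<lambda>x. u x * v x) \<in> unif"
proof -
  have [measurable]: "u \<in> borel_measurable M" "v \<in> borel_measurable M"
    using assms by (auto simp: unif_def)
  obtain A where A: "A > 0" "\<And>x. x \<in> space M \<Longrightarrow> \<bar>v x\<bar> \<le> A"
    using unif_bounded[OF assms(2)] by auto
  have "\<exists>w\<in>R. \<forall>x\<in>space M. \<bar>u x * v x - w x\<bar> < e" if "e > 0" for e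
  proof -
    obtain g where g: "g \<in> R" "\<And>x. x \<in> space M \<Longrightarrow> \<bar>u x - g x\<bar> < e / (2 * A)"
      by (rule unifE[OF assms(1), of "e / (2 * A)"]) (use \<open>e > 0\<close> A(1) in auto)
    \<comment> \<open>The second summand below is bounded through the approximant \<open>g\<close>
      and not through \<open>u\<close>, so \<open>g\<close> has to be fixed before \<open>h\<close>.
      The added 1 keeps \<open>B\<close> positive as a divisor.\<close>
    obtain B0 where B0: "\<And>x. x \<in> space M \<Longrightarrow> \<bar>g x\<bar> \<le> B0" using bounded[OF g(1)] by auto
    define B where "B = \<bar>B0\<bar> + 1"
    have B: "B > 0" "\<And>x. x \<in> space M \<Longrightarrow> \<bar>g x\<bar> \<le> B" using B0 by (force simp: B_def)+
    obtain h where h: "h \<in> R" "\<And>x. x \<in> space M \<Longrightarrow> \<bar>v x - h x\<bar> < e / (2 * B)"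
      by (rule unifE[OF assms(2), of "e / (2 * B)"]) (use \<open>e > 0\<close> B(1) in auto)
    show ?thesis
    proof (intro bexI[of _ "\<lambda>x. g x * h x"] ballI mult g(1) h(1))
      fix x assume x: "x \<in> space M"
      have "\<bar>u x * v x - g x * h x\<bar> = \<bar>(u x - g x) * v x + g x * (v x - h x)\<bar>"
        by (simp add: algebra_simps)
      also have "\<dots> \<le> \<bar>u x - g x\<bar> * \<bar>v x\<bar> + \<bar>g x\<bar> * \<bar>v x - h x\<bar>"
        by (metis abs_mult abs_triangle_ineq)
      also have "\<dots> \<le> \<bar>u x - g x\<bar> * A + B * \<bar>v x - h x\<bar>"
        using A B x by (intro add_mono mult_left_mono mult_right_mono) auto
      also have "\<dots> < e / (2 * A) * A + B * (e / (2 * B))"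
        using A B x g(2) h(2) by (intro add_strict_mono mult_strict_left_mono mult_strict_right_mono) auto
      also have "\<dots> = e" using A B by simp
      finally show "\<bar>u x * v x - g x * h x\<bar> < e" .
    qed
  qed
  then show ?thesis by (simp add: unif_def)
qed

lemma unif_prod: "(\<And>i. i \<in> F \<Longrightarrow> u i \<in> unif) \<Longrightarrow> (\<lambda>x. \<Prod>i\<in>F. u i x) \<in> unif"
proof (induction F rule: infinite_finite_induct)
  case (insert i F) then show ?case by (auto intro!: unif_mult)
qed (use const[of 1] in \<open>auto simp: unif_def intro!: bexI[of _ "\<lambda>_. 1"]\<close>)

lemma polynomial_in_R:
  assumes "real_polynomial_function p" "g \<in> R"
  shows "(\<lambda>x. p (g x)) \<in> R"
  using assms(1)
proof (induction p rule: real_polynomial_function.induct)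
  case (linear h)
  have "h t = t * h 1" for t :: real
    using linear_cmul[OF bounded_linear.linear[OF linear], of t 1] by simp
  then have "(\<lambda>x. h (g x)) = (\<lambda>x. g x * h 1)" by (intro ext)
  then show ?case using mult[OF assms(2) const] by simp
qed (auto intro: const add mult)

text \<open>A member of \<open>R\<close> has bounded range, so Weierstrass applies on a compact
  interval, and a polynomial in \<open>g\<close> stays in the algebra.\<close>

lemma unif_compose:
  assumes g: "g \<in> R" and h: "continuous_on UNIV h"
  shows "(\<lambda>x. h (g x)) \<in> unif"
proof -
  obtain B where B: "\<And>x. x \<in> space M \<Longrightarrow> \<bar>g x\<bar> \<le> B" using bounded[OF g] by auto
  have "\<exists>w\<in>R. \<forall>x\<in>space M. \<bar>h (g x) - w x\<bar> < e" if "e > 0" for e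
  proof -
    obtain p where p: "real_polynomial_function p" "\<And>t. t \<in> {-B..B} \<Longrightarrow> \<bar>h t - p t\<bar> < e"
      by (rule Stone_Weierstrass_real_polynomial_function[of "{-B..B}" h e]) (use \<open>e > 0\<close> continuous_on_subset[OF h] in auto)
    show ?thesis
      by (intro bexI[OF _ polynomial_in_R[OF p(1) g]] ballI p(2)) (use B in \<open>force simp: abs_le_iff\<close>)
  qed
  moreover have "(\<lambda>x. h (g x)) \<in> borel_measurable M"
    using meas[OF g] borel_measurable_continuous_onI[OF h] by measurable
  ultimately show ?thesis by (simp add: unif_def)
qed

lemma unif_subset_appr: assumes "u \<in> unif" shows "u \<in> appr"
proof -
  have um: "u \<in> borel_measurable M" using assms by (simp add: unif_def)
  have usq: "u \<in> sq" using unif_bounded[OF assms] um by (auto intro: sq_bounded)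
  have "\<forall>k. \<exists>g\<in>R. \<forall>x\<in>space M. \<bar>u x - g x\<bar> < 1 / real (Suc k)"
    using assms by (auto simp: unif_def)
  then obtain g where g: "\<And>k. g k \<in> R" "\<And>k x. x \<in> space M \<Longrightarrow> \<bar>u x - g k x\<bar> < 1 / real (Suc k)"
    by metis
  show ?thesis
  proof (rule appr_limit[of g u "\<lambda>_. 1"])
    show "\<bar>u x - g k x\<bar> \<le> 1" if "x \<in> space M" for k x
    proof -
      have "1 / real (Suc k) \<le> 1" by simp
      with g(2)[OF that, of k] show ?thesis by linarith
    qed
    show "(\<lambda>k. g k x) \<longlonglongrightarrow> u x" if "x \<in> space M" for x
    proof (rule LIM_zero_cancel, rule Lim_null_comparison)
      show "\<forall>\<^sub>F k in sequentially. norm (g k x - u x) \<le> 1 / real (Suc k)"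
        using less_imp_le[OF g(2)[OF that]] by (auto simp: abs_minus_commute)
      show "(\<lambda>k. 1 / real (Suc k)) \<longlonglongrightarrow> 0" by (rule LIMSEQ_Suc[OF lim_1_over_n])
    qed
  qed (use g um usq R_subset_appr in \<open>auto intro!: sq_bounded[of _ 1]\<close>)
qed

lemma indicator_basic_appr:
  assumes P: "finite P" "P \<subseteq> R \<times> UNIV"
  shows "indicator {x \<in> space M. \<forall>(g, c)\<in>P. g x > c} \<in> appr"
proof -
  \<comment> \<open>A ramp clipped to \<open>[0, 1]\<close>. It vanishes at 0 for every
    \<open>k\<close>, so its limit is the indicator of \<open>t > 0\<close> and the products tend to
    the indicator of an intersection of strict superlevel sets.\<close>
  define \<psi> where "\<psi> = (\<lambda>(k::nat) (t::real). min 1 (max 0 (real k * t)))"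
  define u where "u = (\<lambda>k x. \<Prod>(g, c)\<in>P. \<psi> k (g x - c))"
  let ?E = "{x \<in> space M. \<forall>(g, c)\<in>P. g x > c}"
  have u: "u k \<in> unif" for k
    unfolding u_def
  proof (rule unif_prod, clarify)
    fix g c assume "(g, c) \<in> P"
    then have "g \<in> R" using P by auto
    then show "(\<lambda>x. \<psi> k (g x - c)) \<in> unif"
      unfolding \<psi>_def by (rule unif_compose) (intro continuous_intros)
  qed
  have bnd: "0 \<le> u k x \<and> u k x \<le> 1" for k x
    unfolding u_def by (auto intro!: prod_nonneg prod_le_1 simp: \<psi>_def split: prod.splits)
  have lim\<psi>: "(\<lambda>k. \<psi> k t) \<longlonglongrightarrow> (if t > 0 then 1 else 0)" for t
  proof (cases "t > 0")
    case True
    obtain k0 :: nat where k0: "1 / t < real k0" using reals_Archimedean2 by blast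
    have "\<psi> k t = 1" if "k \<ge> k0" for k
    proof -
      have "1 < real k0 * t" using k0 True by (simp add: divide_less_eq)
      also have "\<dots> \<le> real k * t" using that True by simp
      finally show ?thesis by (simp add: \<psi>_def)
    qed
    then have "\<forall>\<^sub>F k in sequentially. \<psi> k t = 1" by (auto simp: eventually_sequentially)
    with True show ?thesis by (simp add: tendsto_eventually)
  next
    case False
    then have "\<psi> k t = 0" for k by (simp add: \<psi>_def mult_nonneg_nonpos max.absorb1)
    with False show ?thesis by simp
  qed
  have lim: "(\<lambda>k. u k x) \<longlonglongrightarrow> indicator ?E x" if "x \<in> space M" for x
  proof -
    have "(\<lambda>k. u k x) \<longlonglongrightarrow> (\<Prod>(g, c)\<in>P. if g x - c > 0 then 1 else 0)"
      unfolding u_def by (intro tendsto_prod) (auto simp only: split: prod.splits intro!: lim\<psi>)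
    also have "(\<Prod>(g, c)\<in>P. if g x - c > 0 then 1 else 0) = (indicator ?E x :: real)"
    proof (cases "x \<in> ?E")
      case True then show ?thesis by (auto intro!: prod.neutral)
    next
      case False
      then obtain g c where "(g, c) \<in> P" "\<not> g x > c" using \<open>x \<in> space M\<close> by auto
      with P False show ?thesis by (auto intro!: prod_zero bexI[of _ "(g, c)"])
    qed
    finally show ?thesis .
  qed
  have [measurable]: "?E \<in> sets M"
  proof -
    have "?E = {x \<in> space M. \<forall>p\<in>P. fst p x > snd p}" by (auto simp: case_prod_beta)
    also have "\<dots> \<in> sets M"
    proof (rule sets.sets_Collect_finite_All[OF _ P(1)])
      fix p assume "p \<in> P"
      then have [measurable]: "fst p \<in> borel_measurable M" using P meas by auto
      show "{x \<in> space M. fst p x > snd p} \<in> sets M" by measurable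
    qed
    finally show ?thesis .
  qed
  show ?thesis
  proof (rule appr_limit[of u _ "\<lambda>_. 1"])
    show "\<bar>indicator ?E x - u k x\<bar> \<le> 1" for k x
      using bnd[of k x] by (auto simp: indicator_def)
  qed (use u lim unif_subset_appr in \<open>auto intro!: sq_bounded[of _ 1] simp: indicator_def\<close>)
qed

lemma indicator_appr:
  assumes "E \<in> sets M"
  shows "indicator E \<in> appr"
proof -
  define G where "G = {{x \<in> space M. \<forall>(g, c)\<in>P. g x > c} | P. finite P \<and> P \<subseteq> R \<times> (UNIV :: real set)}"
  have Gsub: "G \<subseteq> Pow (space M)" by (auto simp: G_def)
  \<comment> \<open>\<open>G\<close> contains all superlevel sets of members of \<open>R\<close>, so
    \<open>generating\<close> applies to the \<sigma>-algebra generated by \<open>G\<close>.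
    Allowing finite families \<open>P\<close>, and not just single inequalities, makes
    \<open>G\<close> stable under intersection.\<close>
  have "sets M \<subseteq> sets (sigma (space M) G)"
  proof (rule generating)
    fix g assume g: "g \<in> R"
    show "g \<in> borel_measurable (sigma (space M) G)"
      unfolding borel_measurable_iff_greater
    proof
      fix c
      have "{x \<in> space M. g x > c} \<in> G"
        unfolding G_def using g by (intro CollectI exI[of _ "{(g, c)}"]) auto
      then show "{x \<in> space (sigma (space M) G). c < g x} \<in> sets (sigma (space M) G)"
        using Gsub by (simp add: space_measure_of sets_measure_of sigma_sets.Basic)
    qed
  qed (use Gsub in \<open>simp add: space_measure_of\<close>)
  with assms Gsub have "E \<in> sigma_sets (space M) G" by (auto simp: sets_measure_of)
  moreover have "Int_stable G"
  proof (rule Int_stableI)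
    fix a b assume "a \<in> G" "b \<in> G"
    then obtain P Q where "a = {x \<in> space M. \<forall>(g, c)\<in>P. g x > c}" "finite P" "P \<subseteq> R \<times> UNIV"
      "b = {x \<in> space M. \<forall>(g, c)\<in>Q. g x > c}" "finite Q" "Q \<subseteq> R \<times> UNIV"
      by (auto simp: G_def)
    then show "a \<inter> b \<in> G" unfolding G_def by (intro CollectI exI[of _ "P \<union> Q"]) auto
  qed
  have GM: "sigma_sets (space M) G \<subseteq> sets M"
  proof (rule sets.sigma_sets_subset, safe)
    fix a assume "a \<in> G"
    then obtain P where P: "a = {x \<in> space M. \<forall>(g, c)\<in>P. g x > c}" "finite P" "P \<subseteq> R \<times> UNIV"
      by (auto simp: G_def)
    from indicator_basic_appr[OF P(2,3)] have "(indicator a :: _ \<Rightarrow> real) \<in> borel_measurable M"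
      by (simp add: P(1) appr_def sq_def)
    then show "a \<in> sets M" using P(1) by (subst (asm) borel_measurable_indicator_iff) (auto simp: Int_absorb2)
  qed
  show ?thesis
    using \<open>Int_stable G\<close> Gsub \<open>E \<in> sigma_sets (space M) G\<close>
  proof (induction rule: sigma_sets_induct_disjoint)
    case (basic A)
    then show ?case using indicator_basic_appr by (auto simp: G_def)
  next
    case empty
    then show ?case using R_subset_appr[OF const[of 0]] by simp
  next
    case (compl A)
    have "(\<lambda>x. 1 + (-1) * indicator A x) \<in> appr"
      by (intro appr_add R_subset_appr[OF const] appr_scale compl)
    then show ?case by (rule appr_cong) (simp add: indicator_def)
  next
    case (union A)
    then have AM: "A i \<in> sets M" for i using GM by auto
    have s: "(\<lambda>x. \<Sum>i<k. indicator (A i) x) \<in> appr" for k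
      by (induction k) (use union in \<open>auto intro!: appr_add R_subset_appr[OF const]\<close>)
    \<comment> \<open>Disjointness turns the partial sums into indicators, so the constant 1
      dominates the error in \<open>appr_limit\<close>.\<close>
    have eq: "(\<Sum>i<k. indicator (A i) x) = (indicator (\<Union>i<k. A i) x :: real)" for k x
      using union(1) by (subst indicator_UN_disjoint) (auto simp: disjoint_family_on_def)
    show ?case
    proof (rule appr_limit[of "\<lambda>k. indicator (\<Union>i<k. A i)" _ "\<lambda>_. 1"])
      show "indicator (\<Union>i<k. A i) \<in> appr" for k using s[of k] by (simp add: eq)
      show "(\<lambda>k. indicator (\<Union>i<k. A i) x) \<longlonglongrightarrow> (indicator (\<Union>i. A i) x :: real)" for x
        by (rule LIMSEQ_indicator_UN)
    qed (use AM in \<open>auto intro!: sq_bounded[of _ 1] simp: indicator_def\<close>)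
  qed
qed

lemma dense:
  assumes h: "h \<in> borel_measurable M" "integrable M (\<lambda>x. (h x)\<^sup>2)" and "\<epsilon> > 0"
  shows "\<exists>g\<in>R. (\<integral>x. (h x - g x)\<^sup>2 \<partial>M) < \<epsilon>"
proof -
  obtain s where s: "\<And>i. simple_function M (s i)" "\<And>x. x \<in> space M \<Longrightarrow> (\<lambda>i. s i x) \<longlonglongrightarrow> h x"
    "\<And>i x. x \<in> space M \<Longrightarrow> dist (s i x) 0 \<le> 2 * dist (h x) 0"
    using borel_measurable_implies_sequence_metric[OF h(1), of 0] by metis
  have simp: "s i \<in> appr" for i
  proof -
    have "(\<lambda>x. \<Sum>y\<in>s i ` space M. y * indicator (s i -` {y} \<inter> space M) x) \<in> appr" (is "?r \<in> _")
    proof -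
      have fin: "finite (s i ` space M)" using s(1) by (simp add: simple_function_def)
      have ind: "(\<lambda>x. y * indicator (s i -` {y} \<inter> space M) x) \<in> appr" for y
        by (intro appr_scale indicator_appr simple_functionD(2)[OF s(1)])
      have "(\<lambda>x. \<Sum>y\<in>Y. y * indicator (s i -` {y} \<inter> space M) x) \<in> appr" if "finite Y" for Y
        using that
      proof (induction rule: finite_induct)
        case (insert y Y)
        show ?case
          unfolding sum.insert[OF insert(1,2)] by (intro appr_add ind insert)
      qed (simp add: R_subset_appr[OF const])
      from this[OF fin] show ?thesis .
    qed
    moreover have "s i x = ?r x" if "x \<in> space M" for x
    proof -
      have "?r x = (\<Sum>y\<in>s i ` space M. if y = s i x then y else 0)"
        using that by (intro sum.cong) (auto simp: indicator_def)
      also have "\<dots> = s i x" using that s(1)[of i] by (simp add: simple_function_def)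
      finally show ?thesis by simp
    qed
    ultimately show ?thesis by (rule appr_cong)
  qed
  have "h \<in> appr"
  \<comment> \<open>The simple approximations are bounded by twice the modulus of \<open>h\<close>,
    hence the factor 3 for the error.\<close>
  proof (rule appr_limit[OF simp h(1), of "\<lambda>x. 3 * \<bar>h x\<bar>"])
    show "(\<lambda>x. 3 * \<bar>h x\<bar>) \<in> sq" using h by (simp add: sq_def power_mult_distrib)
    show "\<bar>h x - s k x\<bar> \<le> 3 * \<bar>h x\<bar>" if "x \<in> space M" for k x
      using s(3)[OF that, of k] by (simp add: dist_real_def)
  qed (use h s(2) in \<open>auto simp: sq_def\<close>)
  with \<open>\<epsilon> > 0\<close> show ?thesis by (simp add: appr_def)
qed

lemma dense_complex:
  assumes h: "h \<in> L2 M" and "\<epsilon> > 0"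
  shows "\<exists>g1\<in>R. \<exists>g2\<in>R. (\<integral>x. (cmod (h x - Complex (g1 x) (g2 x)))\<^sup>2 \<partial>M) < \<epsilon>"
proof -
  note [measurable] = L2_measurable[OF h]
  have "integrable M (\<lambda>x. (Re (h x))\<^sup>2)" "integrable M (\<lambda>x. (Im (h x))\<^sup>2)"
    by (rule Bochner_Integration.integrable_bound[OF L2_integrable[OF h]];
        auto simp: cmod_power2)+
  then obtain g1 g2 where g: "g1 \<in> R" "(\<integral>x. (Re (h x) - g1 x)\<^sup>2 \<partial>M) < \<epsilon> / 2"
      "g2 \<in> R" "(\<integral>x. (Im (h x) - g2 x)\<^sup>2 \<partial>M) < \<epsilon> / 2"
    using dense[of "\<lambda>x. Re (h x)" "\<epsilon> / 2"] dense[of "\<lambda>x. Im (h x)" "\<epsilon> / 2"] \<open>\<epsilon> > 0\<close> by auto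
  have "(\<lambda>x. Re (h x)) \<in> sq" "(\<lambda>x. Im (h x)) \<in> sq"
    using \<open>integrable M (\<lambda>x. (Re (h x))\<^sup>2)\<close> \<open>integrable M (\<lambda>x. (Im (h x))\<^sup>2)\<close> by (auto simp: sq_def)
  then have "(\<integral>x. (Re (h x) - g1 x)\<^sup>2 + (Im (h x) - g2 x)\<^sup>2 \<partial>M) < \<epsilon>"
    using g sq_integrable[OF sq_diff[OF _ R_sq]] by (subst Bochner_Integration.integral_add) auto
  then show ?thesis using g(1,3) by (intro bexI[of _ g1] bexI[of _ g2]) (auto simp: cmod_power2)
qed

end

text \<open>The factor before the first term can be brought as close to 1 as desired, at the cost of
  a large factor before the second, which will be small. With the constants 2 of
  \<open>cmod_add_square_le\<close> the comparison on the torus would lose a factor.\<close>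

lemma cmod_add_square_le_weighted:
  assumes "t > 0"
  shows "(cmod (a + b))\<^sup>2 \<le> (1 + t) * (cmod a)\<^sup>2 + (1 + 1 / t) * (cmod b)\<^sup>2"
proof -
  have "(cmod (a + b))\<^sup>2 \<le> (cmod a + cmod b)\<^sup>2" by (intro power_mono norm_triangle_ineq) auto
  also have "\<dots> = (cmod a)\<^sup>2 + (cmod b)\<^sup>2 + 2 * cmod a * cmod b" by (simp add: power2_sum)
  also have "2 * cmod a * cmod b \<le> t * (cmod a)\<^sup>2 + (1 / t) * (cmod b)\<^sup>2"
    using sum_squares_bound[of "sqrt t * cmod a" "cmod b / sqrt t"] assms
    by (simp add: power_mult_distrib power_divide)
  finally show ?thesis by (simp add: algebra_simps)
qed

lemma integral_add_square_le_weighted: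
  assumes f: "f \<in> L2 M" and g: "g \<in> L2 M" and t: "t > 0"
  shows "(\<integral>x. (cmod (f x + g x))\<^sup>2 \<partial>M) \<le> (1 + t) * (\<integral>x. (cmod (f x))\<^sup>2 \<partial>M) + (1 + 1 / t) * (\<integral>x. (cmod (g x))\<^sup>2 \<partial>M)"
proof -
  have "(\<integral>x. (cmod (f x + g x))\<^sup>2 \<partial>M) \<le> (\<integral>x. (1 + t) * (cmod (f x))\<^sup>2 + (1 + 1 / t) * (cmod (g x))\<^sup>2 \<partial>M)"
    using L2_integrable[OF f] L2_integrable[OF g] L2_integrable[OF L2_add[OF f g]]
    by (intro integral_mono cmod_add_square_le_weighted[OF t]) auto
  also have "\<dots> = (1 + t) * (\<integral>x. (cmod (f x))\<^sup>2 \<partial>M) + (1 + 1 / t) * (\<integral>x. (cmod (g x))\<^sup>2 \<partial>M)"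
    using L2_integrable[OF f] L2_integrable[OF g] by simp
  finally show ?thesis .
qed

section \<open>Finite linear combinations of a family of functions\<close>

definition combinations :: "'i set \<Rightarrow> ('i \<Rightarrow> 'a \<Rightarrow> complex) \<Rightarrow> ('a \<Rightarrow> complex) set" where
  "combinations I e = {\<lambda>x. \<Sum>i\<in>F. c i * e i x | F c. finite F \<and> F \<subseteq> I}"

lemma combinations_base: "i \<in> I \<Longrightarrow> e i \<in> combinations I e"
  unfolding combinations_def by (intro CollectI exI[of _ "{i}"] exI[of _ "\<lambda>_. 1"]) auto

lemma combinations_zero: "(\<lambda>_. 0) \<in> combinations I e"
  unfolding combinations_def by (intro CollectI exI[of _ "{}"]) auto

lemma combinations_scale:
  assumes "f \<in> combinations I e" shows "(\<lambda>x. k * f x) \<in> combinations I e"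
proof -
  obtain F c where "finite F" "F \<subseteq> I" "f = (\<lambda>x. \<Sum>i\<in>F. c i * e i x)"
    using assms by (auto simp: combinations_def)
  then show ?thesis
    unfolding combinations_def
    by (intro CollectI exI[of _ F] exI[of _ "\<lambda>i. k * c i"]) (auto simp: sum_distrib_left mult.assoc)
qed

lemma combinations_add:
  assumes "f \<in> combinations I e" "g \<in> combinations I e" shows "(\<lambda>x. f x + g x) \<in> combinations I e"
proof -
  obtain F c where F: "finite F" "F \<subseteq> I" "f = (\<lambda>x. \<Sum>i\<in>F. c i * e i x)"
    using assms(1) by (auto simp: combinations_def)
  obtain G d where G: "finite G" "G \<subseteq> I" "g = (\<lambda>x. \<Sum>i\<in>G. d i * e i x)"
    using assms(2) by (auto simp: combinations_def)
  define h where "h = (\<lambda>i. (if i \<in> F then c i else 0) + (if i \<in> G then d i else 0))"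
  have "f x = (\<Sum>i\<in>F \<union> G. (if i \<in> F then c i else 0) * e i x)" for x
    unfolding F(3) using F(1) G(1) by (intro sum.mono_neutral_cong_left) auto
  moreover have "g x = (\<Sum>i\<in>F \<union> G. (if i \<in> G then d i else 0) * e i x)" for x
    unfolding G(3) using F(1) G(1) by (intro sum.mono_neutral_cong_left) auto
  ultimately have "(\<lambda>x. f x + g x) = (\<lambda>x. \<Sum>i\<in>F \<union> G. h i * e i x)"
    by (simp add: h_def distrib_right sum.distrib)
  with F G show ?thesis
    unfolding combinations_def by (intro CollectI exI[of _ "F \<union> G"] exI[of _ h]) auto
qed

lemma combinations_sum:
  "(\<And>j. j \<in> J \<Longrightarrow> f j \<in> combinations I e) \<Longrightarrow> (\<lambda>x. \<Sum>j\<in>J. f j x) \<in> combinations I e"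
  by (induction J rule: infinite_finite_induct) (auto intro: combinations_zero combinations_add)

section \<open>Multipliers of double Dirichlet series\<close>

lemma summable_on_times:
  fixes f :: "'a \<Rightarrow> real" and g :: "'b \<Rightarrow> real"
  assumes "f summable_on A" "g summable_on B" "\<And>x. x \<in> A \<Longrightarrow> f x \<ge> 0" "\<And>y. y \<in> B \<Longrightarrow> g y \<ge> 0"
  shows "(\<lambda>(x, y). f x * g y) summable_on A \<times> B"
proof (rule summable_on_SigmaI)
  show "((\<lambda>y. case (x, y) of (x, y) \<Rightarrow> f x * g y) has_sum f x * infsum g B) B" for x
    using has_sum_cmult_right[OF has_sum_infsum[OF assms(2)], of "f x"] by simp
  show "(\<lambda>x. f x * infsum g B) summable_on A"
    by (rule summable_on_cmult_left[OF assms(1)])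
qed (use assms in auto)

lemma infsum_split_finite:
  fixes u :: "'a \<Rightarrow> 'b::banach"
  assumes "u summable_on A" "finite X" "X \<subseteq> A"
  shows "infsum u A = sum u X + infsum u (A - X)"
proof -
  have "u summable_on (A - X)" by (rule summable_on_subset_banach[OF assms(1)]) auto
  then have "infsum u (X \<union> (A - X)) = infsum u X + infsum u (A - X)"
    using assms(2) by (intro infsum_Un_disjoint) auto
  moreover have "X \<union> (A - X) = A" using assms(3) by auto
  ultimately show ?thesis using assms(2) by simp
qed

text \<open>Tannery's theorem. A finite \<open>X\<close> carries all but \<open>e / 4\<close> of the
  majorant; on \<open>X\<close> convergence is termwise, and off \<open>X\<close> both the sums and
  the limit are at most the tail of \<open>g\<close>.\<close>

lemma tendsto_infsum_dominated:
  fixes f :: "nat \<Rightarrow> 'a \<Rightarrow> complex"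
  assumes g: "g summable_on A" and le: "\<And>n i. i \<in> A \<Longrightarrow> cmod (f n i) \<le> g i"
    and lim: "\<And>i. i \<in> A \<Longrightarrow> (\<lambda>n. f n i) \<longlonglongrightarrow> h i"
  shows "(\<lambda>n. \<Sum>\<^sub>\<infinity>i\<in>A. f n i) \<longlonglongrightarrow> (\<Sum>\<^sub>\<infinity>i\<in>A. h i)"
proof -
  have leh: "cmod (h i) \<le> g i" if "i \<in> A" for i
    by (rule tendsto_upperbound[OF tendsto_norm[OF lim[OF that]]]) (use le[OF that] in auto)
  have sf: "f n summable_on B" if "B \<subseteq> A" for n B
    by (rule abs_summable_summable, rule Infinite_Sum.abs_summable_on_comparison_test'[OF summable_on_subset[OF g that]])
       (use le that in auto)
  have sh: "h summable_on B" if "B \<subseteq> A" for B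
    by (rule abs_summable_summable, rule Infinite_Sum.abs_summable_on_comparison_test'[OF summable_on_subset[OF g that]])
       (use leh that in auto)
  show ?thesis
  proof (rule LIMSEQ_I)
    fix e :: real assume "e > 0"
    obtain X where X: "finite X" "X \<subseteq> A" "dist (sum g X) (infsum g A) \<le> e / 4"
      using infsum_finite_approximation[OF g, of "e / 4"] \<open>e > 0\<close> by auto
    note split = infsum_split_finite[OF _ X(1,2)]
    have tail: "infsum g (A - X) \<le> e / 4"
      using X(3) split[OF g] by (simp add: dist_real_def)
    have tl: "cmod (infsum u (A - X)) \<le> e / 4" if "\<And>i. i \<in> A \<Longrightarrow> cmod (u i) \<le> g i" for u
    proof -
      have s: "(\<lambda>i. cmod (u i)) summable_on (A - X)"
        by (rule Infinite_Sum.abs_summable_on_comparison_test'[OF summable_on_subset[OF g]]) (use that in auto)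
      have "cmod (infsum u (A - X)) \<le> (\<Sum>\<^sub>\<infinity>i\<in>A - X. cmod (u i))"
        by (rule norm_infsum_bound[OF s])
      also have "\<dots> \<le> infsum g (A - X)"
        by (rule infsum_mono[OF s summable_on_subset[OF g]]) (use that in auto)
      finally show ?thesis using tail by simp
    qed
    have "(\<lambda>n. \<Sum>i\<in>X. f n i) \<longlonglongrightarrow> (\<Sum>i\<in>X. h i)"
      by (intro tendsto_sum lim) (use X in auto)
    then obtain n0 where n0: "\<And>n. n \<ge> n0 \<Longrightarrow> cmod ((\<Sum>i\<in>X. f n i) - (\<Sum>i\<in>X. h i)) < e / 4"
      using LIMSEQ_D[of _ _ "e / 4"] \<open>e > 0\<close> by (metis divide_pos_pos zero_less_numeral)
    show "\<exists>n0. \<forall>n\<ge>n0. cmod (infsum (f n) A - infsum h A) < e"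
    proof (intro exI[of _ n0] allI impI)
      fix n assume "n \<ge> n0"
      have "infsum (f n) A - infsum h A =
          ((\<Sum>i\<in>X. f n i) - (\<Sum>i\<in>X. h i)) + infsum (f n) (A - X) - infsum h (A - X)"
        using split[OF sf[OF order_refl], of n] split[OF sh[OF order_refl]] by simp
      also have "cmod \<dots> \<le> cmod ((\<Sum>i\<in>X. f n i) - (\<Sum>i\<in>X. h i)) + cmod (infsum (f n) (A - X))
          + cmod (infsum h (A - X))"
        by (meson add_mono norm_triangle_ineq norm_triangle_ineq4 order_trans order_refl)
      also have "\<dots> < e / 4 + e / 4 + e / 4"
        using n0[OF \<open>n \<ge> n0\<close>] tl[OF le, of "\<lambda>_. n"] tl[OF leh] by linarith
      finally show "cmod (infsum (f n) A - infsum h A) < e" using \<open>e > 0\<close> by simp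
    qed
  qed
qed

text \<open>Matrix of Dirichlet convolution with \<open>a\<close> on pairs: row \<open>k\<close>,
  column \<open>i\<close> holds the coefficient at the quotient of \<open>k\<close> by
  \<open>i\<close>. In terms of prime exponents the entry depends on a difference, whence the
  name.\<close>

definition toeplitz :: "(nat \<Rightarrow> nat \<Rightarrow> complex) \<Rightarrow> nat \<times> nat \<Rightarrow> nat \<times> nat \<Rightarrow> complex" where
  "toeplitz a k i = (if fst i dvd fst k \<and> snd i dvd snd k
     then a (fst k div fst i) (snd k div snd i) else 0)"

text \<open>Convolution with \<open>a\<close> has operator norm at most \<open>C\<close>, tested on
  finite sections, so that only finite sums occur. The form is bilinear: \<open>c\<close> carries no
  conjugate.\<close>

definition multiplier_bound :: "(nat \<Rightarrow> nat \<Rightarrow> complex) \<Rightarrow> real \<Rightarrow> bool" where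
  "multiplier_bound a C \<longleftrightarrow>
     (\<forall>E K b c. finite E \<and> finite K \<and> E \<subseteq> index_pairs \<and> K \<subseteq> index_pairs \<longrightarrow>
        cmod (\<Sum>k\<in>K. \<Sum>i\<in>E. toeplitz a k i * b i * c k)
          \<le> C * sqrt (\<Sum>i\<in>E. (cmod (b i))\<^sup>2) * sqrt (\<Sum>k\<in>K. (cmod (c k))\<^sup>2))"

definition pair_times :: "nat \<times> nat \<Rightarrow> nat \<times> nat \<Rightarrow> nat \<times> nat" where
  "pair_times i j = (fst i * fst j, snd i * snd j)"

definition dirichlet_monomial :: "complex \<times> complex \<Rightarrow> nat \<times> nat \<Rightarrow> complex" where
  "dirichlet_monomial p i = of_nat (fst i) powr (- fst p) * of_nat (snd i) powr (- snd p)"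

lemma norm_of_nat_powr: "cmod (of_nat n powr (- s)) = real n powr (- Re s)"
  by (subst norm_powr_real_powr) auto

lemma norm_dirichlet_monomial:
  "cmod (dirichlet_monomial p i) = real (fst i) powr (- Re (fst p)) * real (snd i) powr (- Re (snd p))"
  by (simp add: dirichlet_monomial_def norm_mult norm_of_nat_powr)

lemma dirichlet_monomial_times:
  "dirichlet_monomial p (pair_times i j) = dirichlet_monomial p i * dirichlet_monomial p j"
  by (simp add: dirichlet_monomial_def pair_times_def powr_times_real_left)

lemma norm_dirichlet_monomial_le_1:
  assumes "i \<in> index_pairs" "Re (fst p) \<ge> 0" "Re (snd p) \<ge> 0"
  shows "cmod (dirichlet_monomial p i) \<le> 1"
proof -
  have "real n powr (- r) \<le> 1" if "n \<ge> 1" "r \<ge> 0" for n r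
    using that powr_mono2'[of "-r" 1 "real n"] by (auto simp: powr_minus inverse_le_1_iff ge_one_powr_ge_zero)
  with assms show ?thesis
    unfolding norm_dirichlet_monomial by (auto simp: index_pairs_def intro!: mult_le_one)
qed

lemma norm_dirichlet_monomial_antimono:
  assumes "i \<in> index_pairs" "Re (fst p) \<ge> Re (fst q)" "Re (snd p) \<ge> Re (snd q)"
  shows "cmod (dirichlet_monomial p i) \<le> cmod (dirichlet_monomial q i)"
  using assms unfolding norm_dirichlet_monomial
  by (auto simp: index_pairs_def intro!: mult_mono powr_mono)

section \<open>Integers without large prime factors\<close>

definition smooth_numbers :: "nat \<Rightarrow> nat set" where
  "smooth_numbers N = {m. m \<ge> 1 \<and> (\<forall>p. prime p \<and> p dvd m \<longrightarrow> p \<le> N)}"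

text \<open>Over all integers the series diverges when \<sigma> \<le> 1. With the primes bounded by
  \<open>N\<close> it is a finite Euler product, built here one prime at a time: every new prime
  contributes a geometric factor.\<close>

lemma smooth_summable:
  assumes "\<sigma> > 0"
  shows "(\<lambda>m. real m powr (- \<sigma>)) summable_on smooth_numbers N"
proof (induction N)
  case 0
  have "smooth_numbers 0 = {1}"
    using prime_factor_nat by (auto simp: smooth_numbers_def) (metis less_numeral_extra(3) prime_gt_0_nat not_one_le_zero le_zero_eq)
  then show ?case by simp
next
  case (Suc N)
  show ?case
  proof (cases "prime (Suc N)")
    case False
    then have "smooth_numbers (Suc N) = smooth_numbers N"
      by (auto simp: smooth_numbers_def le_Suc_eq)
    with Suc show ?thesis by simp
  next
    case True
    define p where "p = Suc N"
    have p: "prime p" "p > 1" using True prime_gt_1_nat by (auto simp: p_def)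
    \<comment> \<open>Splits off the exact power of \<open>p\<close>. The cofactor is smooth for the
      smaller bound, and \<open>m\<close> is recovered as the product, so the map is
      injective.\<close>
    define h where "h = (\<lambda>m. (multiplicity p m, m div p ^ multiplicity p m))"
    define g where "g = (\<lambda>(j::nat, m::nat). (real p powr (- \<sigma>)) ^ j * real m powr (- \<sigma>))"
    have decomp: "m = p ^ multiplicity p m * (m div p ^ multiplicity p m)" for m :: nat
      by (simp add: multiplicity_dvd)
    have hS: "h ` smooth_numbers (Suc N) \<subseteq> UNIV \<times> smooth_numbers N"
    proof safe
      fix m j l assume m: "m \<in> smooth_numbers (Suc N)" and "(j, l) = h m"
      then have l: "l = m div p ^ multiplicity p m" by (simp add: h_def)
      have m0: "m \<noteq> 0" using m by (auto simp: smooth_numbers_def)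
      have "\<not> p dvd l" unfolding l
        using p m0 by (intro multiplicity_decompose) auto
      moreover have "l dvd m" using decomp[of m] l by (metis dvd_triv_right)
      moreover have "l \<ge> 1" using decomp[of m] m0 l by (cases l) auto
      ultimately show "l \<in> smooth_numbers N"
        using m by (auto simp: smooth_numbers_def p_def dest: dvd_trans)
          (metis le_Suc_eq dvd_trans)
    qed simp
    have inj: "inj_on h (smooth_numbers (Suc N))"
      by (rule inj_onI) (metis decomp h_def prod.inject)
    have "real p powr (- \<sigma>) < 1" using p \<open>\<sigma> > 0\<close> powr_less_one[of "real p" "-\<sigma>"] by simp
    then have "(\<lambda>j. (real p powr (- \<sigma>)) ^ j) summable_on UNIV"
      by (intro norm_summable_imp_summable_on) (auto intro!: summable_geometric)
    then have "g summable_on UNIV \<times> smooth_numbers N"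
      unfolding g_def by (intro summable_on_times Suc) auto
    then have "(g \<circ> h) summable_on smooth_numbers (Suc N)"
      using summable_on_reindex[OF inj] summable_on_subset[OF _ hS] by blast
    moreover have "(g \<circ> h) m = real m powr (- \<sigma>)" for m
    proof -
      have "real m = real p ^ multiplicity p m * real (m div p ^ multiplicity p m)"
        using decomp[of m] by (metis of_nat_mult of_nat_power)
      then have "real m powr (- \<sigma>) = (real p ^ multiplicity p m) powr (- \<sigma>) * real (m div p ^ multiplicity p m) powr (- \<sigma>)"
        by (metis powr_mult of_nat_0_le_iff zero_le_power)
      also have "(real p ^ multiplicity p m) powr (- \<sigma>) = (real p powr (- \<sigma>)) ^ multiplicity p m"
        using p by (simp add: powr_realpow[symmetric] powr_powr mult.commute)
      finally show ?thesis by (simp add: g_def h_def)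
    qed
    ultimately show ?thesis by (simp add: fun_eq_iff[symmetric] cong: summable_on_cong)
  qed
qed

lemma smooth_numbers_mult_iff:
  "m \<ge> 1 \<Longrightarrow> n \<ge> 1 \<Longrightarrow> m * n \<in> smooth_numbers N \<longleftrightarrow> m \<in> smooth_numbers N \<and> n \<in> smooth_numbers N"
  by (auto simp: smooth_numbers_def prime_dvd_mult_iff)

lemma atLeastAtMost_subset_smooth_numbers: "{1..N} \<subseteq> smooth_numbers N"
  by (auto simp: smooth_numbers_def dest: dvd_imp_le)

text \<open>Column \<open>(1, 1)\<close> of the matrix is the coefficient family itself.\<close>

lemma multiplier_bound_entry:
  assumes "multiplier_bound a C" "i \<in> index_pairs"
  shows "cmod (a (fst i) (snd i)) \<le> C"
proof -
  have "cmod (\<Sum>k\<in>{i}. \<Sum>i\<in>{(1,1)}. toeplitz a k i * 1 * 1) \<le>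
      C * sqrt (\<Sum>i\<in>{(1::nat,1::nat)}. (cmod 1)\<^sup>2) * sqrt (\<Sum>k\<in>{i}. (cmod 1)\<^sup>2)"
    using assms(2) by (intro assms(1)[unfolded multiplier_bound_def, rule_format])
      (auto simp: index_pairs_def)
  then show ?thesis by (simp add: toeplitz_def)
qed

text \<open>The reproducing kernel argument: \<open>M\<^sub>a\<close> compressed to the smooth numbers has the
  kernel vector \<open>cnj \<circ> dirichlet_monomial p\<close> as an eigenvector of its adjoint.\<close>

lemma smooth_part_bound:
  fixes N :: nat
  assumes a: "multiplier_bound a C" and p: "Re (fst p) > 0" "Re (snd p) > 0"
  defines "V \<equiv> smooth_numbers N \<times> smooth_numbers N"
  shows "(\<lambda>i. cmod (dirichlet_monomial p i)) summable_on V"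
    and "cmod (\<Sum>\<^sub>\<infinity>i\<in>V. a (fst i) (snd i) * dirichlet_monomial p i) \<le> C"
proof -
  define \<kappa> where "\<kappa> = dirichlet_monomial p"
  have V: "V \<subseteq> index_pairs" by (auto simp: V_def smooth_numbers_def index_pairs_def)
  have s: "(\<lambda>i. cmod (\<kappa> i)) summable_on V"
    using summable_on_times[OF smooth_summable[OF p(1), of N] smooth_summable[OF p(2), of N]]
    unfolding V_def \<kappa>_def by (simp add: case_prod_beta' norm_dirichlet_monomial[abs_def])
  then show "(\<lambda>i. cmod (dirichlet_monomial p i)) summable_on V" by (simp add: \<kappa>_def)
  have k1: "cmod (\<kappa> i) \<le> 1" if "i \<in> V" for i
    using that V p unfolding \<kappa>_def by (intro norm_dirichlet_monomial_le_1) auto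
  have s2: "(\<lambda>i. (cmod (\<kappa> i))\<^sup>2) summable_on V"
    by (rule summable_on_comparison_test[OF s]) (use k1 in \<open>auto simp: power2_eq_square intro!: mult_left_le\<close>)
  define A where "A = (\<lambda>i. a (fst i) (snd i))"
  have Ab: "cmod (A i) \<le> C" if "i \<in> V" for i
    using multiplier_bound_entry[OF a] V that by (auto simp: A_def)
  have C0: "C \<ge> 0" using Ab[of "(1,1)"] order_trans[OF norm_ge_zero] V
    by (force simp: V_def smooth_numbers_def)
  have sA: "(\<lambda>i. cmod (A i * \<kappa> i)) summable_on V"
    by (rule Infinite_Sum.abs_summable_on_comparison_test'[OF summable_on_cmult_right[OF s, of C]])
       (use Ab in \<open>auto simp: norm_mult intro!: mult_right_mono\<close>)
  \<comment> \<open>\<open>G (i, q)\<close> is the term of the bilinear form at column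
    \<open>i\<close> and row \<open>pair_times q i\<close> for the vectors
    \<open>cnj \<circ> \<kappa>\<close> and \<open>\<kappa>\<close>; multiplicativity of
    \<open>\<kappa>\<close> makes it a product. Its total is the squared norm \<open>Z\<close> of
    the kernel vector times the value \<open>S\<close> of the smooth series.\<close>
  define G where "G = (\<lambda>(i, q). complex_of_real ((cmod (\<kappa> i))\<^sup>2) * (A q * \<kappa> q))"
  have sG: "G summable_on V \<times> V"
  proof (rule abs_summable_summable)
    have "(\<lambda>(i, q). (cmod (\<kappa> i))\<^sup>2 * cmod (A q * \<kappa> q)) summable_on V \<times> V"
      by (rule summable_on_times[OF s2 sA]) auto
    then show "(\<lambda>w. cmod (G w)) summable_on V \<times> V"
      by (simp add: G_def case_prod_beta' norm_mult norm_power)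
  qed
  define Z where "Z = (\<Sum>\<^sub>\<infinity>i\<in>V. (cmod (\<kappa> i))\<^sup>2)"
  define S where "S = (\<Sum>\<^sub>\<infinity>i\<in>V. A i * \<kappa> i)"
  have iG: "infsum G (V \<times> V) = of_real Z * S"
  proof -
    have "infsum G (V \<times> V) = (\<Sum>\<^sub>\<infinity>i\<in>V. \<Sum>\<^sub>\<infinity>q\<in>V. of_real ((cmod (\<kappa> i))\<^sup>2) * (A q * \<kappa> q))"
      using infsum_Sigma'_banach[of "\<lambda>i q. of_real ((cmod (\<kappa> i))\<^sup>2) * (A q * \<kappa> q)" V "\<lambda>_. V"] sG
      by (simp add: G_def)
    also have "\<dots> = (\<Sum>\<^sub>\<infinity>i\<in>V. of_real ((cmod (\<kappa> i))\<^sup>2) * S)"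
      unfolding S_def by (intro infsum_cong infsum_cmult_right abs_summable_summable[OF sA])
    also have "\<dots> = (\<Sum>\<^sub>\<infinity>i\<in>V. of_real ((cmod (\<kappa> i))\<^sup>2)) * S"
      by (intro infsum_cmult_left summable_on_of_real s2)
    also have "(\<Sum>\<^sub>\<infinity>i\<in>V. complex_of_real ((cmod (\<kappa> i))\<^sup>2)) = of_real Z"
      unfolding Z_def by (rule infsumI) (simp only: has_sum_of_real_iff has_sum_infsum[OF s2])
    finally show ?thesis .
  qed
  \<comment> \<open>The square section \<open>E \<times> E\<close> of the matrix, written in the
    coordinates \<open>(i, q)\<close>. These sets are finite and exhaust
    \<open>V \<times> V\<close>, so the sums over sections tend to the full sum.\<close>
  define W where "W = (\<lambda>E. {(i, q) \<in> V \<times> V. i \<in> E \<and> pair_times q i \<in> E})"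
  have ptV: "pair_times q i \<in> V" if "q \<in> V" "i \<in> V" for q i
    using that smooth_numbers_mult_iff
    by (auto simp: V_def pair_times_def smooth_numbers_def prime_dvd_mult_iff)
  have Wfin: "finite (W E)" if "finite E" for E
  proof (rule finite_subset)
    let ?h = "\<lambda>(i, k). (i, (fst k div fst i, snd k div snd i))"
    show "W E \<subseteq> ?h ` (E \<times> E)"
    proof safe
      fix i1 i2 q1 q2 assume w: "((i1, i2), (q1, q2)) \<in> W E"
      then have "i1 > 0" "i2 > 0" by (auto simp: W_def V_def smooth_numbers_def)
      then have "((i1, i2), (q1, q2)) = ?h ((i1, i2), pair_times (q1, q2) (i1, i2))"
        by (simp add: pair_times_def)
      moreover have "((i1, i2), pair_times (q1, q2) (i1, i2)) \<in> E \<times> E"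
        using w by (auto simp: W_def)
      ultimately show "((i1, i2), (q1, q2)) \<in> ?h ` (E \<times> E)" by (rule image_eqI)
    qed
  qed (use that in auto)
  have Wlim: "filterlim W (finite_subsets_at_top (V \<times> V)) (finite_subsets_at_top V)"
    unfolding filterlim_finite_subsets_at_top eventually_finite_subsets_at_top
  proof (intro allI impI)
    fix X assume X: "finite X \<and> X \<subseteq> V \<times> V"
    let ?E = "fst ` X \<union> (\<lambda>(i, q). pair_times q i) ` X"
    show "\<exists>E. finite E \<and> E \<subseteq> V \<and> (\<forall>Y. finite Y \<and> E \<subseteq> Y \<and> Y \<subseteq> V \<longrightarrow>
        finite (W Y) \<and> X \<subseteq> W Y \<and> W Y \<subseteq> V \<times> V)"
    proof (intro exI[of _ ?E] conjI allI impI)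
      show "?E \<subseteq> V" using X ptV by auto
    qed (use X Wfin in \<open>auto simp: W_def\<close>)
  qed
  have "(sum G \<longlongrightarrow> of_real Z * S) (finite_subsets_at_top (V \<times> V))"
    using has_sum_infsum[OF sG] by (simp add: has_sum_def iG)
  from filterlim_compose[OF this Wlim]
  have lim: "((\<lambda>E. cmod (sum G (W E))) \<longlongrightarrow> cmod (of_real Z * S)) (finite_subsets_at_top V)"
    by (intro tendsto_norm)
  have bnd: "cmod (sum G (W E)) \<le> C * Z" if E: "finite E" "E \<subseteq> V" for E
  proof -
    have "sum G (W E) = (\<Sum>(k, i)\<in>{(k, i) \<in> E \<times> E. fst i dvd fst k \<and> snd i dvd snd k}.
        toeplitz a k i * cnj (\<kappa> i) * \<kappa> k)"
    proof (rule sum.reindex_bij_witness[where i = "\<lambda>(k, i). (i, (fst k div fst i, snd k div snd i))"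
          and j = "\<lambda>(i, q). (pair_times q i, i)"])
      fix w assume w: "w \<in> W E"
      obtain i q where [simp]: "w = (i, q)" by (cases w)
      have pos: "fst i > 0" "snd i > 0" using w by (auto simp: W_def V_def smooth_numbers_def)
      show "(\<lambda>(k, i). (i, (fst k div fst i, snd k div snd i))) ((\<lambda>(i, q). (pair_times q i, i)) w) = w"
        using pos by (simp add: pair_times_def)
      show "(\<lambda>(i, q). (pair_times q i, i)) w \<in> {(k, i) \<in> E \<times> E. fst i dvd fst k \<and> snd i dvd snd k}"
        using w by (auto simp: W_def pair_times_def)
      have t: "toeplitz a (pair_times q i) i = A q"
        using pos by (simp add: toeplitz_def pair_times_def A_def)
      have "\<kappa> (pair_times q i) = \<kappa> q * \<kappa> i"
        by (simp add: \<kappa>_def dirichlet_monomial_times)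
      then show "(case (\<lambda>(i, q). (pair_times q i, i)) w of (k, i) \<Rightarrow> toeplitz a k i * cnj (\<kappa> i) * \<kappa> k) = G w"
        by (simp add: t G_def complex_norm_square del: of_real_power)
    next
      fix z assume z: "z \<in> {(k, i) \<in> E \<times> E. fst i dvd fst k \<and> snd i dvd snd k}"
      obtain k i where [simp]: "z = (k, i)" by (cases z)
      have pt: "pair_times (fst k div fst i, snd k div snd i) i = k"
        using z by (simp add: pair_times_def)
      show "(\<lambda>(i, q). (pair_times q i, i)) ((\<lambda>(k, i). (i, (fst k div fst i, snd k div snd i))) z) = z"
        using pt by simp
      have "k \<in> V" "i \<in> V" using z E by auto
      then have "(fst k div fst i, snd k div snd i) \<in> V"
        using z smooth_numbers_mult_iff[of "fst k div fst i" "fst i" N]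
           smooth_numbers_mult_iff[of "snd k div snd i" "snd i" N]
        by (auto simp: V_def smooth_numbers_def dvd_div_eq_0_iff Suc_le_eq mem_Times_iff)
      then show "(\<lambda>(k, i). (i, (fst k div fst i, snd k div snd i))) z \<in> W E"
        using z E pt by (auto simp: W_def)
    qed
    also have "\<dots> = (\<Sum>(k, i)\<in>E \<times> E. toeplitz a k i * cnj (\<kappa> i) * \<kappa> k)"
      by (rule sum.mono_neutral_left) (use E in \<open>auto simp: toeplitz_def split: if_splits\<close>)
    also have "\<dots> = (\<Sum>k\<in>E. \<Sum>i\<in>E. toeplitz a k i * cnj (\<kappa> i) * \<kappa> k)"
      by (simp add: sum.cartesian_product)
    finally have "cmod (sum G (W E)) \<le> C * sqrt (\<Sum>i\<in>E. (cmod (cnj (\<kappa> i)))\<^sup>2) * sqrt (\<Sum>k\<in>E. (cmod (\<kappa> k))\<^sup>2)"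
      using a[unfolded multiplier_bound_def, rule_format, of E E "\<lambda>i. cnj (\<kappa> i)" \<kappa>] E V by auto
    also have "\<dots> = C * (\<Sum>i\<in>E. (cmod (\<kappa> i))\<^sup>2)"
      by (simp add: mult.assoc sum_nonneg)
    also have "\<dots> \<le> C * Z"
      unfolding Z_def using s2 E C0 by (intro mult_left_mono finite_sum_le_infsum) auto
    finally show ?thesis .
  qed
  \<comment> \<open>On every section both vectors have squared norm at most \<open>Z\<close>.
    Cancelling \<open>Z\<close>, which is positive because of the term at \<open>(1, 1)\<close>,
    leaves the bound for the value.\<close>
  have "cmod (of_real Z * S) \<le> C * Z"
  proof (rule tendsto_upperbound[OF lim])
    show "\<forall>\<^sub>F E in finite_subsets_at_top V. cmod (sum G (W E)) \<le> C * Z"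
      unfolding eventually_finite_subsets_at_top using bnd by (intro exI[of _ "{}"]) auto
  qed simp
  moreover have "Z > 0"
  proof -
    have "(1,1) \<in> V" by (auto simp: V_def smooth_numbers_def)
    then have "(cmod (\<kappa> (1,1)))\<^sup>2 \<le> Z"
      using finite_sum_le_infsum[OF s2, of "{(1,1)}"] by (auto simp: Z_def)
    then show ?thesis by (simp add: \<kappa>_def dirichlet_monomial_def)
  qed
  ultimately show "cmod (\<Sum>\<^sub>\<infinity>i\<in>V. a (fst i) (snd i) * dirichlet_monomial p i) \<le> C"
    by (simp add: norm_mult mult.commute S_def A_def \<kappa>_def)
qed

text \<open>Montel provides convergent subsequences, and the identity theorem determines every
  subsequential limit by its values \<open>h\<close> on \<open>U\<close>. If the full sequence
  failed at some point, a subsequence kept away from the limit there would itself have a subsequence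
  tending to it.\<close>

lemma vitali_convergence:
  fixes g :: "nat \<Rightarrow> complex \<Rightarrow> complex"
  assumes S: "open S" "connected S" and hol: "\<And>n. g n holomorphic_on S"
    and bnd: "\<And>n z. z \<in> S \<Longrightarrow> cmod (g n z) \<le> B"
    and U: "open U" "U \<noteq> {}" "U \<subseteq> S" and lim: "\<And>z. z \<in> U \<Longrightarrow> (\<lambda>n. g n z) \<longlonglongrightarrow> h z"
  obtains G where "G holomorphic_on S" "\<And>z. z \<in> S \<Longrightarrow> (\<lambda>n. g n z) \<longlonglongrightarrow> G z"
proof -
  have M: "\<exists>G r. G holomorphic_on S \<and> strict_mono (r :: nat \<Rightarrow> nat) \<and>
      (\<forall>z\<in>S. (\<lambda>n. g (q (r n)) z) \<longlonglongrightarrow> G z)" for q :: "nat \<Rightarrow> nat"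
    by (rule Montel[of S "range g" "\<lambda>n. g (q n)"]) (use S hol bnd in blast)+
  obtain G r where G: "G holomorphic_on S" "strict_mono r" "\<And>z. z \<in> S \<Longrightarrow> (\<lambda>n. g (r n) z) \<longlonglongrightarrow> G z"
    using M[of id] by auto
  have GU: "G z = h z" if "z \<in> U" for z
  proof (rule LIMSEQ_unique[OF G(3)])
    show "(\<lambda>n. g (r n) z) \<longlonglongrightarrow> h z"
      using LIMSEQ_subseq_LIMSEQ[OF lim[OF that] G(2)] by (simp add: o_def)
  qed (use that U in auto)
  have "(\<lambda>n. g n z) \<longlonglongrightarrow> G z" if "z \<in> S" for z
  proof (rule ccontr)
    assume "\<not> (\<lambda>n. g n z) \<longlonglongrightarrow> G z"
    then obtain e where e: "e > 0" "\<And>n0. \<exists>n\<ge>n0. dist (g n z) (G z) \<ge> e"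
      by (auto simp: lim_sequentially not_less)
    obtain q :: "nat \<Rightarrow> nat" where q: "strict_mono q" "\<And>n. dist (g (q n) z) (G z) \<ge> e"
    proof -
      have "infinite {n. dist (g n z) (G z) \<ge> e}"
        unfolding infinite_nat_iff_unbounded_le using e(2) by auto
      from infinite_enumerate[OF this] show ?thesis using that by auto
    qed
    obtain G' r' where G': "G' holomorphic_on S" "strict_mono r'" "\<And>z. z \<in> S \<Longrightarrow> (\<lambda>n. g (q (r' n)) z) \<longlonglongrightarrow> G' z"
      using M[of q] by auto
    have sub: "strict_mono (\<lambda>n. q (r' n))"
      using q(1) G'(2) by (simp add: strict_mono_def)
    have "G' z = h z" if "z \<in> U" for z
    proof (rule LIMSEQ_unique[OF G'(3)])
      show "(\<lambda>n. g (q (r' n)) z) \<longlonglongrightarrow> h z"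
        using LIMSEQ_subseq_LIMSEQ[OF lim[OF that] sub] by (simp add: o_def)
    qed (use that U in auto)
    then have "G' z = G z"
      using analytic_continuation_open[OF U(1) S(1) U(2) S(2) U(3) G'(1) G(1) _ \<open>z \<in> S\<close>] GU by auto
    with G'(3)[OF \<open>z \<in> S\<close>] have "(\<lambda>n. g (q (r' n)) z) \<longlonglongrightarrow> G z" by simp
    then have "\<forall>\<^sub>F n in sequentially. dist (g (q (r' n)) z) (G z) < e"
      using e(1) by (rule tendstoD)
    then obtain n where "dist (g (q (r' n)) z) (G z) < e"
      by (meson eventually_sequentially order_refl)
    with q(2)[of "r' n"] show False by simp
  qed
  with G(1) that show ?thesis by blast
qed

section \<open>Half planes and holomorphy in two variables\<close>

lemma open_Re_gt: "open {z. Re z > c}"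
  by (simp add: open_halfspace_Re_gt)

lemma connected_Re_gt: "connected {z. Re z > c}"
  by (simp add: convex_connected convex_halfspace_Re_gt)

lemma open_half_planes: "open (half_planes \<sigma>)"
proof -
  have "half_planes \<sigma> = {z. Re z > \<sigma>} \<times> {z. Re z > \<sigma>}" by (auto simp: half_planes_def)
  then show ?thesis by (simp add: open_Times open_Re_gt)
qed

lemma deriv_bound:
  assumes "f holomorphic_on S" "open S" "cball z r \<subseteq> S" "r > 0" "\<And>w. w \<in> S \<Longrightarrow> cmod (f w) \<le> B"
  shows "cmod (deriv f z) \<le> B / r"
proof -
  have "cmod ((deriv ^^ 1) f z) \<le> fact 1 * B / r ^ 1"
  proof (rule Cauchy_inequality)
    show "f holomorphic_on ball z r" "continuous_on (cball z r) f"
      using assms ball_subset_cball by (meson holomorphic_on_subset holomorphic_on_imp_continuous_on subset_trans)+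
    show "cmod (f x) \<le> B" if "cmod (z - x) = r" for x
      using that assms by (auto simp: dist_norm subset_eq)
  qed fact
  then show ?thesis by simp
qed

text \<open>Osgood's lemma for bounded functions: by Cauchy's estimates the partial derivative in the
  second variable is jointly continuous.\<close>

lemma osgood:
  fixes F :: "complex \<times> complex \<Rightarrow> complex"
  assumes bnd: "\<And>p. p \<in> half_planes 0 \<Longrightarrow> cmod (F p) \<le> B"
    and h1: "\<And>t. Re t > 0 \<Longrightarrow> (\<lambda>s. F (s, t)) holomorphic_on {s. Re s > 0}"
    and h2: "\<And>s. Re s > 0 \<Longrightarrow> (\<lambda>t. F (s, t)) holomorphic_on {t. Re t > 0}"
  shows "holomorphic2_on F (half_planes 0)"
  unfolding holomorphic2_on_def
proof safe
  fix s t assume "(s, t) \<in> half_planes 0"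
  then have st: "Re s > 0" "Re t > 0" by (auto simp: half_planes_def)
  \<comment> \<open>With a third of the distance to the boundary, a disc of radius \<open>r\<close>
    about any point of the disc of radius \<open>r\<close> still lies in the half plane, so Cauchy's
    estimate is available at all those points.\<close>
  define r where "r = min (Re s) (Re t) / 3"
  have r: "r > 0" "3 * r \<le> Re s" "3 * r \<le> Re t" using st by (auto simp: r_def)
  have Re_ball: "Re z - Re w \<le> r'" if "z \<in> cball w r' \<or> w \<in> cball z r'" for z w r'
    using that abs_Re_le_cmod[of "z - w"] abs_Re_le_cmod[of "w - z"] by (auto simp: dist_norm)
  have pos: "Re z > 0" if "z \<in> cball w r" "w \<in> cball s r \<or> w \<in> cball t r" for z w
    using Re_ball[of s w r] Re_ball[of t w r] Re_ball[of w z r] that r by auto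
  have pos1: "Re z > 0" if "z \<in> cball s r \<or> z \<in> cball t r" for z
    using pos[of z z] that r by auto
  define d where "d = (\<lambda>x y. deriv (\<lambda>t. F (x, t)) y)"
  have H: "open {z. Re z > 0}" by (rule open_Re_gt)
  have B0: "B \<ge> 0" using order_trans[OF norm_ge_zero bnd[of "(s,t)"]] st by (simp add: half_planes_def)
  have lip: "cmod (F (x, y) - F (s, y)) \<le> B / r * cmod (x - s)" if "x \<in> ball s r" "Re y > 0" for x y
  proof (rule field_differentiable_bound[where S = "ball s r" and f = "\<lambda>x. F (x, y)" and f' = "deriv (\<lambda>x. F (x, y))"])
    fix z assume z: "z \<in> ball s r"
    then have z0: "Re z > 0" using pos1[of z] by auto
    show "((\<lambda>x. F (x, y)) has_field_derivative deriv (\<lambda>x. F (x, y)) z) (at z within ball s r)"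
      using holomorphic_derivI[OF h1[OF that(2)] H, of z] z0 has_field_derivative_at_within by auto
    show "cmod (deriv (\<lambda>x. F (x, y)) z) \<le> B / r"
    proof (rule deriv_bound[OF h1[OF that(2)] H])
      show "cball z r \<subseteq> {s. 0 < Re s}" using pos[of _ z] z by auto
      show "cmod (F (w, y)) \<le> B" if "w \<in> {s. 0 < Re s}" for w
        using that \<open>Re y > 0\<close> bnd by (auto simp: half_planes_def)
    qed (use r in auto)
  qed (use that r in auto)
  \<comment> \<open>Cauchy's estimate a second time, now in the second variable and for the
    difference of two slices. That difference is bounded by \<open>lip\<close> on the whole half
    plane, hence the two divisions by \<open>r\<close>.\<close>
  have dlip: "cmod (d x y - d s y) \<le> B / r / r * cmod (x - s)" if x: "x \<in> ball s r" and y: "y \<in> ball t r" for x y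
  proof -
    have x0: "Re x > 0" using pos1[of x] x by auto
    have y0: "Re y > 0" using pos1[of y] y by auto
    have "deriv (\<lambda>t. F (x, t) - F (s, t)) y = d x y - d s y"
      unfolding d_def using h2[OF x0] h2[OF st(1)] H y0
      by (intro deriv_diff) (auto simp: holomorphic_on_imp_differentiable_at)
    moreover have "cmod (deriv (\<lambda>t. F (x, t) - F (s, t)) y) \<le> B / r * cmod (x - s) / r"
    proof (rule deriv_bound[where S = "{t. Re t > 0}"])
      show "(\<lambda>t. F (x, t) - F (s, t)) holomorphic_on {t. Re t > 0}"
        by (intro holomorphic_intros h2 x0 st)
      show "cball y r \<subseteq> {t. Re t > 0}" using pos[of _ y] y by auto
      show "cmod (F (x, w) - F (s, w)) \<le> B / r * cmod (x - s)" if "w \<in> {t. Re t > 0}" for w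
        using lip[OF x] that by auto
    qed (use r H in auto)
    ultimately show ?thesis by simp
  qed
  have dcont: "((\<lambda>(x, y). d x y) \<longlongrightarrow> d s t) (at (s, t) within ball s r \<times> ball t r)"
  proof -
    let ?F = "at (s, t) within ball s r \<times> ball t r"
    have fs: "(fst \<longlongrightarrow> s) ?F" and sn: "(snd \<longlongrightarrow> t) ?F"
      using tendsto_fst[OF tendsto_ident_at[of "(s,t)"]] tendsto_snd[OF tendsto_ident_at[of "(s,t)"]] by auto
    have "isCont (d s) t"
      unfolding d_def using holomorphic_on_imp_continuous_on[OF holomorphic_deriv[OF h2[OF st(1)] H]] H st
      by (auto simp: continuous_on_eq_continuous_at)
    then have "((\<lambda>p. d s (snd p)) \<longlongrightarrow> d s t) ?F" by (rule isCont_tendsto_compose[OF _ sn])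
    moreover have "((\<lambda>p. d (fst p) (snd p) - d s (snd p)) \<longlongrightarrow> 0) ?F"
    proof (rule Lim_null_comparison)
      show "\<forall>\<^sub>F p in ?F. norm (d (fst p) (snd p) - d s (snd p)) \<le> B / r / r * cmod (fst p - s)"
        unfolding eventually_at_filter using dlip by (auto intro!: always_eventually)
      have "((\<lambda>p. B / r / r * cmod (fst p - s)) \<longlongrightarrow> B / r / r * cmod (s - s)) ?F"
        by (intro tendsto_intros fs)
      then show "((\<lambda>p. B / r / r * cmod (fst p - s)) \<longlongrightarrow> 0) ?F" by simp
    qed
    ultimately have "((\<lambda>p. (d (fst p) (snd p) - d s (snd p)) + d s (snd p)) \<longlongrightarrow> 0 + d s t) ?F"
      by (intro tendsto_add)
    then show ?thesis by (simp add: case_prod_beta')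
  qed
  have "((\<lambda>(x, y). F (x, y)) has_derivative
      (\<lambda>(tx, ty). deriv (\<lambda>x. F (x, t)) s * tx + blinfun_apply (blinfun_mult_right (d s t)) ty))
      (at (s, t) within ball s r \<times> ball t r)"
  proof (rule has_derivative_partialsI[where fy = "\<lambda>x y. blinfun_mult_right (d x y)"])
    show "((\<lambda>x. F (x, t)) has_derivative (\<lambda>h. deriv (\<lambda>x. F (x, t)) s * h)) (at s within ball s r)"
      using holomorphic_derivI[OF h1[OF st(2)] H, of s] st
      by (auto simp: has_field_derivative_def intro: has_derivative_at_withinI)
    show "((\<lambda>y. F (x, y)) has_derivative blinfun_apply (blinfun_mult_right (d x y))) (at y within ball t r)"
      if "x \<in> ball s r" "y \<in> ball t r" for x y
      using holomorphic_derivI[OF h2 H, of x y] pos1[of x] pos1[of y] that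
      by (auto simp: has_field_derivative_def d_def blinfun_mult_right.rep_eq intro: has_derivative_at_withinI)
    show "continuous (at (s, t) within ball s r \<times> ball t r) (\<lambda>(x, y). blinfun_mult_right (d x y))"
      using bounded_linear.tendsto[OF bounded_linear_blinfun_mult_right dcont]
      by (simp add: continuous_within case_prod_beta')
  qed (use r in auto)
  moreover have "at (s, t) within ball s r \<times> ball t r = at (s, t)"
    using r by (intro at_within_open open_Times) auto
  ultimately have "((\<lambda>(x, y). F (x, y)) has_derivative
      (\<lambda>(tx, ty). deriv (\<lambda>x. F (x, t)) s * tx + d s t * ty)) (at (s, t))"
    by (simp add: blinfun_mult_right.rep_eq)
  then have "(F has_derivative (\<lambda>(h, k). deriv (\<lambda>x. F (x, t)) s * h + d s t * k)) (at (s, t) within half_planes 0)"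
    by (simp only: case_prod_eta has_derivative_at_withinI)
  then show "\<exists>a b. (F has_derivative (\<lambda>(h, k). a * h + b * k)) (at (s, t) within half_planes 0)"
    by (intro exI)
qed

text \<open>Along a diagonal line one complex parameter carries a point of
  \<open>half_planes 0\<close> into the region of absolute convergence, so one-variable theorems on
  half planes become usable for functions of two variables.\<close>

lemma holomorphic2_slice:
  assumes F: "holomorphic2_on F (half_planes 0)" and S: "open S"
    and sub: "\<And>z. z \<in> S \<Longrightarrow> (s + z, t + z) \<in> half_planes 0"
  shows "(\<lambda>z. F (s + z, t + z)) holomorphic_on S"
  unfolding holomorphic_on_open[OF S]
proof safe
  fix z assume z: "z \<in> S"
  obtain a b where "(F has_derivative (\<lambda>(h, k). a * h + b * k)) (at (s + z, t + z) within half_planes 0)"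
    using F sub[OF z] unfolding holomorphic2_on_def by blast
  then have D: "(F has_derivative (\<lambda>(h, k). a * h + b * k)) (at (s + z, t + z))"
    using at_within_open[OF sub[OF z] open_half_planes] by simp
  have "((\<lambda>z. (s + z, t + z)) has_derivative (\<lambda>h. (h, h))) (at z)"
    by (auto intro!: derivative_eq_intros)
  from has_derivative_compose[OF this D]
  have "((\<lambda>z. F (s + z, t + z)) has_derivative (\<lambda>h. (a + b) * h)) (at z)"
    by (simp add: distrib_right)
  then show "\<exists>f'. ((\<lambda>z. F (s + z, t + z)) has_field_derivative f') (at z)"
    by (auto simp: has_field_derivative_def)
qed

lemma holomorphic2_unique:
  assumes F: "holomorphic2_on F (half_planes 0)" and G: "holomorphic2_on G (half_planes 0)"
    and eq: "\<And>p. p \<in> half_planes (1/2) \<Longrightarrow> F p = G p" and p: "p \<in> half_planes 0"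
  shows "F p = G p"
proof -
  obtain s t where st: "p = (s, t)" "Re s > 0" "Re t > 0" using p by (cases p) (auto simp: half_planes_def)
  \<comment> \<open>Shifts to the left by less than \<open>c\<close> stay in
    \<open>half_planes 0\<close>, while shifts with real part above 1 land in
    \<open>half_planes (1/2)\<close> because \<open>s\<close> and \<open>t\<close> have positive
    real parts.\<close>
  define c where "c = min (Re s) (Re t)"
  have "F (s + 0, t + 0) = G (s + 0, t + 0)"
  proof (rule analytic_continuation_open[of "{z. Re z > 1}" "{z. Re z > - c}"
        "\<lambda>z. F (s + z, t + z)" "\<lambda>z. G (s + z, t + z)" 0])
    show "{z. Re z > 1} \<noteq> {}" by (auto intro!: exI[of _ "2::complex"])
    show "(\<lambda>z. F (s + z, t + z)) holomorphic_on {z. - c < Re z}"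
      "(\<lambda>z. G (s + z, t + z)) holomorphic_on {z. - c < Re z}"
      by (rule holomorphic2_slice[OF F open_Re_gt] holomorphic2_slice[OF G open_Re_gt];
          auto simp: half_planes_def c_def)+
    show "F (s + z, t + z) = G (s + z, t + z)" if "z \<in> {z. Re z > 1}" for z
      using that st by (intro eq) (auto simp: half_planes_def)
  qed (use st in \<open>auto simp: open_Re_gt connected_Re_gt c_def\<close>)
  then show ?thesis by (simp add: st)
qed

text \<open>Vitali's theorem wants holomorphic functions with a bound independent of the index.
  Finite sums are holomorphic at once, and cutting the smooth series down to a finite
  \<open>E\<close> costs at most \<open>1 / N\<close>. The same \<open>N\<close> bounds the primes,
  the distance to the boundary and the error. The box is put into \<open>E\<close> so that these
  sets exhaust all pairs.\<close>

lemma smooth_truncation: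
  assumes a: "multiplier_bound a C" and N: "N \<ge> 1"
  shows "\<exists>E. finite E \<and> {1..N} \<times> {1..N} \<subseteq> E \<and> E \<subseteq> index_pairs \<and>
    (\<forall>p. Re (fst p) \<ge> 1 / N \<and> Re (snd p) \<ge> 1 / N \<longrightarrow>
      cmod (\<Sum>i\<in>E. a (fst i) (snd i) * dirichlet_monomial p i) \<le> C + 1 / N)"
proof -
  define V where "V = smooth_numbers N \<times> smooth_numbers N"
  have V: "V \<subseteq> index_pairs" by (auto simp: V_def smooth_numbers_def index_pairs_def)
  \<comment> \<open>Corner of the region considered. Moduli of monomials decrease as the real parts
    grow, so the monomials at \<open>p0\<close> times \<open>C\<close> majorize the terms at all
    points, and one tail estimate serves them all.\<close>
  define p0 where "p0 = (complex_of_real (1 / N), complex_of_real (1 / N))"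
  have p0: "Re (fst p0) > 0" "Re (snd p0) > 0" using N by (auto simp: p0_def)
  define g where "g = (\<lambda>i. C * cmod (dirichlet_monomial p0 i))"
  have C0: "C \<ge> 0"
    using order_trans[OF norm_ge_zero multiplier_bound_entry[OF a, of "(1,1)"]] by (auto simp: index_pairs_def)
  have g: "g summable_on V"
    unfolding g_def V_def by (intro summable_on_cmult_right smooth_part_bound(1)[OF a p0])
  have g0: "g i \<ge> 0" for i using C0 by (simp add: g_def)
  obtain X where X: "finite X" "X \<subseteq> V" "dist (sum g X) (infsum g V) \<le> 1 / N"
    using infsum_finite_approximation[OF g, of "1 / N"] N by auto
  define E where "E = X \<union> {1..N} \<times> {1..N}"
  have E: "finite E" "E \<subseteq> V"
    using X atLeastAtMost_subset_smooth_numbers[of N] by (auto simp: E_def V_def)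
  have "sum g X \<le> sum g E" using E(1) g0 by (intro sum_mono2) (auto simp: E_def)
  then have tail: "infsum g (V - E) \<le> 1 / N"
    using X(3) infsum_split_finite[OF g E] by (simp add: dist_real_def)
  show ?thesis
  proof (intro exI[of _ E] conjI allI impI)
    fix p :: "complex \<times> complex"
    assume p: "Re (fst p) \<ge> 1 / N \<and> Re (snd p) \<ge> 1 / N"
    define u where "u = (\<lambda>i. a (fst i) (snd i) * dirichlet_monomial p i)"
    have p': "Re (fst p) > 0" "Re (snd p) > 0"
      using p N by (auto intro: less_le_trans[of 0 "1 / N"])
    have ug: "cmod (u i) \<le> g i" if "i \<in> V" for i
      unfolding u_def g_def norm_mult
      using that V p C0 multiplier_bound_entry[OF a]
      by (intro mult_mono norm_dirichlet_monomial_antimono) (auto simp: p0_def)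
    have s: "(\<lambda>i. cmod (u i)) summable_on W" if "W \<subseteq> V" for W
      by (rule Infinite_Sum.abs_summable_on_comparison_test'[OF summable_on_subset[OF g that]])
         (use ug that in auto)
    have "sum u E = infsum u V - infsum u (V - E)"
      using infsum_split_finite[OF abs_summable_summable[OF s[OF order_refl]] E] by simp
    also have "cmod \<dots> \<le> cmod (infsum u V) + cmod (infsum u (V - E))"
      by (rule norm_triangle_ineq4)
    also have "cmod (infsum u (V - E)) \<le> (\<Sum>\<^sub>\<infinity>i\<in>V - E. cmod (u i))"
      by (rule norm_infsum_bound[OF s]) auto
    also have "\<dots> \<le> infsum g (V - E)"
      by (rule infsum_mono[OF s summable_on_subset[OF g]]) (use ug in auto)
    also have "\<dots> \<le> 1 / N" by (rule tail)
    also have "cmod (infsum u V) \<le> C"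
      unfolding u_def V_def by (rule smooth_part_bound(2)[OF a p'])
    finally show "cmod (\<Sum>i\<in>E. a (fst i) (snd i) * dirichlet_monomial p i) \<le> C + 1 / N"
      by (simp add: u_def)
  qed (use E V in \<open>auto simp: E_def\<close>)
qed

section \<open>Absolute convergence and the bounded holomorphic extension\<close>

lemma summable_on_dirichlet_series:
  assumes a: "(\<lambda>i. (cmod (a (fst i) (snd i)))\<^sup>2) summable_on index_pairs"
    and p: "p \<in> half_planes (1/2)"
  shows "(\<lambda>i. cmod (a (fst i) (snd i) * dirichlet_monomial p i)) summable_on index_pairs"
proof -
  have s: "(\<lambda>n. real n powr (- 2 * r)) summable_on {1..}" if "r > 1/2" for r
  proof -
    have "summable (\<lambda>n. real n powr (- 2 * r))"
      using that by (simp add: summable_real_powr_iff)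
    then have "(\<lambda>n. real n powr (- 2 * r)) summable_on UNIV"
      by (intro norm_summable_imp_summable_on) auto
    then show ?thesis by (rule summable_on_subset) auto
  qed
  have "(\<lambda>i. (cmod (dirichlet_monomial p i))\<^sup>2) summable_on index_pairs"
  proof -
    have "(real n powr (- r))\<^sup>2 = real n powr (- 2 * r)" for n r
      by (simp add: power2_eq_square flip: powr_add)
    then show ?thesis
      using summable_on_times[OF s s, of "Re (fst p)" "Re (snd p)"] p
      by (simp add: norm_dirichlet_monomial half_planes_def case_prod_beta' index_pairs_def
        power_mult_distrib)
  qed
  from summable_on_add[OF a this] show ?thesis
  proof (rule Infinite_Sum.abs_summable_on_comparison_test')
    fix i
    show "cmod (a (fst i) (snd i) * dirichlet_monomial p i)
        \<le> (cmod (a (fst i) (snd i)))\<^sup>2 + (cmod (dirichlet_monomial p i))\<^sup>2"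
      using sum_squares_bound[of "cmod (a (fst i) (snd i))" "cmod (dirichlet_monomial p i)"]
        mult_nonneg_nonneg[OF norm_ge_zero[of "a (fst i) (snd i)"] norm_ge_zero[of "dirichlet_monomial p i"]]
      unfolding norm_mult by linarith
  qed
qed

lemma holomorphic_dirichlet_monomial:
  assumes "i \<in> index_pairs" "f holomorphic_on S" "g holomorphic_on S"
  shows "(\<lambda>z. dirichlet_monomial (f z, g z) i) holomorphic_on S"
  unfolding dirichlet_monomial_def using assms
  by (auto simp: index_pairs_def powr_def intro!: holomorphic_intros)

text \<open>The predicate under the choice operator in \<open>dirichlet_function\<close>, rewritten
  with \<open>dirichlet_monomial\<close>.\<close>

definition extends_series :: "(nat \<Rightarrow> nat \<Rightarrow> complex) \<Rightarrow> (complex \<times> complex \<Rightarrow> complex) \<Rightarrow> bool" where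
  "extends_series a F \<longleftrightarrow> holomorphic2_on F (half_planes 0) \<and>
     (\<forall>p\<in>half_planes (1/2). ((\<lambda>i. a (fst i) (snd i) * dirichlet_monomial p i) has_sum F p) index_pairs)"

text \<open>The finite sums \<open>R\<close> are used on two kinds of lines: on diagonals Vitali's
  theorem gives convergence at every point, on discs in a coordinate line it gives holomorphy of the
  limit in that variable. Osgood's lemma then joins the variables. The bounds
  \<open>C + 1 / Suc n\<close> leave exactly \<open>C\<close> in the limit.\<close>

lemma bounded_extension_exists:
  assumes a: "multiplier_bound a C"
    and sq: "(\<lambda>i. (cmod (a (fst i) (snd i)))\<^sup>2) summable_on index_pairs"
  obtains F where "extends_series a F" "\<And>p. p \<in> half_planes 0 \<Longrightarrow> cmod (F p) \<le> C"
proof -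
  have "\<forall>n. \<exists>E. finite E \<and> {1..Suc n} \<times> {1..Suc n} \<subseteq> E \<and> E \<subseteq> index_pairs \<and>
    (\<forall>p. Re (fst p) \<ge> 1 / Suc n \<and> Re (snd p) \<ge> 1 / Suc n \<longrightarrow>
      cmod (\<Sum>i\<in>E. a (fst i) (snd i) * dirichlet_monomial p i) \<le> C + 1 / Suc n)" (is "\<forall>n. \<exists>E. ?P n E")
    by (intro allI smooth_truncation[OF a]) simp
  from choice[OF this] obtain E where "\<forall>n. ?P n (E n)" ..
  then have E: "\<And>n. finite (E n)" "\<And>n. {1..Suc n} \<times> {1..Suc n} \<subseteq> E n"
    "\<And>n. E n \<subseteq> index_pairs"
    and Eb: "\<And>n p. Re (fst p) \<ge> 1 / Suc n \<Longrightarrow> Re (snd p) \<ge> 1 / Suc n \<Longrightarrow>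
      cmod (\<Sum>i\<in>E n. a (fst i) (snd i) * dirichlet_monomial p i) \<le> C + 1 / Suc n"
    by blast+
  define R where "R = (\<lambda>n p. \<Sum>i\<in>E n. a (fst i) (snd i) * dirichlet_monomial p i)"
  have Rhol: "(\<lambda>z. R n (f z, g z)) holomorphic_on S" if "f holomorphic_on S" "g holomorphic_on S" for f g S n
    unfolding R_def using that E(3)[of n] by (intro holomorphic_intros holomorphic_dirichlet_monomial) auto
  have Rb: "\<exists>n0. \<forall>n\<ge>n0. \<forall>p. Re (fst p) \<ge> \<delta> \<and> Re (snd p) \<ge> \<delta> \<longrightarrow> cmod (R n p) \<le> C + 1 / Suc n" if "\<delta> > 0" for \<delta>
  proof -
    obtain n0 where n0: "1 / real (Suc n0) < \<delta>" using nat_approx_posE[OF \<open>\<delta> > 0\<close>] by blast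
    have "1 / real (Suc n) < \<delta>" if "n \<ge> n0" for n
      using n0 that by (auto intro: le_less_trans[rotated] simp: frac_le)
    then show ?thesis unfolding R_def by (intro exI[of _ n0] allI impI Eb) (auto intro: less_imp_le less_le_trans)
  qed
  have Elim: "filterlim E (finite_subsets_at_top index_pairs) sequentially"
    unfolding filterlim_finite_subsets_at_top
  proof (intro allI impI)
    fix X assume X: "finite X \<and> X \<subseteq> index_pairs"
    define n0 where "n0 = Max (insert 0 (fst ` X \<union> snd ` X))"
    have "X \<subseteq> E n" if "n \<ge> n0" for n
    proof
      fix x assume x: "x \<in> X"
      have "fst x \<le> n0" "snd x \<le> n0" unfolding n0_def using X x by (auto intro!: Max_ge)
      then have "x \<in> {1..Suc n} \<times> {1..Suc n}"
        using X x that by (cases x) (auto simp: index_pairs_def)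
      then show "x \<in> E n" using E(2) by blast
    qed
    then show "\<forall>\<^sub>F n in sequentially. finite (E n) \<and> X \<subseteq> E n \<and> E n \<subseteq> index_pairs"
      using E by (auto simp: eventually_sequentially)
  qed
  define D where "D = (\<lambda>p. \<Sum>\<^sub>\<infinity>i\<in>index_pairs. a (fst i) (snd i) * dirichlet_monomial p i)"
  have Dsum: "((\<lambda>i. a (fst i) (snd i) * dirichlet_monomial p i) has_sum D p) index_pairs"
    if "p \<in> half_planes (1/2)" for p
    unfolding D_def by (intro has_sum_infsum abs_summable_summable[OF summable_on_dirichlet_series[OF sq that]])
  have RD: "(\<lambda>n. R n p) \<longlonglongrightarrow> D p" if "p \<in> half_planes (1/2)" for p
    using filterlim_compose[OF Dsum[OF that, unfolded has_sum_def] Elim] by (simp add: R_def)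
  have conv: "\<exists>l. (\<lambda>n. R n p) \<longlonglongrightarrow> l" if p: "p \<in> half_planes 0" for p
  proof -
    obtain s t where st: "p = (s, t)" "Re s > 0" "Re t > 0" using p by (cases p) (auto simp: half_planes_def)
    define c where "c = min (Re s) (Re t) / 2"
    have c: "c > 0" "2 * c \<le> Re s" "2 * c \<le> Re t" using st by (auto simp: c_def)
    obtain n0 where n0: "\<And>n p. n \<ge> n0 \<Longrightarrow> Re (fst p) \<ge> c \<Longrightarrow> Re (snd p) \<ge> c \<Longrightarrow> cmod (R n p) \<le> C + 1 / Suc n"
      using Rb[OF c(1)] by blast
    \<comment> \<open>The bound holds only from the index \<open>n0\<close> on, hence the shifted
      sequence; \<open>C + 1\<close> is a crude common bound for its members.\<close>
    obtain G where G: "\<And>z. z \<in> {z. Re z > - c} \<Longrightarrow> (\<lambda>n. R (n + n0) (s + z, t + z)) \<longlonglongrightarrow> G z"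
    proof (rule vitali_convergence[of "{z. Re z > - c}" "\<lambda>n z. R (n + n0) (s + z, t + z)" "C + 1"
          "{z. Re z > 1}" "\<lambda>z. D (s + z, t + z)"])
      show "(\<lambda>z. R (n + n0) (s + z, t + z)) holomorphic_on {z. - c < Re z}" for n
        by (intro Rhol holomorphic_intros)
      show "cmod (R (n + n0) (s + z, t + z)) \<le> C + 1" if "z \<in> {z. - c < Re z}" for n z
      proof -
        have "cmod (R (n + n0) (s + z, t + z)) \<le> C + 1 / Suc (n + n0)"
          by (rule n0) (use that c in auto)
        also have "\<dots> \<le> C + 1" by simp
        finally show ?thesis .
      qed
      show "{z. 1 < Re z} \<noteq> {}" by (auto intro!: exI[of _ "2::complex"])
      show "(\<lambda>n. R (n + n0) (s + z, t + z)) \<longlonglongrightarrow> D (s + z, t + z)" if "z \<in> {z. 1 < Re z}" for z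
        by (intro LIMSEQ_ignore_initial_segment RD) (use that st in \<open>auto simp: half_planes_def\<close>)
    qed (use c in \<open>auto simp: open_Re_gt connected_Re_gt\<close>)
    have "(\<lambda>n. R (n + n0) (s + 0, t + 0)) \<longlonglongrightarrow> G 0" by (rule G) (use c in auto)
    then show ?thesis using LIMSEQ_offset[of "\<lambda>n. R n p" n0 "G 0"] st(1) by auto
  qed
  define F where "F = (\<lambda>p. lim (\<lambda>n. R n p))"
  have RF: "(\<lambda>n. R n p) \<longlonglongrightarrow> F p" if "p \<in> half_planes 0" for p
    using conv[OF that] by (auto simp: F_def limI)
  have FD: "F p = D p" if "p \<in> half_planes (1/2)" for p
    by (rule LIMSEQ_unique[OF RF RD[OF that]]) (use that in \<open>auto simp: half_planes_def\<close>)
  have Fb: "cmod (F p) \<le> C" if p: "p \<in> half_planes 0" for p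
  proof (rule LIMSEQ_le[OF tendsto_norm[OF RF[OF p]]])
    have "(\<lambda>n. C + 1 / real (Suc n)) \<longlonglongrightarrow> C + 0" by (intro tendsto_add tendsto_const LIMSEQ_Suc[OF lim_1_over_n])
    then show "(\<lambda>n. C + 1 / real (Suc n)) \<longlonglongrightarrow> C" by simp
    show "\<exists>n0. \<forall>n\<ge>n0. cmod (R n p) \<le> C + 1 / real (Suc n)"
      using Rb[of "min (Re (fst p)) (Re (snd p))"] p by (fastforce simp: half_planes_def)
  qed
  \<comment> \<open>Stated for two entire functions in order to cover both variables: one of them
    will be the identity, the other a constant. The hypothesis keeps a small disc at a positive
    distance from the boundary, where the \<open>R n\<close> are eventually uniformly
    bounded.\<close>
  have sep: "(\<lambda>z. F (f z, g z)) holomorphic_on {z. Re z > 0}"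
    if f: "f holomorphic_on UNIV" and g: "g holomorphic_on UNIV"
      and fg: "\<And>z. Re z > 0 \<Longrightarrow> \<exists>\<delta>>0. \<exists>e>0. \<forall>w\<in>ball z e. Re w > 0 \<and> Re (f w) > \<delta> \<and> Re (g w) > \<delta>" for f g
  proof -
    have "(\<lambda>z. F (f z, g z)) field_differentiable (at z)" if z: "Re z > 0" for z
    proof -
      obtain \<delta> e where de: "\<delta> > 0" "e > 0" "\<And>w. w \<in> ball z e \<Longrightarrow> Re (f w) > \<delta> \<and> Re (g w) > \<delta>"
        using fg[OF z] by blast
      obtain n0 where n0: "\<And>n p. n \<ge> n0 \<Longrightarrow> Re (fst p) \<ge> \<delta> \<Longrightarrow> Re (snd p) \<ge> \<delta> \<Longrightarrow> cmod (R n p) \<le> C + 1 / Suc n"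
        using Rb[OF de(1)] by blast
      have lim: "(\<lambda>n. R (n + n0) (f w, g w)) \<longlonglongrightarrow> F (f w, g w)" if "w \<in> ball z e" for w
        by (intro LIMSEQ_ignore_initial_segment RF) (use de(1) de(3)[OF that] in \<open>auto simp: half_planes_def\<close>)
      obtain G where G: "G holomorphic_on ball z e" "\<And>w. w \<in> ball z e \<Longrightarrow> (\<lambda>n. R (n + n0) (f w, g w)) \<longlonglongrightarrow> G w"
      \<comment> \<open>Convergence on the whole disc is known already; what is gained is holomorphy
        of the limit.\<close>
      proof (rule vitali_convergence[of "ball z e" "\<lambda>n w. R (n + n0) (f w, g w)" "C + 1"
            "ball z e" "\<lambda>w. F (f w, g w)"])
        show "(\<lambda>w. R (n + n0) (f w, g w)) holomorphic_on ball z e" for n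
          by (intro Rhol holomorphic_on_subset[OF f] holomorphic_on_subset[OF g]) auto
        show "cmod (R (n + n0) (f w, g w)) \<le> C + 1" if "w \<in> ball z e" for n w
        proof -
          have "cmod (R (n + n0) (f w, g w)) \<le> C + 1 / Suc (n + n0)"
            by (rule n0) (use de(3)[OF that] in auto)
          also have "\<dots> \<le> C + 1" by simp
          finally show ?thesis .
        qed
      qed (use de lim in auto)
      have "F (f w, g w) = G w" if "w \<in> ball z e" for w
        by (rule LIMSEQ_unique[OF lim[OF that] G(2)[OF that]])
      then have "(\<lambda>w. F (f w, g w)) holomorphic_on ball z e"
        by (intro holomorphic_transform[OF G(1)]) auto
      then show ?thesis using de(2) by (simp add: holomorphic_on_imp_differentiable_at)
    qed
    then show ?thesis by (simp add: holomorphic_on_def field_differentiable_at_within)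
  qed
  have half: "\<exists>e>0. \<forall>w\<in>ball z e. Re w > Re z / 2" if "Re z > 0" for z
  proof (intro exI[of _ "Re z / 2"] conjI ballI)
    show "Re z / 2 < Re w" if "w \<in> ball z (Re z / 2)" for w
      using that abs_Re_le_cmod[of "z - w"] by (auto simp: dist_norm)
  qed (use that in auto)
  have "holomorphic2_on F (half_planes 0)"
  proof (rule osgood[of F C])
    show "(\<lambda>s. F (s, t)) holomorphic_on {s. Re s > 0}" if t: "Re t > 0" for t
    proof (rule sep)
      fix z assume z: "Re z > 0"
      obtain e where "e > 0" "\<forall>w\<in>ball z e. Re w > Re z / 2" using half[OF z] by blast
      then show "\<exists>\<delta>>0. \<exists>e>0. \<forall>w\<in>ball z e. Re w > 0 \<and> Re w > \<delta> \<and> Re t > \<delta>"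
        using z t by (intro exI[of _ "min (Re z / 2) (Re t / 2)"] conjI exI[of _ e] ballI) force+
    qed (auto intro!: holomorphic_intros)
    show "(\<lambda>t. F (s, t)) holomorphic_on {t. Re t > 0}" if t: "Re s > 0" for s
    proof (rule sep)
      fix z assume z: "Re z > 0"
      obtain e where "e > 0" "\<forall>w\<in>ball z e. Re w > Re z / 2" using half[OF z] by blast
      then show "\<exists>\<delta>>0. \<exists>e>0. \<forall>w\<in>ball z e. Re w > 0 \<and> Re s > \<delta> \<and> Re w > \<delta>"
        using z t by (intro exI[of _ "min (Re z / 2) (Re s / 2)"] conjI exI[of _ e] ballI) force+
    qed (auto intro!: holomorphic_intros)
  qed (rule Fb)
  then have "extends_series a F"
    using Dsum FD by (simp add: extends_series_def)
  then show ?thesis using that Fb by blast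
qed

section \<open>Averages over a grid of vertical translations\<close>

definition mean2 :: "nat \<Rightarrow> (nat \<times> nat \<Rightarrow> complex) \<Rightarrow> complex" where
  "mean2 T f = (\<Sum>j\<in>{..<Suc T} \<times> {..<Suc T}. f j) / of_nat (Suc T * Suc T)"

lemma mean2_sum: "mean2 T (\<lambda>j. \<Sum>i\<in>E. f i j) = (\<Sum>i\<in>E. mean2 T (f i))"
  unfolding mean2_def by (subst sum.swap) (simp add: sum_divide_distrib)

lemma mean2_cmult: "mean2 T (\<lambda>j. c * f j) = c * mean2 T f"
  by (simp add: mean2_def sum_distrib_left)

lemma norm_mean2_le:
  assumes "\<And>j. cmod (f j) \<le> C" shows "cmod (mean2 T f) \<le> C"
proof -
  have "cmod (\<Sum>j\<in>{..<Suc T} \<times> {..<Suc T}. f j) \<le> of_nat (card ({..<Suc T} \<times> {..<Suc T})) * C"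
    using assms by (intro sum_norm_bound) auto
  also have "\<dots> = C * real (Suc T * Suc T)" by (simp add: card_cartesian_product)
  finally have "cmod (\<Sum>j\<in>{..<Suc T} \<times> {..<Suc T}. f j) \<le> C * real (Suc T * Suc T)" .
  moreover have "0 < real (Suc T * Suc T)" by (simp only: of_nat_0_less_iff) simp
  ultimately show ?thesis
    unfolding mean2_def norm_divide norm_of_nat by (simp only: pos_divide_le_eq)
qed

text \<open>Geometric sums whose ratio has modulus 1 but differs from 1 stay bounded, so their
  averages tend to 0. The mean over the square grid is a product of two such averages.\<close>

lemma mean2_powers:
  assumes "cmod x = 1" "cmod y = 1"
  shows "(\<lambda>T. mean2 T (\<lambda>j. x ^ fst j * y ^ snd j)) \<longlonglongrightarrow> (if x = 1 \<and> y = 1 then 1 else 0)"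
proof -
  have one: "(\<lambda>T. (\<Sum>j<Suc T. x ^ j) / of_nat (Suc T)) \<longlonglongrightarrow> (if x = 1 then 1 else 0)"
    if "cmod x = 1" for x :: complex
  proof (cases "x = 1")
    case True
    have "(\<lambda>T. of_nat (Suc T) / of_nat (Suc T) :: complex) = (\<lambda>T. 1)"
      by (intro ext divide_self) (rule of_nat_neq_0)
    then show ?thesis using True by simp
  next
    case False
    show ?thesis
      unfolding if_not_P[OF False]
    proof (rule Lim_null_comparison)
      show "\<forall>\<^sub>F T in sequentially. norm ((\<Sum>j<Suc T. x ^ j) / of_nat (Suc T)) \<le> 2 / cmod (x - 1) * (1 / real (Suc T))"
      proof (intro always_eventually allI)
        fix T
        have "(\<Sum>j<Suc T. x ^ j) = (x ^ Suc T - 1) / (x - 1)" by (rule geometric_sum[OF False])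
        then have "cmod (\<Sum>j<Suc T. x ^ j) = cmod (x ^ Suc T - 1) / cmod (x - 1)"
          by (simp only: norm_divide)
        also have "cmod (x ^ Suc T - 1) \<le> cmod (x ^ Suc T) + cmod 1" by (rule norm_triangle_ineq4)
        also have "\<dots> = 2" using that by (simp only: norm_power) simp
        finally have "cmod (\<Sum>j<Suc T. x ^ j) \<le> 2 / cmod (x - 1)" by (simp add: divide_right_mono)
        then have "cmod (\<Sum>j<Suc T. x ^ j) * (1 / real (Suc T)) \<le> 2 / cmod (x - 1) * (1 / real (Suc T))"
          by (intro mult_right_mono) auto
        then show "norm ((\<Sum>j<Suc T. x ^ j) / of_nat (Suc T)) \<le> 2 / cmod (x - 1) * (1 / real (Suc T))"
          by (simp only: norm_divide norm_of_nat) simp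
      qed
      show "(\<lambda>T. 2 / cmod (x - 1) * (1 / real (Suc T))) \<longlonglongrightarrow> 0"
        by (rule tendsto_mult_right_zero[OF LIMSEQ_Suc[OF lim_1_over_n]])
    qed
  qed
  have "mean2 T (\<lambda>j. x ^ fst j * y ^ snd j) =
      ((\<Sum>j<Suc T. x ^ j) / of_nat (Suc T)) * ((\<Sum>j<Suc T. y ^ j) / of_nat (Suc T))" for T
    unfolding mean2_def times_divide_times_eq sum_product sum.cartesian_product of_nat_mult
    by (simp add: case_prod_beta')
  then show ?thesis
    using tendsto_mult[OF one[OF assms(1)] one[OF assms(2)]] by (auto split: if_splits)
qed

text \<open>The averages run over integer multiples of one step \<delta>, so distinct integers must
  not give the same character at that step. Each pair of integers excludes countably many steps, and
  there are countably many pairs.\<close>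

lemma exists_separating_frequency:
  obtains \<delta> :: real where "\<And>m n. m \<ge> 1 \<Longrightarrow> n \<ge> 1 \<Longrightarrow>
    exp (- \<i> * of_real (\<delta> * (ln (real m) - ln (real n)))) = 1 \<Longrightarrow> m = n"
proof -
  define bad where "bad = (\<lambda>(m::nat, n::nat, k::int). 2 * pi * of_int k / (ln (real m) - ln (real n))) ` UNIV"
  have "countable bad" unfolding bad_def by auto
  then obtain \<delta> where \<delta>: "\<delta> \<notin> bad" using uncountable_UNIV_real by (metis UNIV_eq_I)
  show ?thesis
  proof (rule that[of \<delta>], rule ccontr)
    fix m n :: nat
    assume mn: "m \<ge> 1" "n \<ge> 1" "m \<noteq> n"
      and e: "exp (- \<i> * of_real (\<delta> * (ln (real m) - ln (real n)))) = 1"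
    from e obtain k :: int where "Im (- \<i> * of_real (\<delta> * (ln (real m) - ln (real n)))) = of_int (2 * k) * pi"
      unfolding exp_eq_1 by blast
    then have "- (\<delta> * (ln (real m) - ln (real n))) = 2 * pi * of_int k" by simp
    then have "\<delta> * (ln (real m) - ln (real n)) = 2 * pi * of_int (- k)"
      by (simp only: of_int_minus mult_minus_right)
    moreover have "ln (real m) - ln (real n) \<noteq> 0" using mn by simp
    ultimately have "\<delta> = 2 * pi * of_int (- k) / (ln (real m) - ln (real n))" by (simp add: field_simps)
    then have "\<delta> \<in> bad" unfolding bad_def by (intro image_eqI[of _ _ "(m, n, -k)"]) auto
    with \<delta> show False by simp
  qed
qed

lemma of_nat_powr_exp:
  "m \<ge> 1 \<Longrightarrow> of_nat m powr (- s) = exp (- s * complex_of_real (ln (real m)))"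
  by (simp add: powr_def Ln_of_nat)

text \<open>Averaging \<open>F\<close> over vertical translations against the character sums of \<open>b\<close> and \<open>c\<close> turns the
  pointwise bound of \<open>F\<close> into the operator bound, first for the series on \<open>Re z > 1/2\<close>; by Vitali's
  theorem the averages converge to the bilinear form on all of \<open>Re z > 0\<close>, and \<open>z \<rightarrow> 0\<close>.\<close>

lemma multiplier_bound_sup:
  assumes F: "extends_series a F" and M: "\<And>p. p \<in> half_planes 0 \<Longrightarrow> cmod (F p) \<le> M"
  shows "multiplier_bound a M"
  unfolding multiplier_bound_def
proof safe
  fix E K :: "(nat \<times> nat) set" and b c
  assume E: "finite E" "E \<subseteq> index_pairs" and K: "finite K" "K \<subseteq> index_pairs"
  obtain \<delta> where \<delta>: "\<And>m n. m \<ge> 1 \<Longrightarrow> n \<ge> 1 \<Longrightarrow>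
    exp (- \<i> * of_real (\<delta> * (ln (real m) - ln (real n)))) = 1 \<Longrightarrow> m = n"
    using exists_separating_frequency by blast
  \<comment> \<open>Purely imaginary shifts do not leave \<open>half_planes 0\<close>, and the
    monomials at them have modulus 1 and are orthonormal in mean.\<close>
  define \<tau> where "\<tau> = (\<lambda>j::nat. \<i> * of_real (\<delta> * real j))"
  define \<psi> where "\<psi> = (\<lambda>j i. dirichlet_monomial (\<tau> (fst j), \<tau> (snd j)) i)"
  have M0: "M \<ge> 0" using order_trans[OF norm_ge_zero M[of "(1,1)"]] by (auto simp: half_planes_def)
  have n\<psi>: "cmod (\<psi> j i) = 1" if "i \<in> index_pairs" for i j
    using that by (auto simp: \<psi>_def norm_dirichlet_monomial \<tau>_def index_pairs_def)
  have \<psi>mean: "(\<lambda>T. mean2 T (\<lambda>j. \<psi> j i * cnj (\<psi> j k))) \<longlonglongrightarrow> (if i = k then 1 else 0)"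
    if i: "i \<in> index_pairs" and k: "k \<in> index_pairs" for i k
  proof -
    define x where "x = (\<lambda>m n. exp (- \<i> * of_real (\<delta> * (ln (real m) - ln (real n)))))"
    have pos: "fst i \<ge> 1" "snd i \<ge> 1" "fst k \<ge> 1" "snd k \<ge> 1" using i k by (auto simp: index_pairs_def)
    have x1: "of_nat m powr (- \<tau> j) * cnj (of_nat n powr (- \<tau> j)) = x m n ^ j" if "m \<ge> 1" "n \<ge> 1" for m n j
      using that by (simp add: of_nat_powr_exp x_def exp_cnj \<tau>_def flip: exp_add exp_of_nat_mult)
        (simp add: algebra_simps)
    have "\<psi> j i * cnj (\<psi> j k) = x (fst i) (fst k) ^ fst j * x (snd i) (snd k) ^ snd j" for j
      using x1[OF pos(1,3), of "fst j"] x1[OF pos(2,4), of "snd j"]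
      by (simp add: \<psi>_def dirichlet_monomial_def mult_ac)
    moreover have "cmod (x m n) = 1" for m n by (simp add: x_def)
    moreover have "x m n = 1 \<longleftrightarrow> m = n" if "m \<ge> 1" "n \<ge> 1" for m n
      using \<delta>[OF that] by (auto simp: x_def)
    ultimately show ?thesis
      using mean2_powers[of "x (fst i) (fst k)" "x (snd i) (snd k)"] pos by (simp add: prod_eq_iff)
  qed
  define H where "H = (\<lambda>T i k z. mean2 T (\<lambda>j. F (\<tau> (fst j) + z, \<tau> (snd j) + z) * (\<psi> j i * cnj (\<psi> j k))))"
  define q where "q = (\<lambda>(i :: nat \<times> nat) (k :: nat \<times> nat). (fst k div fst i, snd k div snd i))"
  \<comment> \<open>The expected limit of the averaged entry: the matrix entry damped by the
    monomial of the quotient \<open>q i k\<close> at \<open>(z, z)\<close>. At \<open>z = 0\<close>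
    the damping disappears.\<close>
  define L where "L = (\<lambda>i k z. toeplitz a k i * dirichlet_monomial (z, z) (q i k))"
  have Hlim: "(\<lambda>T. H T i k z) \<longlonglongrightarrow> L i k z"
    if i: "i \<in> index_pairs" and k: "k \<in> index_pairs" and z: "Re z > 1/2" for i k z
  proof -
    \<comment> \<open>Where the series converges absolutely it may be averaged term by term;
      orthogonality in mean leaves only the index \<open>q\<close> with
      \<open>pair_times q i = k\<close>.\<close>
    define u where "u = (\<lambda>q. a (fst q) (snd q) * dirichlet_monomial (z, z) q)"
    define w where "w = (\<lambda>T q. mean2 T (\<lambda>j. \<psi> j (pair_times q i) * cnj (\<psi> j k)))"
    have pt: "pair_times q i \<in> index_pairs" if "q \<in> index_pairs" for q
      using that i by (auto simp: pair_times_def index_pairs_def)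
    have us: "(\<lambda>q. cmod (u q)) summable_on index_pairs"
    proof -
      have "u summable_on index_pairs"
        using F z unfolding extends_series_def u_def by (auto simp: half_planes_def intro: has_sum_imp_summable)
      then show ?thesis using summable_on_iff_abs_summable_on_complex by blast
    qed
    have "H T i k z = (\<Sum>\<^sub>\<infinity>q\<in>index_pairs. u q * w T q)" for T
    proof -
      have t: "((\<lambda>q. u q * (\<psi> j (pair_times q i) * cnj (\<psi> j k))) has_sum
          F (\<tau> (fst j) + z, \<tau> (snd j) + z) * (\<psi> j i * cnj (\<psi> j k))) index_pairs" for j
      proof -
        have p: "(\<tau> (fst j) + z, \<tau> (snd j) + z) \<in> half_planes (1/2)" using z by (simp add: half_planes_def \<tau>_def)
        have "((\<lambda>q. a (fst q) (snd q) * dirichlet_monomial (\<tau> (fst j) + z, \<tau> (snd j) + z) q)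
            has_sum F (\<tau> (fst j) + z, \<tau> (snd j) + z)) index_pairs"
          using F p by (auto simp: extends_series_def)
        from has_sum_cmult_left[OF this, of "\<psi> j i * cnj (\<psi> j k)"] show ?thesis
        proof (rule has_sum_cong[THEN iffD1, rotated])
          fix q
          have "dirichlet_monomial (\<tau> (fst j) + z, \<tau> (snd j) + z) q = dirichlet_monomial (z, z) q * \<psi> j q"
            unfolding dirichlet_monomial_def \<psi>_def fst_conv snd_conv minus_add_distrib powr_add
            by (simp only: mult_ac)
          then show "a (fst q) (snd q) * dirichlet_monomial (\<tau> (fst j) + z, \<tau> (snd j) + z) q * (\<psi> j i * cnj (\<psi> j k))
              = u q * (\<psi> j (pair_times q i) * cnj (\<psi> j k))"
            by (simp add: u_def \<psi>_def dirichlet_monomial_times)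
        qed
      qed
      have "((\<lambda>q. \<Sum>j\<in>J. u q * (\<psi> j (pair_times q i) * cnj (\<psi> j k))) has_sum
          (\<Sum>j\<in>J. F (\<tau> (fst j) + z, \<tau> (snd j) + z) * (\<psi> j i * cnj (\<psi> j k)))) index_pairs" if "finite J" for J
        using that by (induction J) (auto intro!: has_sum_add t)
      from has_sum_cmult_left[OF this, of "{..<Suc T} \<times> {..<Suc T}" "inverse (of_nat (Suc T * Suc T))"]
      have "((\<lambda>q. u q * w T q) has_sum H T i k z) index_pairs"
        unfolding H_def w_def mean2_cmult[symmetric] unfolding mean2_def divide_inverse by simp
      then show ?thesis by (simp add: infsumI)
    qed
    moreover have "(\<lambda>T. \<Sum>\<^sub>\<infinity>q\<in>index_pairs. u q * w T q) \<longlonglongrightarrow>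
        (\<Sum>\<^sub>\<infinity>q\<in>index_pairs. u q * (if pair_times q i = k then 1 else 0))"
    proof (rule tendsto_infsum_dominated[OF us])
      show "cmod (u q * w T q) \<le> cmod (u q)" if "q \<in> index_pairs" for T q
        unfolding norm_mult w_def using n\<psi>[OF pt[OF that]] n\<psi>[OF k]
        by (intro mult_left_le norm_mean2_le) (auto simp: norm_mult)
      show "(\<lambda>T. u q * w T q) \<longlonglongrightarrow> u q * (if pair_times q i = k then 1 else 0)" if "q \<in> index_pairs" for q
        unfolding w_def by (intro tendsto_mult tendsto_const \<psi>mean pt that k)
    qed
    moreover have "(\<Sum>\<^sub>\<infinity>q\<in>index_pairs. u q * (if pair_times q i = k then 1 else 0)) = L i k z"
    proof (cases "fst i dvd fst k \<and> snd i dvd snd k")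
      case True
      have pos: "fst i > 0" "snd i > 0" "fst k > 0" "snd k > 0" using i k by (auto simp: index_pairs_def)
      have qi: "q i k \<in> index_pairs" using True pos
        by (auto simp: q_def index_pairs_def Suc_le_eq dvd_imp_le div_greater_zero_iff)
      have "pair_times q' i = k \<longleftrightarrow> q' = q i k" for q'
        using True pos by (auto simp: pair_times_def q_def prod_eq_iff)
      then have "(\<Sum>\<^sub>\<infinity>q\<in>index_pairs. u q * (if pair_times q i = k then 1 else 0)) = (\<Sum>\<^sub>\<infinity>q'\<in>{q i k}. u q')"
        using qi by (intro infsum_cong_neutral) auto
      also have "\<dots> = L i k z" using True by (simp add: u_def L_def toeplitz_def q_def)
      finally show ?thesis .
    next
      case False
      then have "pair_times q i \<noteq> k" for q by (auto simp: pair_times_def)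
      then show ?thesis using False by (auto simp: L_def toeplitz_def)
    qed
    ultimately show ?thesis by simp
  qed
  define G where "G = (\<lambda>T z. \<Sum>k\<in>K. \<Sum>i\<in>E. b i * c k * H T i k z)"
  define Q where "Q = (\<lambda>z. \<Sum>k\<in>K. \<Sum>i\<in>E. b i * c k * L i k z)"
  define PB where "PB = (\<lambda>j. \<Sum>i\<in>E. b i * \<psi> j i)"
  \<comment> \<open>\<open>c\<close> is conjugated because the averages contain
    \<open>cnj (PC j)\<close>, which restores the bilinear form.\<close>
  define PC where "PC = (\<lambda>j. \<Sum>k\<in>K. cnj (c k) * \<psi> j k)"
  have norm_lim: "(\<lambda>T. Re (mean2 T (\<lambda>j. of_real ((cmod (\<Sum>i\<in>E. b i * \<psi> j i))\<^sup>2)))) \<longlonglongrightarrow> (\<Sum>i\<in>E. (cmod (b i))\<^sup>2)"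
    if E: "finite E" "E \<subseteq> index_pairs" for E and b :: "nat \<times> nat \<Rightarrow> complex"
  proof -
    have "of_real ((cmod (\<Sum>i\<in>E. b i * \<psi> j i))\<^sup>2) = (\<Sum>i\<in>E. \<Sum>k\<in>E. (b i * cnj (b k)) * (\<psi> j i * cnj (\<psi> j k)))" for j
      unfolding complex_norm_square by (simp add: sum_product mult_ac)
    then have "mean2 T (\<lambda>j. of_real ((cmod (\<Sum>i\<in>E. b i * \<psi> j i))\<^sup>2)) =
        (\<Sum>i\<in>E. \<Sum>k\<in>E. (b i * cnj (b k)) * mean2 T (\<lambda>j. \<psi> j i * cnj (\<psi> j k)))" for T
      by (simp only: mean2_sum mean2_cmult)
    moreover have "(\<lambda>T. \<Sum>i\<in>E. \<Sum>k\<in>E. (b i * cnj (b k)) * mean2 T (\<lambda>j. \<psi> j i * cnj (\<psi> j k)))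
        \<longlonglongrightarrow> (\<Sum>i\<in>E. \<Sum>k\<in>E. (b i * cnj (b k)) * (if i = k then 1 else 0))"
      using E by (intro tendsto_sum tendsto_mult tendsto_const \<psi>mean) auto
    moreover have "(\<Sum>i\<in>E. \<Sum>k\<in>E. (b i * cnj (b k)) * (if i = k then 1 else 0)) = of_real (\<Sum>i\<in>E. (cmod (b i))\<^sup>2)"
      using E(1) by (simp add: complex_norm_square if_distrib[of "\<lambda>x. _ * x"] cong: if_cong del: of_real_power)
    ultimately have "(\<lambda>T. mean2 T (\<lambda>j. of_real ((cmod (\<Sum>i\<in>E. b i * \<psi> j i))\<^sup>2))) \<longlonglongrightarrow> of_real (\<Sum>i\<in>E. (cmod (b i))\<^sup>2)"
      by simp
    from tendsto_Re[OF this] show ?thesis by simp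
  qed
  define nB where "nB = (\<lambda>T. Re (mean2 T (\<lambda>j. of_real ((cmod (PB j))\<^sup>2))))"
  define nC where "nC = (\<lambda>T. Re (mean2 T (\<lambda>j. of_real ((cmod (PC j))\<^sup>2))))"
  have nB: "nB \<longlonglongrightarrow> (\<Sum>i\<in>E. (cmod (b i))\<^sup>2)"
    using norm_lim[OF E, of b] by (simp add: nB_def[abs_def] PB_def)
  have nC: "nC \<longlonglongrightarrow> (\<Sum>k\<in>K. (cmod (c k))\<^sup>2)"
    using norm_lim[OF K, of "\<lambda>k. cnj (c k)"] by (simp add: nC_def[abs_def] PC_def)
  \<comment> \<open>Cauchy-Schwarz on the grid. The right side is independent of \<open>z\<close>
    and converges in \<open>T\<close>, so it serves both as the uniform bound for Vitali's theorem
    and as the bound for the limit.\<close>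
  have Gbound: "cmod (G T z) \<le> M * (sqrt (nB T) * sqrt (nC T))" if z: "Re z > 0" for T z
  proof -
    let ?J = "{..<Suc T} \<times> {..<Suc T}"
    let ?N = "real (Suc T * Suc T)"
    have "G T z = mean2 T (\<lambda>j. \<Sum>k\<in>K. \<Sum>i\<in>E. (b i * c k) * (F (\<tau> (fst j) + z, \<tau> (snd j) + z) * (\<psi> j i * cnj (\<psi> j k))))"
      by (simp only: G_def H_def mean2_sum mean2_cmult)
    also have "\<dots> = mean2 T (\<lambda>j. F (\<tau> (fst j) + z, \<tau> (snd j) + z) * (PB j * cnj (PC j)))"
      by (rule arg_cong[of _ _ "mean2 T"], rule ext)
         (simp add: PB_def PC_def sum_product sum_distrib_left mult_ac sum.swap[of _ K E])
    also have "cmod \<dots> \<le> (\<Sum>j\<in>?J. M * (cmod (PB j) * cmod (PC j))) / ?N"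
      unfolding mean2_def norm_divide norm_of_nat
    proof (intro divide_right_mono sum_norm_le)
      fix j
      show "cmod (F (\<tau> (fst j) + z, \<tau> (snd j) + z) * (PB j * cnj (PC j))) \<le> M * (cmod (PB j) * cmod (PC j))"
        unfolding norm_mult complex_mod_cnj using z
        by (intro mult_right_mono M) (auto simp: half_planes_def \<tau>_def)
    qed auto
    also have "\<dots> = M * ((\<Sum>j\<in>?J. \<bar>cmod (PB j)\<bar> * \<bar>cmod (PC j)\<bar>) / ?N)"
      by (simp only: sum_distrib_left[symmetric] abs_norm_cancel times_divide_eq_right)
    also have "\<dots> \<le> M * ((L2_set (\<lambda>j. cmod (PB j)) ?J * L2_set (\<lambda>j. cmod (PC j)) ?J) / ?N)"
      by (intro mult_left_mono divide_right_mono L2_set_mult_ineq M0) auto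
    also have "(L2_set (\<lambda>j. cmod (PB j)) ?J * L2_set (\<lambda>j. cmod (PC j)) ?J) / ?N = sqrt (nB T) * sqrt (nC T)"
    proof -
      have Re_mean: "Re (mean2 T (\<lambda>j. of_real (f j))) = (\<Sum>j\<in>?J. f j) / ?N" for f
        unfolding mean2_def Re_divide_of_nat Re_sum Re_complex_of_real by (rule refl)
      have "sqrt (nB T) * sqrt (nC T) = (L2_set (\<lambda>j. cmod (PB j)) ?J * L2_set (\<lambda>j. cmod (PC j)) ?J) / (sqrt ?N * sqrt ?N)"
        unfolding nB_def nC_def Re_mean L2_set_def real_sqrt_divide by (rule times_divide_times_eq)
      also have "sqrt ?N * sqrt ?N = ?N" by (simp only: real_sqrt_mult_self abs_of_nat)
      finally show ?thesis by (rule sym)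
    qed
    finally show ?thesis .
  qed
  have lim: "(\<lambda>T. M * (sqrt (nB T) * sqrt (nC T))) \<longlonglongrightarrow>
      M * (sqrt (\<Sum>i\<in>E. (cmod (b i))\<^sup>2) * sqrt (\<Sum>k\<in>K. (cmod (c k))\<^sup>2))"
    by (intro tendsto_mult tendsto_const tendsto_real_sqrt nB nC)
  obtain B0 where B0: "\<And>T. norm (M * (sqrt (nB T) * sqrt (nC T))) \<le> B0"
    using convergent_imp_Bseq[OF convergentI[OF lim]] by (auto simp: Bseq_def)
  have Qhol: "Q holomorphic_on UNIV"
  proof -
    have "(\<lambda>z. L i k z) holomorphic_on UNIV" if "i \<in> E" "k \<in> K" for i k
    proof (cases "toeplitz a k i = 0")
      case False
      then have "fst i dvd fst k" "snd i dvd snd k" by (auto simp: toeplitz_def split: if_splits)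
      then have "q i k \<in> index_pairs"
        using that E K by (fastforce simp: q_def index_pairs_def Suc_le_eq dvd_imp_le div_greater_zero_iff)
      then show ?thesis unfolding L_def by (intro holomorphic_intros holomorphic_dirichlet_monomial)
    qed (simp add: L_def)
    then show ?thesis unfolding Q_def by (intro holomorphic_intros) auto
  qed
  have GQ: "(\<lambda>T. G T z) \<longlonglongrightarrow> Q z" if "Re z > 1/2" for z
    unfolding G_def Q_def using E K by (intro tendsto_intros Hlim that) auto
  obtain G' where G': "G' holomorphic_on {z. Re z > 0}" "\<And>z. z \<in> {z. Re z > 0} \<Longrightarrow> (\<lambda>T. G T z) \<longlonglongrightarrow> G' z"
  proof (rule vitali_convergence[of "{z. Re z > 0}" G B0 "{z. Re z > 1/2}" Q])
    show "G T holomorphic_on {z. 0 < Re z}" for T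
    proof -
      have "(\<lambda>z. F (\<tau> (fst j) + z, \<tau> (snd j) + z)) holomorphic_on {z. 0 < Re z}" for j
        by (rule holomorphic2_slice) (use F in \<open>auto simp: extends_series_def open_Re_gt half_planes_def \<tau>_def\<close>)
      then show ?thesis unfolding G_def H_def mean2_def by (intro holomorphic_intros) auto
    qed
    show "cmod (G T z) \<le> B0" if "z \<in> {z. 0 < Re z}" for T z
      using Gbound[of z T] B0[of T] that by simp
    show "{z. 1 / 2 < Re z} \<noteq> {}" by (auto intro!: exI[of _ "1::complex"])
    show "open {z. 1 / 2 < Re z}" by (rule open_Re_gt)
  qed (use GQ in \<open>auto simp: open_Re_gt connected_Re_gt\<close>)
  have Qbound: "cmod (Q z) \<le> M * (sqrt (\<Sum>i\<in>E. (cmod (b i))\<^sup>2) * sqrt (\<Sum>k\<in>K. (cmod (c k))\<^sup>2))"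
    if z: "Re z > 0" for z
  proof -
    have "G' z = Q z"
    proof (rule analytic_continuation_open[of "{z. Re z > 1/2}" "{z. Re z > 0}" G' Q])
      show "{z. 1 / 2 < Re z} \<noteq> {}" by (auto intro!: exI[of _ "1::complex"])
      show "open {z. 1 / 2 < Re z}" by (rule open_Re_gt)
      show "G' w = Q w" if "w \<in> {z. 1 / 2 < Re z}" for w
        by (rule LIMSEQ_unique[OF G'(2) GQ]) (use that in auto)
    qed (use z G' holomorphic_on_subset[OF Qhol] in \<open>auto simp: open_Re_gt connected_Re_gt\<close>)
    then have "(\<lambda>T. cmod (G T z)) \<longlonglongrightarrow> cmod (Q z)" using G'(2)[of z] z by (auto intro: tendsto_norm)
    then show ?thesis by (rule LIMSEQ_le[OF _ lim]) (use Gbound[OF z] in auto)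
  qed
  \<comment> \<open>\<open>Q\<close> is a finite combination of exponentials and hence entire, so
    the estimate survives at the boundary point 0, although nothing is known about \<open>F\<close>
    there.\<close>
  have "(\<lambda>n. Q (of_real (1 / real (Suc n)))) \<longlonglongrightarrow> Q 0"
  proof (rule isCont_tendsto_compose[of 0 Q])
    show "isCont Q 0" using holomorphic_on_imp_continuous_on[OF Qhol] by (simp add: continuous_on_eq_continuous_at)
    show "(\<lambda>n. complex_of_real (1 / real (Suc n))) \<longlonglongrightarrow> 0"
      using tendsto_of_real[OF LIMSEQ_Suc[OF lim_1_over_n], where 'a = complex] by simp
  qed
  then have "(\<lambda>n. cmod (Q (of_real (1 / real (Suc n))))) \<longlonglongrightarrow> cmod (Q 0)" by (rule tendsto_norm)
  then have "cmod (Q 0) \<le> M * (sqrt (\<Sum>i\<in>E. (cmod (b i))\<^sup>2) * sqrt (\<Sum>k\<in>K. (cmod (c k))\<^sup>2))"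
    by (rule tendsto_upperbound) (auto intro!: always_eventually Qbound)
  moreover have "Q 0 = (\<Sum>k\<in>K. \<Sum>i\<in>E. toeplitz a k i * b i * c k)"
    unfolding Q_def
  proof (intro sum.cong refl)
    fix k i assume "k \<in> K" "i \<in> E"
    then have "k \<in> index_pairs" "i \<in> index_pairs" using E K by auto
    then have "dirichlet_monomial (0, 0) (q i k) = 1" if "toeplitz a k i \<noteq> 0"
      using that by (auto simp: toeplitz_def dirichlet_monomial_def q_def index_pairs_def dvd_div_eq_0_iff split: if_splits)
    then show "b i * c k * L i k 0 = toeplitz a k i * b i * c k"
      by (cases "toeplitz a k i = 0") (auto simp: L_def)
  qed
  ultimately show "cmod (\<Sum>k\<in>K. \<Sum>i\<in>E. toeplitz a k i * b i * c k)
      \<le> M * sqrt (\<Sum>i\<in>E. (cmod (b i))\<^sup>2) * sqrt (\<Sum>k\<in>K. (cmod (c k))\<^sup>2)"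
    by (simp add: mult.assoc)
qed

text \<open>\<open>C\<close> acts only through existence and boundedness: it makes the choice in
  \<open>dirichlet_function\<close> meaningful and the supremum that of a bounded set. Uniqueness of
  the extension transfers the bound from the constructed function to the chosen one.\<close>

lemma multiplier_bound_dirichlet_sup_norm:
  assumes a: "multiplier_bound a C"
    and sq: "(\<lambda>i. (cmod (a (fst i) (snd i)))\<^sup>2) summable_on index_pairs"
  shows "multiplier_bound a (dirichlet_sup_norm a)"
proof -
  obtain F0 where F0: "extends_series a F0" "\<And>p. p \<in> half_planes 0 \<Longrightarrow> cmod (F0 p) \<le> C"
    using bounded_extension_exists[OF a sq] by blast
  have "dirichlet_function a = (SOME F. extends_series a F)"
    unfolding dirichlet_function_def extends_series_def
    by (simp add: case_prod_beta' dirichlet_monomial_def mult.assoc)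
  then have F: "extends_series a (dirichlet_function a)"
    using someI[of "extends_series a", OF F0(1)] by simp
  have eq: "dirichlet_function a p = F0 p" if "p \<in> half_planes 0" for p
  proof (rule holomorphic2_unique[OF _ _ _ that])
    show "dirichlet_function a p = F0 p" if "p \<in> half_planes (1/2)" for p
      using F F0(1) that has_sum_unique unfolding extends_series_def by blast
  qed (use F F0(1) in \<open>auto simp: extends_series_def\<close>)
  show ?thesis
  proof (rule multiplier_bound_sup[OF F])
    fix p :: "complex \<times> complex" assume p: "p \<in> half_planes 0"
    show "cmod (dirichlet_function a p) \<le> dirichlet_sup_norm a"
      unfolding dirichlet_sup_norm_def
      by (rule cSUP_upper[OF p], rule bdd_aboveI2[where M = C]) (simp add: eq F0(2))
  qed
qed

section \<open>Dilations on the square\<close>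

text \<open>The substitution stretches the unit interval to \<open>{0<..<real m}\<close>, and
  evenness together with the period 2 makes all its unit cells contribute alike. Nonnegative
  integrals keep integrability out of the argument.\<close>

lemma even_periodic_nn_integral:
  fixes g :: "real \<Rightarrow> ennreal"
  assumes [measurable]: "g \<in> borel_measurable borel"
    and even: "\<And>x. g (- x) = g x" and per: "\<And>x. g (x + 2) = g x" and m: "m \<ge> 1"
  shows "(\<integral>\<^sup>+x. g (real m * x) * indicator {0<..<1} x \<partial>lborel) = (\<integral>\<^sup>+x. g x * indicator {0<..<1} x \<partial>lborel)"
proof -
  have shift: "g (2 * real k - x) = g x" for k x
  proof (induction k)
    case (Suc k)
    have "g (2 * real (Suc k) - x) = g ((2 * real k - x) + 2)" by (simp add: algebra_simps)
    then show ?case using per Suc by simp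
  qed (simp add: even)
  define I where "I = (\<lambda>j::nat. \<integral>\<^sup>+x. g x * indicator {real j<..<real j + 1} x \<partial>lborel)"
  have I: "I j = I 0" for j
  proof (induction j)
    case (Suc j)
    \<comment> \<open>Reflection at \<open>Suc j\<close> exchanges the two neighbouring unit cells,
      and by \<open>shift\<close> it leaves \<open>g\<close> unchanged.\<close>
    have "I (Suc j) = ennreal \<bar>-1\<bar> * (\<integral>\<^sup>+x. g (2 * real (Suc j) + -1 * x)
        * indicator {real (Suc j)<..<real (Suc j) + 1} (2 * real (Suc j) + -1 * x) \<partial>lborel)"
      unfolding I_def by (rule nn_integral_real_affine) auto
    also have "\<dots> = I j"
      unfolding I_def using shift[of "Suc j"]
      by (simp, intro nn_integral_cong) (auto simp: indicator_def algebra_simps)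
    finally show ?case using Suc by simp
  qed simp
  have sum: "(\<integral>\<^sup>+x. g x * indicator {0<..<real k} x \<partial>lborel) = of_nat k * I 0" for k :: nat
  proof (induction k)
    case (Suc k)
    have "(\<integral>\<^sup>+x. g x * indicator {0<..<real (Suc k)} x \<partial>lborel) =
        (\<integral>\<^sup>+x. g x * indicator {0<..<real k} x + g x * indicator {real k<..<real k + 1} x \<partial>lborel)"
      \<comment> \<open>The open cells miss the point \<open>k\<close>, a null set.\<close>
      by (rule nn_integral_cong_AE, rule AE_mp[OF AE_lborel_singleton[of "real k"]])
         (auto simp: indicator_def intro!: AE_I2)
    also have "\<dots> = of_nat k * I 0 + I k"
      by (subst nn_integral_add) (auto simp: Suc I_def)
    also have "\<dots> = of_nat (Suc k) * I 0" using I[of k] by (simp add: distrib_right add.commute)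
    finally show ?case .
  qed simp
  have "of_nat m * I 0 = (\<integral>\<^sup>+x. g x * indicator {0<..<real m} x \<partial>lborel)" by (simp add: sum)
  also have "\<dots> = ennreal \<bar>real m\<bar> * (\<integral>\<^sup>+x. g (0 + real m * x) * indicator {0<..<real m} (0 + real m * x) \<partial>lborel)"
    using m by (intro nn_integral_real_affine) auto
  also have "(\<integral>\<^sup>+x. g (0 + real m * x) * indicator {0<..<real m} (0 + real m * x) \<partial>lborel) =
      (\<integral>\<^sup>+x. g (real m * x) * indicator {0<..<1} x \<partial>lborel)"
    using m by (intro nn_integral_cong) (auto simp: indicator_def zero_less_mult_iff)
  finally have "of_nat m * I 0 = of_nat m * (\<integral>\<^sup>+x. g (real m * x) * indicator {0<..<1} x \<partial>lborel)"
    by (simp add: ennreal_of_nat_eq_real_of_nat)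
  then show ?thesis using m by (simp add: ennreal_mult_cancel_left I_def)
qed

lemma unit_square_borel [measurable]: "unit_square \<in> sets borel"
  unfolding unit_square_def by (intro borel_open open_Times) auto

lemma space_square [simp]: "space square_measure = unit_square"
  by (simp add: square_measure_def space_restrict_space)

lemma square_measurable: "h \<in> borel_measurable borel \<Longrightarrow> h \<in> borel_measurable square_measure"
  unfolding square_measure_def by (intro measurable_restrict_space1) simp

lemma nn_integral_square:
  assumes [measurable]: "h \<in> borel_measurable borel"
  shows "(\<integral>\<^sup>+p. h p \<partial>square_measure) =
    (\<integral>\<^sup>+x. (\<integral>\<^sup>+y. h (x, y) * indicator {0<..<1} y \<partial>lborel) * indicator {0<..<1::real} x \<partial>lborel)"
proof -
  have [measurable]: "h \<in> borel_measurable (borel \<Otimes>\<^sub>M borel)" by (simp add: borel_prod)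
  have "(\<integral>\<^sup>+p. h p \<partial>square_measure) = (\<integral>\<^sup>+p. h p * indicator unit_square p \<partial>lborel)"
    unfolding square_measure_def by (subst nn_integral_restrict_space) auto
  also have "\<dots> = (\<integral>\<^sup>+p. h p * indicator ({0<..<1} \<times> {0<..<1}) p \<partial>(lborel \<Otimes>\<^sub>M lborel))"
    by (simp add: lborel_prod unit_square_def)
  also have "\<dots> = (\<integral>\<^sup>+x. \<integral>\<^sup>+y. h (x, y) * indicator ({0<..<1} \<times> {0<..<1}) (x, y) \<partial>lborel \<partial>lborel)"
    by (rule lborel.nn_integral_fst[symmetric]) simp
  also have "\<dots> = (\<integral>\<^sup>+x. (\<integral>\<^sup>+y. h (x, y) * indicator {0<..<1} y \<partial>lborel) * indicator {0<..<1::real} x \<partial>lborel)"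
    by (intro nn_integral_cong) (auto simp: indicator_def)
  finally show ?thesis .
qed

lemma finite_measure_square: "finite_measure square_measure"
proof
  have "emeasure square_measure (space square_measure) = emeasure lborel unit_square"
    by (simp add: square_measure_def emeasure_restrict_space)
  also have "\<dots> \<le> emeasure lborel (cbox (0::real, 0::real) (1, 1))"
  proof (rule emeasure_mono)
    show "unit_square \<subseteq> cbox (0::real, 0::real) (1, 1)"
      by (auto simp: unit_square_def cbox_Pair_eq)
  qed simp
  also have "\<dots> < \<infinity>" by (simp add: emeasure_lborel_cbox_eq)
  finally show "emeasure square_measure (space square_measure) \<noteq> \<infinity>" by simp
qed

text \<open>Folds the line onto the unit interval: the period removes even integers, and on odd
  cells a reflection brings in the sign. Oddness and the period force the zeros at the ends.\<close>

lemma odd_periodic_1d: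
  fixes g :: "real \<Rightarrow> complex"
  assumes odd: "\<And>x. g (- x) = - g x" and per: "\<And>x. g (x + 2) = g x"
  shows "g x = (if even \<lfloor>x\<rfloor> then g (frac x) else - g (1 - frac x))" and "g 0 = 0" and "g 1 = 0"
proof -
  have P: "g (x + 2 * of_int k) = g x" for x k
  proof (induction k rule: int_induct[where k = 0])
    case (step1 i)
    have "g (x + 2 * of_int (i + 1)) = g ((x + 2 * of_int i) + 2)" by (simp add: algebra_simps)
    then show ?case using per step1 by simp
  next
    case (step2 i)
    have "g ((x + 2 * of_int (i - 1)) + 2) = g (x + 2 * of_int i)" by (simp add: algebra_simps)
    then show ?case using per step2 by metis
  qed simp
  show "g 0 = 0" using odd[of 0] by simp
  show "g 1 = 0" using odd[of 1] per[of "-1"] by simp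
  show "g x = (if even \<lfloor>x\<rfloor> then g (frac x) else - g (1 - frac x))"
  proof (cases "even \<lfloor>x\<rfloor>")
    case True
    then obtain k where "\<lfloor>x\<rfloor> = 2 * k" by (elim evenE)
    then have "x = frac x + 2 * of_int k" by (simp add: frac_def)
    then show ?thesis using P[of "frac x" k] True by simp
  next
    case False
    then obtain k where "\<lfloor>x\<rfloor> = 2 * k + 1" by (elim oddE)
    then have "x = - (1 - frac x) + 2 * of_int (k + 1)" by (simp add: frac_def)
    then have "g x = g (- (1 - frac x))" using P[of "- (1 - frac x)" "k + 1"] by metis
    then show ?thesis using False odd[of "1 - frac x"] by simp
  qed
qed

text \<open>Measurability is given on the open square, while dilations evaluate
  \<open>\<phi>\<close> elsewhere. Folding expresses \<open>\<phi>\<close> everywhere through its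
  extension \<open>u\<close> by zero from the square; on the boundary of the square the two agree
  because an odd periodic function vanishes there.\<close>

lemma odd_periodic_measurable:
  assumes odd: "odd_periodic \<phi>" and meas: "\<phi> \<in> borel_measurable square_measure"
  shows "\<phi> \<in> borel_measurable borel"
proof -
  define u where "u = (\<lambda>p. indicator unit_square p *\<^sub>R \<phi> p)"
  have u[measurable]: "u \<in> borel_measurable borel"
    using meas unfolding u_def square_measure_def
    by (subst (asm) borel_measurable_restrict_space_iff) auto
  then have u'[measurable]: "u \<in> borel_measurable (borel \<Otimes>\<^sub>M borel)" by (simp add: borel_prod)
  define r where "r = (\<lambda>x::real. if even \<lfloor>x\<rfloor> then frac x else 1 - frac x)"
  define s where "s = (\<lambda>x::real. if even \<lfloor>x\<rfloor> then 1 else - 1 :: complex)"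
  have [measurable]: "r \<in> borel_measurable borel" "s \<in> borel_measurable borel"
    unfolding r_def s_def frac_def by measurable
  have zero: "\<phi> (0, y) = 0" "\<phi> (1, y) = 0" "\<phi> (x, 0) = 0" "\<phi> (x, 1) = 0" for x y
    using odd_periodic_1d(2,3)[of "\<lambda>x. \<phi> (x, y)"] odd_periodic_1d(2,3)[of "\<lambda>y. \<phi> (x, y)"] odd
    by (auto simp: odd_periodic_def)
  have r01: "0 \<le> r x" "r x \<le> 1" for x
    using frac_lt_1[of x] by (auto simp: r_def less_imp_le)
  have "\<phi> (x, y) = s x * s y * u (r x, r y)" for x y
  proof -
    have "\<phi> (x, y) = s x * \<phi> (r x, y)"
      using odd_periodic_1d(1)[of "\<lambda>x. \<phi> (x, y)" x] odd by (auto simp: odd_periodic_def r_def s_def)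
    also have "\<phi> (r x, y) = s y * \<phi> (r x, r y)"
      using odd_periodic_1d(1)[of "\<lambda>y. \<phi> (r x, y)" y] odd by (auto simp: odd_periodic_def r_def s_def)
    also have "\<phi> (r x, r y) = u (r x, r y)"
      using r01[of x] r01[of y] zero by (cases "r x = 0 \<or> r x = 1 \<or> r y = 0 \<or> r y = 1")
        (auto simp: u_def indicator_def unit_square_def)
    finally show ?thesis by simp
  qed
  then have "\<phi> = (\<lambda>p. s (fst p) * s (snd p) * u (r (fst p), r (snd p)))" by (auto simp: fun_eq_iff)
  also have "\<dots> \<in> borel_measurable (borel \<Otimes>\<^sub>M borel)" by measurable
  finally show ?thesis by (simp add: borel_prod)
qed

text \<open>The one-variable statement is applied to the inner integral and then to the outer one,
  whose integrand inherits evenness and period from \<open>h\<close>.\<close>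

lemma dilation_nn_integral:
  assumes odd: "odd_periodic \<phi>" and meas[measurable]: "\<phi> \<in> borel_measurable borel" and j: "j \<in> index_pairs"
  shows "(\<integral>\<^sup>+p. ennreal ((cmod (dilation \<phi> j p))\<^sup>2) \<partial>square_measure) =
    (\<integral>\<^sup>+p. ennreal ((cmod (\<phi> p))\<^sup>2) \<partial>square_measure)"
proof -
  obtain m n where mn: "j = (m, n)" "m \<ge> 1" "n \<ge> 1" using j by (auto simp: index_pairs_def)
  define h where "h = (\<lambda>p. ennreal ((cmod (\<phi> p))\<^sup>2))"
  have [measurable]: "h \<in> borel_measurable borel" unfolding h_def by measurable
  then have [measurable]: "h \<in> borel_measurable (borel \<Otimes>\<^sub>M borel)" by (simp add: borel_prod)
  have ev: "h (- x, y) = h (x, y)" "h (x, - y) = h (x, y)" "h (x + 2, y) = h (x, y)" "h (x, y + 2) = h (x, y)" for x y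
    using odd by (auto simp: h_def odd_periodic_def)
  have "(\<lambda>p. h (real m * fst p, real n * snd p)) \<in> borel_measurable (borel \<Otimes>\<^sub>M borel)" by measurable
  then have hm: "(\<lambda>p. h (real m * fst p, real n * snd p)) \<in> borel_measurable borel" by (simp add: borel_prod)
  have "(\<integral>\<^sup>+p. ennreal ((cmod (dilation \<phi> j p))\<^sup>2) \<partial>square_measure) =
      (\<integral>\<^sup>+p. h (real m * fst p, real n * snd p) \<partial>square_measure)"
    by (simp add: h_def dilation_def mn(1) case_prod_beta')
  also have "\<dots> = (\<integral>\<^sup>+x. (\<integral>\<^sup>+y. h (real m * x, real n * y) * indicator {0<..<1} y \<partial>lborel) * indicator {0<..<1} x \<partial>lborel)"
    by (subst nn_integral_square[OF hm]) simp
  also have "\<dots> = (\<integral>\<^sup>+x. (\<integral>\<^sup>+y. h (real m * x, y) * indicator {0<..<1} y \<partial>lborel) * indicator {0<..<1} x \<partial>lborel)"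
  proof -
    have "(\<integral>\<^sup>+y. h (real m * x, real n * y) * indicator {0<..<1} y \<partial>lborel) =
        (\<integral>\<^sup>+y. h (real m * x, y) * indicator {0<..<1} y \<partial>lborel)" for x
      by (rule even_periodic_nn_integral[of "\<lambda>y. h (real m * x, y)"]) (use ev mn in auto)
    then show ?thesis by (simp only:)
  qed
  also have "\<dots> = (\<integral>\<^sup>+x. (\<integral>\<^sup>+y. h (x, y) * indicator {0<..<1} y \<partial>lborel) * indicator {0<..<1} x \<partial>lborel)"
    by (rule even_periodic_nn_integral[of "\<lambda>x. \<integral>\<^sup>+y. h (x, y) * indicator {0<..<1} y \<partial>lborel"]) (use ev mn in auto)
  also have "\<dots> = (\<integral>\<^sup>+p. h p \<partial>square_measure)" by (rule nn_integral_square[symmetric]) simp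
  finally show ?thesis by (simp add: h_def)
qed

lemma dilation_measurable:
  assumes "\<phi> \<in> borel_measurable borel" shows "dilation \<phi> j \<in> borel_measurable borel"
proof -
  have [measurable]: "\<phi> \<in> borel_measurable (borel \<Otimes>\<^sub>M borel)" using assms by (simp add: borel_prod)
  have "(\<lambda>p. \<phi> (real (fst j) * fst p, real (snd j) * snd p)) \<in> borel_measurable (borel \<Otimes>\<^sub>M borel)" by measurable
  then show ?thesis by (simp add: borel_prod dilation_def case_prod_beta')
qed

lemma dilation_isometry:
  assumes odd: "odd_periodic \<phi>" and L2: "\<phi> \<in> L2 square_measure" and j: "j \<in> index_pairs"
  shows "dilation \<phi> j \<in> L2 square_measure"
    and "(\<integral>p. (cmod (dilation \<phi> j p))\<^sup>2 \<partial>square_measure) = (\<integral>p. (cmod (\<phi> p))\<^sup>2 \<partial>square_measure)"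
proof -
  have m: "\<phi> \<in> borel_measurable borel" by (rule odd_periodic_measurable[OF odd L2_measurable[OF L2]])
  note [measurable] = square_measurable[OF dilation_measurable[OF m, of j]] square_measurable[OF m]
  note eq = dilation_nn_integral[OF odd m j]
  have "(\<integral>\<^sup>+p. ennreal ((cmod (\<phi> p))\<^sup>2) \<partial>square_measure) < \<infinity>"
    using L2_integrable[OF L2] by (auto simp: integrable_iff_bounded)
  then show "dilation \<phi> j \<in> L2 square_measure"
    using eq by (auto simp: L2_def integrable_iff_bounded)
  show "(\<integral>p. (cmod (dilation \<phi> j p))\<^sup>2 \<partial>square_measure) = (\<integral>p. (cmod (\<phi> p))\<^sup>2 \<partial>square_measure)"
    by (subst (1 2) integral_eq_nn_integral) (auto simp: eq)
qed

section \<open>The sine basis and its totality\<close>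

abbreviation sine_basis :: "nat \<times> nat \<Rightarrow> real \<times> real \<Rightarrow> complex" where
  "sine_basis i \<equiv> sine2 (fst i) (snd i)"

lemma sine2_eq: "sine2 m n p = complex_of_real (sine m (fst p) * sine n (snd p))"
  by (simp add: sine2_def case_prod_beta')

lemma sine_continuous:
  fixes f :: "'a::t2_space \<Rightarrow> real"
  assumes "continuous_on A f" shows "continuous_on A (\<lambda>p. sine n (f p))"
  unfolding sine_def by (intro continuous_on_mult continuous_on_const continuous_on_sin assms)

lemma sine2_borel: "sine2 m n \<in> borel_measurable borel"
  unfolding sine2_eq[abs_def]
  by (intro borel_measurable_continuous_onI continuous_intros sine_continuous)

lemma sine2_L2: "sine2 m n \<in> L2 square_measure"
proof (rule finite_measure.L2_bounded[OF finite_measure_square])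
  show "sine2 m n \<in> borel_measurable square_measure" by (rule square_measurable[OF sine2_borel])
  have "cmod (sine2 m n p) \<le> sqrt 2 * sqrt 2" for p
  proof -
    have "\<bar>sine k x\<bar> \<le> sqrt 2" for k x
      by (simp add: sine_def abs_mult mult_left_le)
    then show ?thesis unfolding sine2_eq norm_of_real abs_mult by (intro mult_mono) auto
  qed
  then show "AE p in square_measure. cmod (sine2 m n p) \<le> sqrt 2 * sqrt 2" by simp
qed

interpretation square: orthonormal_system square_measure index_pairs sine_basis
proof
  fix i j :: "nat \<times> nat" assume "i \<in> index_pairs" "j \<in> index_pairs"
  then have pos: "fst i > 0" "snd i > 0" "fst j > 0" "snd j > 0" by (auto simp: index_pairs_def)
  show "(\<integral>x. sine_basis i x * cnj (sine_basis j x) \<partial>square_measure) = (if i = j then 1 else 0)"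
    using S_map_sine2[OF pos(1,2), of "fst j" "snd j"] pos by (auto simp: S_map_def prod_eq_iff)
qed (rule sine2_L2)

lemma square_coeff_basis:
  "i \<in> index_pairs \<Longrightarrow> j \<in> index_pairs \<Longrightarrow> square.coeff (sine_basis i) j = (if i = j then 1 else 0)"
  unfolding square.coeff_def by (rule square.orthonormal)

lemma square_coeff: "i \<in> index_pairs \<Longrightarrow> square.coeff g i = S_map g (fst i) (snd i)"
  by (auto simp: square.coeff_def S_map_def index_pairs_def)

text \<open>Multiplication by these functions preserves sine polynomials, and on the open square the
  two cosines determine the point, so the algebra generates the Borel sets there.\<close>

inductive_set cosine_polynomials :: "(real \<times> real \<Rightarrow> real) set" where
  const: "(\<lambda>_. c) \<in> cosine_polynomials"
| cos_fst: "(\<lambda>p. cos (pi * fst p)) \<in> cosine_polynomials"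
| cos_snd: "(\<lambda>p. cos (pi * snd p)) \<in> cosine_polynomials"
| add: "f \<in> cosine_polynomials \<Longrightarrow> g \<in> cosine_polynomials \<Longrightarrow> (\<lambda>p. f p + g p) \<in> cosine_polynomials"
| mult: "f \<in> cosine_polynomials \<Longrightarrow> g \<in> cosine_polynomials \<Longrightarrow> (\<lambda>p. f p * g p) \<in> cosine_polynomials"

lemma cosine_polynomial_borel: "f \<in> cosine_polynomials \<Longrightarrow> f \<in> borel_measurable borel"
  by (induction rule: cosine_polynomials.induct)
     (auto intro!: borel_measurable_add borel_measurable_times borel_measurable_continuous_onI continuous_intros)

lemma cosine_polynomial_bounded: "f \<in> cosine_polynomials \<Longrightarrow> \<exists>B. \<forall>p. \<bar>f p\<bar> \<le> B"
proof (induction rule: cosine_polynomials.induct)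
  case (add f g)
  then obtain A B where "\<And>p. \<bar>f p\<bar> \<le> A" "\<And>p. \<bar>g p\<bar> \<le> B" by auto
  then show ?case by (intro exI[of _ "A + B"]) (auto intro: order_trans[OF abs_triangle_ineq add_mono])
next
  case (mult f g)
  then obtain A B where AB: "\<And>p. \<bar>f p\<bar> \<le> A" "\<And>p. \<bar>g p\<bar> \<le> B" by auto
  have "A \<ge> 0" using AB(1)[of undefined] by simp
  then have "\<bar>f p * g p\<bar> \<le> A * B" for p
    unfolding abs_mult using AB by (intro mult_mono) auto
  then show ?case by blast
qed (use abs_cos_le_one in blast)+

lemma combinations_times_cosine:
  assumes "h \<in> combinations index_pairs sine_basis"
  shows "(\<lambda>p. complex_of_real (cos (pi * fst p)) * h p) \<in> combinations index_pairs sine_basis"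
    and "(\<lambda>p. complex_of_real (cos (pi * snd p)) * h p) \<in> combinations index_pairs sine_basis"
proof -
  obtain F c where F: "finite F" "F \<subseteq> index_pairs" "h = (\<lambda>x. \<Sum>i\<in>F. c i * sine_basis i x)"
    using assms by (auto simp: combinations_def)
  \<comment> \<open>Lowering the index 1 leads to the index 0, which lies outside
    \<open>index_pairs\<close>; the function there is zero, so the product formula holds without
    exception.\<close>
  have zero: "sine2 0 n = (\<lambda>_. 0)" "sine2 n 0 = (\<lambda>_. 0)" for n
    by (auto simp: sine2_eq sine_def fun_eq_iff)
  have base: "sine2 m n \<in> combinations index_pairs sine_basis" for m n
    using combinations_base[of "(m, n)" index_pairs sine_basis] combinations_zero[of index_pairs sine_basis] zero
    by (cases "m = 0 \<or> n = 0") (auto simp: index_pairs_def)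
  have cs: "cos (pi * x) * sine m x = (1/2) * (sine (m + 1) x + sine (m - 1) x)" if "m \<ge> 1" for m x
  proof -
    have "pi * real (m + 1) * x = pi * real m * x + pi * x" "pi * real (m - 1) * x = pi * real m * x - pi * x"
      using that by (simp_all add: algebra_simps of_nat_diff)
    then show ?thesis unfolding sine_def by (simp only: sin_add sin_diff) (simp add: algebra_simps)
  qed
  have 1: "(\<lambda>p. complex_of_real (cos (pi * fst p)) * sine_basis i p) = (\<lambda>p. (1/2) * (sine2 (fst i + 1) (snd i) p + sine2 (fst i - 1) (snd i) p))"
    if "i \<in> index_pairs" for i
  proof
    fix p
    have "complex_of_real (cos (pi * fst p) * sine (fst i) (fst p)) * of_real (sine (snd i) (snd p)) =
      of_real ((1/2) * (sine (fst i + 1) (fst p) + sine (fst i - 1) (fst p))) * of_real (sine (snd i) (snd p))"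
      using that by (subst cs) (auto simp: index_pairs_def)
    then show "complex_of_real (cos (pi * fst p)) * sine_basis i p = (1/2) * (sine2 (fst i + 1) (snd i) p + sine2 (fst i - 1) (snd i) p)"
      by (simp add: sine2_eq algebra_simps)
  qed
  have 2: "(\<lambda>p. complex_of_real (cos (pi * snd p)) * sine_basis i p) = (\<lambda>p. (1/2) * (sine2 (fst i) (snd i + 1) p + sine2 (fst i) (snd i - 1) p))"
    if "i \<in> index_pairs" for i
  proof
    fix p
    have "of_real (sine (fst i) (fst p)) * complex_of_real (cos (pi * snd p) * sine (snd i) (snd p)) =
      of_real (sine (fst i) (fst p)) * of_real ((1/2) * (sine (snd i + 1) (snd p) + sine (snd i - 1) (snd p)))"
      using that by (subst cs) (auto simp: index_pairs_def)
    then show "complex_of_real (cos (pi * snd p)) * sine_basis i p = (1/2) * (sine2 (fst i) (snd i + 1) p + sine2 (fst i) (snd i - 1) p)"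
      by (simp add: sine2_eq algebra_simps)
  qed
  have "(\<lambda>p. \<Sum>i\<in>F. c i * (complex_of_real (cos (pi * fst p)) * sine_basis i p)) \<in> combinations index_pairs sine_basis"
  proof (rule combinations_sum)
    fix i assume "i \<in> F"
    then have "i \<in> index_pairs" using F by auto
    note 1[OF this]
    moreover have "(\<lambda>p. (1/2) * (sine2 (fst i + 1) (snd i) p + sine2 (fst i - 1) (snd i) p)) \<in> combinations index_pairs sine_basis"
      by (intro combinations_scale combinations_add base)
    ultimately show "(\<lambda>p. c i * (complex_of_real (cos (pi * fst p)) * sine_basis i p)) \<in> combinations index_pairs sine_basis"
      by (intro combinations_scale) simp
  qed
  then show "(\<lambda>p. complex_of_real (cos (pi * fst p)) * h p) \<in> combinations index_pairs sine_basis"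
    by (simp add: F(3) sum_distrib_left mult_ac)
  have "(\<lambda>p. \<Sum>i\<in>F. c i * (complex_of_real (cos (pi * snd p)) * sine_basis i p)) \<in> combinations index_pairs sine_basis"
  proof (rule combinations_sum)
    fix i assume "i \<in> F"
    then have "i \<in> index_pairs" using F by auto
    note 2[OF this]
    moreover have "(\<lambda>p. (1/2) * (sine2 (fst i) (snd i + 1) p + sine2 (fst i) (snd i - 1) p)) \<in> combinations index_pairs sine_basis"
      by (intro combinations_scale combinations_add base)
    ultimately show "(\<lambda>p. c i * (complex_of_real (cos (pi * snd p)) * sine_basis i p)) \<in> combinations index_pairs sine_basis"
      by (intro combinations_scale) simp
  qed
  then show "(\<lambda>p. complex_of_real (cos (pi * snd p)) * h p) \<in> combinations index_pairs sine_basis"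
    by (simp add: F(3) sum_distrib_left mult_ac)
qed

lemma cosine_polynomial_times:
  assumes "g \<in> cosine_polynomials" "h \<in> combinations index_pairs sine_basis"
  shows "(\<lambda>p. complex_of_real (g p) * h p) \<in> combinations index_pairs sine_basis"
  using assms
proof (induction arbitrary: h rule: cosine_polynomials.induct)
  case (const c)
  then show ?case by (intro combinations_scale)
next
  case (add f g)
  then show ?case using combinations_add[OF add(3)[OF add(5)] add(4)[OF add(5)]] by (simp add: distrib_right)
next
  case (mult f g)
  then show ?case using mult(3)[OF mult(4)[OF mult(5)]] by (simp add: mult.assoc)
qed (rule combinations_times_cosine, assumption)+

text \<open>Every sine polynomial is \<open>sine2 1 1\<close> times a polynomial in the two cosines, so totality reduces
  to the density of these polynomials in \<open>L\<^sup>2\<close> of the measure weighted by \<open>(sine2 1 1)\<^sup>2\<close>.\<close>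

lemma sine_total:
  assumes \<phi>: "\<phi> \<in> L2 square_measure" and "\<epsilon> > 0"
  shows "\<exists>F c. finite F \<and> F \<subseteq> index_pairs \<and>
      (\<integral>x. (cmod (\<phi> x - (\<Sum>i\<in>F. c i * sine_basis i x)))\<^sup>2 \<partial>square_measure) < \<epsilon>"
proof -
  define w where "w = (\<lambda>p. sine 1 (fst p) * sine 1 (snd p))"
  have wb[measurable]: "w \<in> borel_measurable borel"
    unfolding w_def by (intro borel_measurable_continuous_onI continuous_intros sine_continuous)
  have wm[measurable]: "w \<in> borel_measurable square_measure" by (rule square_measurable[OF wb])
  have w_sine: "sine_basis (1, 1) = (\<lambda>p. of_real (w p))" by (auto simp: w_def sine2_eq fun_eq_iff)
  have wpos: "w p > 0" if "p \<in> unit_square" for p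
    using that by (cases p) (auto simp: w_def sine_def unit_square_def intro!: mult_pos_pos sin_gt_zero)
  \<comment> \<open>With this weight the mean square distance of \<open>\<phi> / w\<close> from
    \<open>G\<close> is that of \<open>\<phi>\<close> from \<open>G * w\<close>. Division by
    \<open>w\<close> is legitimate because \<open>w\<close> is positive on the open square.\<close>
  define \<mu> where "\<mu> = density square_measure (\<lambda>p. (w p)\<^sup>2)"
  have sp: "space \<mu> = unit_square" and st: "sets \<mu> = sets square_measure" by (simp_all add: \<mu>_def)
  have w2: "integrable square_measure (\<lambda>p. (w p)\<^sup>2)"
    using L2_integrable[OF sine2_L2[of 1 1]] w_sine by simp
  interpret generating_algebra \<mu> cosine_polynomials
  proof (intro generating_algebra.intro generating_algebra_axioms.intro finite_measureI)
    have "emeasure \<mu> (space \<mu>) = (\<integral>\<^sup>+p. ennreal ((w p)\<^sup>2) \<partial>square_measure)"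
      using sets.top[of square_measure] unfolding \<mu>_def
      by (subst emeasure_density) (auto intro!: nn_integral_cong)
    also have "\<dots> < \<infinity>" using w2 by (auto simp: integrable_iff_bounded)
    finally show "emeasure \<mu> (space \<mu>) \<noteq> \<infinity>" by simp
  next
    fix g assume g: "g \<in> cosine_polynomials"
    show "\<exists>B. \<forall>x\<in>space \<mu>. \<bar>g x\<bar> \<le> B" using cosine_polynomial_bounded[OF g] by blast
    show "g \<in> borel_measurable \<mu>"
      using square_measurable[OF cosine_polynomial_borel[OF g]] st by (simp cong: measurable_cong_sets)
  next
    fix N :: "(real \<times> real) measure"
    assume N: "space N = space \<mu>" "\<And>g. g \<in> cosine_polynomials \<Longrightarrow> g \<in> borel_measurable N"
    have c1[measurable]: "(\<lambda>p. cos (pi * fst p)) \<in> borel_measurable N" "(\<lambda>p. cos (pi * snd p)) \<in> borel_measurable N"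
      by (intro N cosine_polynomials.intros)+
    \<comment> \<open>Clamping makes the arccosine continuous on the whole line and changes nothing
      at values of the cosine, so both coordinates are measurable functions of the two
      generators.\<close>
    have ac: "(\<lambda>t. arccos (max (-1) (min 1 t)) / pi) \<in> borel_measurable borel"
    proof (rule borel_measurable_continuous_onI)
      have "continuous_on UNIV (\<lambda>t. arccos (max (-1) (min 1 t)))"
        by (rule continuous_on_arccos) (auto intro!: continuous_intros)
      then show "continuous_on UNIV (\<lambda>t. arccos (max (-1) (min 1 t)) / pi)"
        by (intro continuous_intros) auto
    qed
    have inv: "arccos (cos (pi * x)) / pi = x" if "0 < x" "x < 1" for x
      using that by (simp add: arccos_cos)
    have "fst \<in> borel_measurable N"
      using measurable_compose[OF c1(1) ac]
      by (subst measurable_cong[where g = "\<lambda>p. arccos (max (-1) (min 1 (cos (pi * fst p)))) / pi"])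
         (auto simp: N(1) sp unit_square_def inv)
    moreover have "snd \<in> borel_measurable N"
      using measurable_compose[OF c1(2) ac]
      by (subst measurable_cong[where g = "\<lambda>p. arccos (max (-1) (min 1 (cos (pi * snd p)))) / pi"])
         (auto simp: N(1) sp unit_square_def inv)
    ultimately have id: "(\<lambda>p. (fst p, snd p)) \<in> N \<rightarrow>\<^sub>M borel" by (rule borel_measurable_Pair)
    show "sets \<mu> \<subseteq> sets N"
    proof
      fix A assume "A \<in> sets \<mu>"
      then obtain B where B: "B \<in> sets borel" "A = unit_square \<inter> B"
        unfolding st square_measure_def by (auto simp: sets_restrict_space)
      have "(\<lambda>p. (fst p, snd p)) -` B \<inter> space N \<in> sets N" by (rule measurable_sets[OF id B(1)])
      also have "(\<lambda>p. (fst p, snd p)) -` B \<inter> space N = A" using B(2) N(1) sp by auto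
      finally show "A \<in> sets N" .
    qed
  qed (auto intro: cosine_polynomials.intros)
  note [measurable] = L2_measurable[OF \<phi>]
  have trans: "(\<integral>p. (cmod (\<phi> p / of_real (w p) - G p))\<^sup>2 \<partial>\<mu>) = (\<integral>p. (cmod (\<phi> p - G p * of_real (w p)))\<^sup>2 \<partial>square_measure)"
    if [measurable]: "G \<in> borel_measurable square_measure" for G
  proof -
    have "(\<integral>p. (cmod (\<phi> p / of_real (w p) - G p))\<^sup>2 \<partial>\<mu>) = (\<integral>p. (w p)\<^sup>2 *\<^sub>R (cmod (\<phi> p / of_real (w p) - G p))\<^sup>2 \<partial>square_measure)"
      unfolding \<mu>_def by (rule integral_density) auto
    also have "\<dots> = (\<integral>p. (cmod (\<phi> p - G p * of_real (w p)))\<^sup>2 \<partial>square_measure)"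
    proof (rule Bochner_Integration.integral_cong[OF refl])
      fix p assume "p \<in> space square_measure"
      then have "w p > 0" using wpos by simp
      then have "\<phi> p - G p * of_real (w p) = of_real (w p) * (\<phi> p / of_real (w p) - G p)"
        by (simp add: field_simps)
      then show "(w p)\<^sup>2 *\<^sub>R (cmod (\<phi> p / of_real (w p) - G p))\<^sup>2 = (cmod (\<phi> p - G p * of_real (w p)))\<^sup>2"
        by (simp add: norm_mult power_mult_distrib)
    qed
    finally show ?thesis .
  qed
  have "(\<lambda>p. \<phi> p / of_real (w p)) \<in> L2 \<mu>"
  proof -
    have "integrable \<mu> (\<lambda>p. (cmod (\<phi> p / of_real (w p)))\<^sup>2) \<longleftrightarrow>
        integrable square_measure (\<lambda>p. (w p)\<^sup>2 *\<^sub>R (cmod (\<phi> p / of_real (w p)))\<^sup>2)"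
      unfolding \<mu>_def by (rule integrable_density) auto
    also have "\<dots> \<longleftrightarrow> integrable square_measure (\<lambda>p. (cmod (\<phi> p))\<^sup>2)"
      by (intro Bochner_Integration.integrable_cong) (auto simp: norm_divide power_divide dest!: wpos)
    finally show ?thesis
      using L2_integrable[OF \<phi>] by (simp add: L2_def measurable_cong_sets[OF st refl])
  qed
  from dense_complex[OF this \<open>\<epsilon> > 0\<close>] obtain g1 g2 where g: "g1 \<in> cosine_polynomials" "g2 \<in> cosine_polynomials"
    "(\<integral>p. (cmod (\<phi> p / of_real (w p) - Complex (g1 p) (g2 p)))\<^sup>2 \<partial>\<mu>) < \<epsilon>"
    by blast
  have [measurable]: "g1 \<in> borel_measurable square_measure" "g2 \<in> borel_measurable square_measure"
    by (intro square_measurable cosine_polynomial_borel g)+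
  have Gm: "(\<lambda>p. Complex (g1 p) (g2 p)) \<in> borel_measurable square_measure"
    unfolding Complex_eq by measurable
  have "(\<lambda>p. of_real (g1 p) * sine_basis (1,1) p + \<i> * (of_real (g2 p) * sine_basis (1,1) p)) \<in> combinations index_pairs sine_basis"
    by (intro combinations_add combinations_scale cosine_polynomial_times g combinations_base) (simp_all add: index_pairs_def)
  also have "(\<lambda>p. of_real (g1 p) * sine_basis (1,1) p + \<i> * (of_real (g2 p) * sine_basis (1,1) p)) =
      (\<lambda>p. Complex (g1 p) (g2 p) * of_real (w p))"
    unfolding w_sine Complex_eq by (simp add: algebra_simps)
  finally obtain F c where F: "finite F" "F \<subseteq> index_pairs"
    "(\<lambda>p. Complex (g1 p) (g2 p) * of_real (w p)) = (\<lambda>p. \<Sum>i\<in>F. c i * sine_basis i p)"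
    by (auto simp: combinations_def)
  have "(\<integral>p. (cmod (\<phi> p - (\<Sum>i\<in>F. c i * sine_basis i p)))\<^sup>2 \<partial>square_measure) < \<epsilon>"
    using g(3) unfolding trans[OF Gm] fun_cong[OF F(3)] .
  with F show ?thesis by blast
qed

section \<open>Sine coefficients of dilations\<close>

lemma odd_periodic_sine2: "odd_periodic (sine2 m n)"
proof -
  have "sine k (x + 2) = sine k x" for k x
  proof -
    have "pi * real k * (x + 2) = pi * real k * x + 2 * real k * pi" by (simp add: algebra_simps)
    then show ?thesis unfolding sine_def by (simp only: sin_add cos_2npi sin_2npi) simp
  qed
  moreover have "sine k (- x) = - sine k x" for k x by (simp add: sine_def)
  ultimately show ?thesis by (simp add: odd_periodic_def sine2_eq)
qed

lemma odd_periodic_combination: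
  "(\<And>i. i \<in> F \<Longrightarrow> odd_periodic (f i)) \<Longrightarrow> odd_periodic (\<lambda>p. \<Sum>i\<in>F. c i * f i p)"
  by (simp add: odd_periodic_def sum_negf cong: sum.cong)

lemma odd_periodic_diff: "odd_periodic f \<Longrightarrow> odd_periodic g \<Longrightarrow> odd_periodic (\<lambda>p. f p - g p)"
  by (simp add: odd_periodic_def)

lemma dilation_sine: "dilation (sine_basis i) j = sine_basis (pair_times i j)"
  by (cases j) (auto simp: dilation_def sine2_def pair_times_def sine_def fun_eq_iff mult.assoc)

text \<open>For a sine polynomial dilation only multiplies indices, and both sides can be read off.
  The general case follows by approximation: dilation is isometric and coefficients are contractive,
  so each side moves by at most \<open>e\<close>.\<close>

lemma coeff_dilation:
  assumes odd: "odd_periodic \<phi>" and \<phi>: "\<phi> \<in> L2 square_measure"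
    and j: "j \<in> index_pairs" and k: "k \<in> index_pairs"
  shows "square.coeff (dilation \<phi> j) k = toeplitz (S_map \<phi>) k j"
proof -
  have le2: "cmod (square.coeff (dilation \<phi> j) k - toeplitz (S_map \<phi>) k j) \<le> 2 * e" if "e > 0" for e
  proof -
    obtain F c where F: "finite F" "F \<subseteq> index_pairs"
      and lt: "(\<integral>x. (cmod (\<phi> x - (\<Sum>i\<in>F. c i * sine_basis i x)))\<^sup>2 \<partial>square_measure) < e\<^sup>2"
      using sine_total[OF \<phi>, of "e\<^sup>2"] \<open>e > 0\<close> by auto
    define p where "p = (\<lambda>x. \<Sum>i\<in>F. c i * sine_basis i x)"
    define d where "d = (\<lambda>x. \<phi> x - p x)"
    have p: "p \<in> L2 square_measure" "odd_periodic p"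
      unfolding p_def by (auto intro!: L2_sum sine2_L2 odd_periodic_combination odd_periodic_sine2)
    have d: "d \<in> L2 square_measure" "odd_periodic d"
      unfolding d_def by (auto intro!: L2_diff odd_periodic_diff p odd \<phi>)
    have le: "cmod (square.coeff u q) \<le> e"
      if "u \<in> L2 square_measure" "(\<integral>x. (cmod (u x))\<^sup>2 \<partial>square_measure) < e\<^sup>2" "q \<in> index_pairs" for u q
    proof -
      have "(cmod (square.coeff u q))\<^sup>2 \<le> e\<^sup>2"
        using square.bessel[OF that(1), of "{q}"] that by simp
      then show ?thesis using \<open>e > 0\<close> by (simp add: power2_le_iff_abs_le)
    qed
    have cp: "square.coeff p q = (if q \<in> F then c q else 0)" if q: "q \<in> index_pairs" for q
    proof -
      have "square.coeff p q = (\<Sum>i\<in>F. c i * square.coeff (sine_basis i) q)"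
        unfolding p_def by (rule square.coeff_sum) (auto intro: sine2_L2 q)
      also have "\<dots> = (\<Sum>i\<in>F. if i = q then c i else 0)"
        using F q by (intro sum.cong refl) (auto simp: square_coeff_basis subsetD)
      finally show ?thesis using F(1) by simp
    qed
    have cd: "square.coeff (dilation p j) k = (\<Sum>i\<in>F. if pair_times i j = k then c i else 0)"
    proof -
      have "dilation p j = (\<lambda>x. \<Sum>i\<in>F. c i * sine_basis (pair_times i j) x)"
        unfolding dilation_sine[symmetric] by (simp add: p_def dilation_def case_prod_beta' fun_eq_iff)
      then have "square.coeff (dilation p j) k = (\<Sum>i\<in>F. c i * square.coeff (sine_basis (pair_times i j)) k)"
        by (simp only:) (rule square.coeff_sum, auto intro: sine2_L2 k)
      also have "\<dots> = (\<Sum>i\<in>F. if pair_times i j = k then c i else 0)"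
      proof (intro sum.cong refl)
        fix i assume "i \<in> F"
        then have "pair_times i j \<in> index_pairs" using F j by (auto simp: pair_times_def index_pairs_def)
        then show "c i * square.coeff (sine_basis (pair_times i j)) k = (if pair_times i j = k then c i else 0)"
          using k by (simp only: square_coeff_basis) auto
      qed
      finally show ?thesis .
    qed
    have dd: "dilation d j = (\<lambda>x. dilation \<phi> j x - dilation p j x)"
      by (simp add: d_def dilation_def case_prod_beta' fun_eq_iff)
    have A: "cmod (square.coeff (dilation \<phi> j) k - square.coeff (dilation p j) k) \<le> e"
    proof -
      have "square.coeff (dilation d j) k = square.coeff (dilation \<phi> j) k - square.coeff (dilation p j) k"
        unfolding dd by (rule square.coeff_diff) (intro dilation_isometry p odd \<phi> j k)+
      moreover have "cmod (square.coeff (dilation d j) k) \<le> e"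
        using lt dilation_isometry[OF d(2,1) j] by (intro le k) (auto simp: d_def p_def)
      ultimately show ?thesis by simp
    qed
    have B: "cmod (square.coeff (dilation p j) k - toeplitz (S_map \<phi>) k j) \<le> e"
    proof (cases "fst j dvd fst k \<and> snd j dvd snd k")
      case True
      define q where "q = (fst k div fst j, snd k div snd j)"
      have pos: "fst j > 0" "snd j > 0" "fst k > 0" "snd k > 0" using j k by (auto simp: index_pairs_def)
      have q: "q \<in> index_pairs" using True pos
        by (auto simp: q_def index_pairs_def Suc_le_eq dvd_imp_le div_greater_zero_iff)
      have "pair_times i j = k \<longleftrightarrow> i = q" for i
        using True pos by (auto simp: pair_times_def q_def prod_eq_iff)
      then have "square.coeff (dilation p j) k = square.coeff p q"
        unfolding cd cp[OF q] using F(1) by simp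
      moreover have "toeplitz (S_map \<phi>) k j = square.coeff \<phi> q"
        using True square_coeff[OF q, of \<phi>] by (simp add: toeplitz_def q_def)
      moreover have "cmod (square.coeff \<phi> q - square.coeff p q) \<le> e"
        using le[OF d(1) _ q] lt square.coeff_diff[OF \<phi> p(1) q] by (simp add: d_def p_def)
      ultimately show ?thesis by (simp add: norm_minus_commute)
    next
      case False
      then have "pair_times i j \<noteq> k" for i by (auto simp: pair_times_def)
      then show ?thesis using False \<open>e > 0\<close> by (auto simp: cd toeplitz_def)
    qed
    from norm_diff_triangle_le[OF A B] show ?thesis by simp
  qed
  have "cmod (square.coeff (dilation \<phi> j) k - toeplitz (S_map \<phi>) k j) \<le> 0"
  proof (rule field_le_epsilon)
    fix e :: real assume "e > 0"
    then show "cmod (square.coeff (dilation \<phi> j) k - toeplitz (S_map \<phi>) k j) \<le> 0 + e"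
      using le2[of "e / 2"] by simp
  qed
  then show ?thesis by simp
qed

text \<open>One half of the bridge to the torus: the norm of a combination of dilations depends on
  \<open>S_map \<phi>\<close> alone. The other half, \<open>torus_parseval\<close>, has the same
  series with \<open>bohr f\<close>.\<close>

lemma square_parseval:
  assumes odd: "odd_periodic \<phi>" and \<phi>: "\<phi> \<in> L2 square_measure" and F: "finite F" "F \<subseteq> index_pairs"
  shows "((\<lambda>k. (cmod (\<Sum>j\<in>F. b j * toeplitz (S_map \<phi>) k j))\<^sup>2) has_sum
    (L2_norm square_measure (\<lambda>p. \<Sum>j\<in>F. b j * dilation \<phi> j p))\<^sup>2) index_pairs"
proof -
  have d: "dilation \<phi> j \<in> L2 square_measure" if "j \<in> F" for j
    using that F by (intro dilation_isometry odd \<phi>) auto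
  define g where "g = (\<lambda>p. \<Sum>j\<in>F. b j * dilation \<phi> j p)"
  have g: "g \<in> L2 square_measure" unfolding g_def by (intro L2_sum d)
  have "square.coeff g k = (\<Sum>j\<in>F. b j * toeplitz (S_map \<phi>) k j)" if "k \<in> index_pairs" for k
  proof -
    have "square.coeff g k = (\<Sum>j\<in>F. b j * square.coeff (dilation \<phi> j) k)"
      unfolding g_def by (rule square.coeff_sum[OF d that])
    also have "\<dots> = (\<Sum>j\<in>F. b j * toeplitz (S_map \<phi>) k j)"
      using F that by (intro sum.cong refl) (auto simp: coeff_dilation[OF odd \<phi>])
    finally show ?thesis .
  qed
  with square.parseval[OF sine_total[OF g] g] show ?thesis
    unfolding g_def[symmetric] by (simp cong: has_sum_cong)
qed

section \<open>The infinite torus\<close>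

lemma circle_map_measurable:
  "(\<lambda>t. cis (2 * pi * t)) \<in> uniform_measure lborel {0..1::real} \<rightarrow>\<^sub>M restrict_space borel (sphere 0 1)"
proof (rule measurable_restrict_space2)
  have "(\<lambda>t. cis (2 * pi * t)) \<in> borel_measurable borel"
    by (intro borel_measurable_continuous_onI continuous_intros)
  then show "(\<lambda>t. cis (2 * pi * t)) \<in> borel_measurable (uniform_measure lborel {0..1::real})" by simp
qed simp

lemma prob_space_circle: "prob_space circle_measure"
  unfolding circle_measure_def
  by (intro prob_space.prob_space_distr prob_space_uniform_measure circle_map_measurable) auto

lemma sets_circle: "sets circle_measure = sets (restrict_space borel (sphere 0 1))"
  by (simp add: circle_measure_def)

lemma space_circle: "space circle_measure = sphere 0 1"
  by (simp add: circle_measure_def space_restrict_space)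

lemma circle_id_measurable [measurable]: "(\<lambda>z. z) \<in> borel_measurable circle_measure"
  by (simp add: measurable_cong_sets[OF sets_circle refl] measurable_restrict_space1)

lemma power_int_borel [measurable]: "(\<lambda>z::complex. z powi n) \<in> borel_measurable borel"
proof (cases "n \<ge> 0")
  case True
  then have "(\<lambda>z::complex. z powi n) = (\<lambda>z. z ^ nat n)" by (auto simp: power_int_def)
  then show ?thesis by simp
next
  case False
  then have "(\<lambda>z::complex. z powi n) = (\<lambda>z. inverse z ^ nat (- n))" by (auto simp: power_int_def)
  then show ?thesis by simp
qed

lemma circle_integral_power: "(\<integral>z. z powi n \<partial>circle_measure) = (if n = 0 then 1 else 0)"
proof (cases "n = 0")
  case True
  interpret prob_space circle_measure by (rule prob_space_circle)
  show ?thesis using True by (simp add: prob_space)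
next
  case False
  define c where "c = 2 * pi * real_of_int n"
  have c: "c \<noteq> 0" using False by (simp add: c_def)
  have m: "(\<lambda>t. cis (c * t)) \<in> borel_measurable borel"
    by (intro borel_measurable_continuous_onI continuous_intros)
  have "(\<integral>z. z powi n \<partial>circle_measure) = (\<integral>t. cis (2 * pi * t) powi n \<partial>uniform_measure lborel {0..1::real})"
    unfolding circle_measure_def
    by (rule integral_distr[OF circle_map_measurable]) (intro measurable_restrict_space1 power_int_borel)
  also have "\<dots> = (\<integral>t. cis (c * t) \<partial>density lborel (\<lambda>t. ennreal (indicator {0..1::real} t)))"
    by (simp add: cis_power_int c_def mult_ac uniform_measure_def ennreal_indicator divide_ennreal_def)
  also have "\<dots> = (\<integral>t. indicator {0..1::real} t *\<^sub>R cis (c * t) \<partial>lborel)"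
    using m by (intro integral_density) auto
  also have "\<dots> = integral {0..1} (\<lambda>t. cis (c * t))"
  proof -
    have "set_integrable lborel {0..1} (\<lambda>t. cis (c * t))"
      by (rule borel_integrable_atLeastAtMost') (intro continuous_intros)
    from set_borel_integral_eq_integral(2)[OF this] show ?thesis by (simp add: set_lebesgue_integral_def)
  qed
  also have "\<dots> = 0"
  proof (rule integral_unique)
    have "((\<lambda>t. cis (c * t)) has_integral (cis (c * 1) / (\<i> * of_real c) - cis (c * 0) / (\<i> * of_real c))) {0..1}"
    proof (rule fundamental_theorem_of_calculus)
      fix t :: real
      have "((\<lambda>t. exp (\<i> * of_real c * of_real t) / (\<i> * of_real c)) has_vector_derivative exp (\<i> * of_real c * of_real t)) (at t within {0..1})"
      proof (rule has_vector_derivative_real_field)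
        show "((\<lambda>z. exp (\<i> * of_real c * z) / (\<i> * of_real c)) has_field_derivative exp (\<i> * of_real c * of_real t)) (at (of_real t))"
          using c by (auto intro!: derivative_eq_intros)
      qed
      then show "((\<lambda>t. cis (c * t) / (\<i> * of_real c)) has_vector_derivative cis (c * t)) (at t within {0..1})"
        by (simp add: cis_conv_exp mult_ac)
    qed simp
    moreover have "cis (c * 1) = 1"
      unfolding c_def using cis_multiple_2pi[of "of_int n"] by (simp add: mult_ac)
    ultimately show "((\<lambda>t. cis (c * t)) has_integral 0) {0..1}" by simp
  qed
  finally show ?thesis using False by simp
qed

interpretation torus: product_prob_space "\<lambda>_. circle_measure" "UNIV :: nat set"
  by (intro product_prob_spaceI prob_space_circle)

section \<open>The product measure and monomials of one torus variable\<close>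

lemma prob_space_torus: "prob_space torus_measure"
  unfolding torus_measure_def by (rule prob_space_PiM[OF prob_space_circle])

lemma space_torus: "space torus_measure = {w. \<forall>i. cmod (w i) = 1}"
  by (auto simp: torus_measure_def space_PiM space_circle PiE_def Pi_def)

lemma prob_space_torus2: "prob_space torus2_measure"
proof -
  interpret pair_prob_space torus_measure torus_measure
    by (intro pair_prob_space.intro pair_sigma_finite.intro prob_space_torus prob_space_imp_sigma_finite)
  show ?thesis unfolding torus2_measure_def by (rule prob_space_axioms)
qed

lemma space_torus2: "space torus2_measure = {z. (\<forall>i. cmod (fst z i) = 1) \<and> (\<forall>i. cmod (snd z i) = 1)}"
  by (auto simp: torus2_measure_def space_pair_measure space_torus)

lemma circle_product_coordinate:
  assumes "i \<in> J" shows "(\<lambda>w. w i) \<in> borel_measurable (PiM J (\<lambda>_. circle_measure))"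
proof -
  have "(\<lambda>w. w i) \<in> PiM J (\<lambda>_. circle_measure) \<rightarrow>\<^sub>M circle_measure"
    using assms by (rule measurable_component_singleton)
  from measurable_compose[OF this circle_id_measurable] show ?thesis .
qed

lemma torus_coordinate [measurable]: "(\<lambda>w. w i) \<in> borel_measurable torus_measure"
  unfolding torus_measure_def by (rule circle_product_coordinate) simp

lemma torus_monomial_measurable [measurable]: "torus_monomial \<alpha> \<in> borel_measurable torus_measure"
  unfolding torus_monomial_def by measurable

lemma torus_monomial_superset:
  assumes "finite J" "{i. \<alpha> i \<noteq> 0} \<subseteq> J"
  shows "torus_monomial \<alpha> w = (\<Prod>i\<in>J. w i powi \<alpha> i)"
  unfolding torus_monomial_def using assms by (intro prod.mono_neutral_left) auto

lemma norm_torus_monomial: "w \<in> space torus_measure \<Longrightarrow> cmod (torus_monomial \<alpha> w) = 1"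
  by (simp add: torus_monomial_def space_torus prod_norm[symmetric] norm_power_int)

lemma torus_monomial_add:
  assumes w: "w \<in> space torus_measure" and fin: "finite {i. \<alpha> i \<noteq> 0}" "finite {i. \<beta> i \<noteq> 0}"
  shows "torus_monomial (\<lambda>i. \<alpha> i + \<beta> i) w = torus_monomial \<alpha> w * torus_monomial \<beta> w"
proof -
  let ?J = "{i. \<alpha> i \<noteq> 0} \<union> {i. \<beta> i \<noteq> 0}"
  have w0: "w i \<noteq> 0" for i using w by (auto simp: space_torus dest: spec[of _ i])
  have "torus_monomial (\<lambda>i. \<alpha> i + \<beta> i) w = (\<Prod>i\<in>?J. w i powi (\<alpha> i + \<beta> i))"
    using fin by (intro torus_monomial_superset) auto
  also have "\<dots> = (\<Prod>i\<in>?J. w i powi \<alpha> i) * (\<Prod>i\<in>?J. w i powi \<beta> i)"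
    by (simp add: power_int_add w0 prod.distrib)
  also have "(\<Prod>i\<in>?J. w i powi \<alpha> i) = torus_monomial \<alpha> w"
    using fin by (intro torus_monomial_superset[symmetric]) auto
  also have "(\<Prod>i\<in>?J. w i powi \<beta> i) = torus_monomial \<beta> w"
    using fin by (intro torus_monomial_superset[symmetric]) auto
  finally show ?thesis .
qed

lemma torus_monomial_cnj:
  assumes "w \<in> space torus_measure"
  shows "torus_monomial (\<lambda>i. - \<alpha> i) w = cnj (torus_monomial \<alpha> w)"
proof -
  have "w i powi (- \<alpha> i) = cnj (w i powi \<alpha> i)" for i
  proof -
    have "cmod (w i powi \<alpha> i) = 1" using assms by (simp add: space_torus norm_power_int)
    then show ?thesis using divide_conv_cnj[of "w i powi \<alpha> i" 1] by (simp add: power_int_minus inverse_eq_divide)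
  qed
  then show ?thesis by (simp add: torus_monomial_def)
qed

text \<open>A monomial depends on finitely many coordinates, so the integral over the infinite
  product reduces to a finite product of circle integrals.\<close>

lemma torus_monomial_integral:
  assumes fin: "finite {i. \<alpha> i \<noteq> 0}"
  shows "(\<integral>w. torus_monomial \<alpha> w \<partial>torus_measure) = (if \<alpha> = (\<lambda>_. 0) then 1 else 0)"
proof -
  let ?J = "{i. \<alpha> i \<noteq> 0}"
  let ?P = "PiM ?J (\<lambda>_. circle_measure)"
  have int: "integrable circle_measure (\<lambda>z. z powi n)" for n
    by (rule finite_measure.integrable_const_bound[OF prob_space.finite_measure[OF prob_space_circle], of _ 1]) (auto intro!: AE_I2 simp: space_circle norm_power_int)
  have "(\<integral>w. torus_monomial \<alpha> w \<partial>torus_measure) = (\<integral>w. (\<Prod>i\<in>?J. restrict w ?J i powi \<alpha> i) \<partial>torus_measure)"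
    unfolding torus_monomial_def by (intro Bochner_Integration.integral_cong prod.cong refl) simp
  also have "\<dots> = (\<integral>w. (\<Prod>i\<in>?J. w i powi \<alpha> i) \<partial>distr torus_measure ?P (\<lambda>w. restrict w ?J))"
    unfolding torus_measure_def
    by (subst integral_distr) (auto intro!: measurable_restrict_subset borel_measurable_prod
      measurable_compose[OF circle_product_coordinate power_int_borel])
  also have "distr torus_measure ?P (\<lambda>w. restrict w ?J) = ?P"
    unfolding torus_measure_def by (rule torus.distr_PiM_restrict_finite[OF fin]) simp
  also have "(\<integral>w. (\<Prod>i\<in>?J. w i powi \<alpha> i) \<partial>?P) = (\<Prod>i\<in>?J. \<integral>z. z powi \<alpha> i \<partial>circle_measure)"
    using fin int by (rule torus.product_integral_prod)
  also have "\<dots> = (\<Prod>i\<in>?J. if \<alpha> i = 0 then 1 else 0)" by (simp only: circle_integral_power)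
  also have "\<dots> = (if \<alpha> = (\<lambda>_. 0) then 1 else 0)"
    using fin by (auto simp: fun_eq_iff card_gt_0_iff)
  finally show ?thesis .
qed

section \<open>Monomials of both torus variables\<close>

type_synonym exponents = "(nat \<Rightarrow> int) \<times> (nat \<Rightarrow> int)"

text \<open>For infinitely many nonzero exponents the product in \<open>torus_monomial\<close> is 1
  by convention, so distinct exponents would give equal functions; orthonormality is claimed on this
  set.\<close>

definition finite_exponents :: "exponents set" where
  "finite_exponents = {i. finite {k. fst i k \<noteq> 0} \<and> finite {k. snd i k \<noteq> 0}}"

definition exponents_add :: "exponents \<Rightarrow> exponents \<Rightarrow> exponents" where
  "exponents_add i j = ((\<lambda>k. fst i k + fst j k), (\<lambda>k. snd i k + snd j k))"

definition exponents_neg :: "exponents \<Rightarrow> exponents" where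
  "exponents_neg i = ((\<lambda>k. - fst i k), (\<lambda>k. - snd i k))"

definition monomial2 :: "exponents \<Rightarrow> (nat \<Rightarrow> complex) \<times> (nat \<Rightarrow> complex) \<Rightarrow> complex" where
  "monomial2 i z = torus_monomial (fst i) (fst z) * torus_monomial (snd i) (snd z)"

lemma finite_exponents_add: "i \<in> finite_exponents \<Longrightarrow> j \<in> finite_exponents \<Longrightarrow> exponents_add i j \<in> finite_exponents"
  unfolding finite_exponents_def exponents_add_def
  by (auto intro: finite_subset[of _ "{k. fst i k \<noteq> 0} \<union> {k. fst j k \<noteq> 0}"]
      finite_subset[of _ "{k. snd i k \<noteq> 0} \<union> {k. snd j k \<noteq> 0}"])

lemma finite_exponents_neg: "i \<in> finite_exponents \<Longrightarrow> exponents_neg i \<in> finite_exponents"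
  by (simp add: finite_exponents_def exponents_neg_def)

lemma space_torus2_components:
  "z \<in> space torus2_measure \<Longrightarrow> fst z \<in> space torus_measure \<and> snd z \<in> space torus_measure"
  by (simp add: space_torus space_torus2)

lemma monomial2_measurable [measurable]: "monomial2 i \<in> borel_measurable torus2_measure"
  unfolding monomial2_def[abs_def] torus2_measure_def by measurable

lemma norm_monomial2: "z \<in> space torus2_measure \<Longrightarrow> cmod (monomial2 i z) = 1"
  using space_torus2_components[of z] by (simp add: monomial2_def norm_mult norm_torus_monomial)

lemma monomial2_add:
  assumes "z \<in> space torus2_measure" "i \<in> finite_exponents" "j \<in> finite_exponents"
  shows "monomial2 (exponents_add i j) z = monomial2 i z * monomial2 j z"
  using assms space_torus2_components[of z]
  by (simp add: monomial2_def exponents_add_def finite_exponents_def torus_monomial_add)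

lemma monomial2_neg:
  assumes "z \<in> space torus2_measure"
  shows "monomial2 (exponents_neg i) z = cnj (monomial2 i z)"
  using space_torus2_components[OF assms] by (simp add: monomial2_def exponents_neg_def torus_monomial_cnj)

lemma monomial2_integral:
  assumes "i \<in> finite_exponents"
  shows "(\<integral>z. monomial2 i z \<partial>torus2_measure) = (if i = ((\<lambda>_. 0), (\<lambda>_. 0)) then 1 else 0)"
proof -
  interpret pair_prob_space torus_measure torus_measure
    by (intro pair_prob_space.intro pair_sigma_finite.intro prob_space_torus prob_space_imp_sigma_finite)
  interpret p: prob_space torus2_measure by (rule prob_space_torus2)
  have int: "integrable torus2_measure (monomial2 i)"
    by (rule p.integrable_const_bound[of _ 1]) (auto intro!: AE_I2 simp: norm_monomial2)
  have "(\<integral>z. monomial2 i z \<partial>torus2_measure) =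
      (\<integral>x. (\<integral>y. monomial2 i (x, y) \<partial>torus_measure) \<partial>torus_measure)"
    unfolding torus2_measure_def by (rule integral_fst'[OF int[unfolded torus2_measure_def], symmetric])
  also have "\<dots> = (\<integral>x. (\<integral>y. torus_monomial (fst i) x * torus_monomial (snd i) y \<partial>torus_measure) \<partial>torus_measure)"
    by (simp add: monomial2_def)
  also have "\<dots> = (\<integral>x. torus_monomial (fst i) x \<partial>torus_measure) * (\<integral>y. torus_monomial (snd i) y \<partial>torus_measure)"
    by simp
  also have "\<dots> = (if i = ((\<lambda>_. 0), (\<lambda>_. 0)) then 1 else 0)"
    using assms by (auto simp: finite_exponents_def torus_monomial_integral prod_eq_iff)
  finally show ?thesis .
qed

lemma monomial2_L2: "monomial2 i \<in> L2 torus2_measure"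
proof -
  interpret p: prob_space torus2_measure by (rule prob_space_torus2)
  show ?thesis by (rule p.L2_bounded[of _ 1]) (auto intro!: AE_I2 simp: norm_monomial2)
qed

interpretation torus2: orthonormal_system torus2_measure finite_exponents monomial2
proof
  fix i j :: exponents assume ij: "i \<in> finite_exponents" "j \<in> finite_exponents"
  have "(\<integral>z. monomial2 i z * cnj (monomial2 j z) \<partial>torus2_measure) =
      (\<integral>z. monomial2 (exponents_add i (exponents_neg j)) z \<partial>torus2_measure)"
    by (rule Bochner_Integration.integral_cong)
       (simp_all add: monomial2_add monomial2_neg finite_exponents_neg ij)
  also have "\<dots> = (if i = j then 1 else 0)"
    unfolding monomial2_integral[OF finite_exponents_add[OF ij(1) finite_exponents_neg[OF ij(2)]]]
    by (auto simp: exponents_add_def exponents_neg_def fun_eq_iff prod_eq_iff)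
  finally show "(\<integral>z. monomial2 i z * cnj (monomial2 j z) \<partial>torus2_measure) = (if i = j then 1 else 0)" .
qed (rule monomial2_L2)

lemma torus2_coeff: "torus2.coeff g i = fourier_coeff g (fst i) (snd i)"
  unfolding torus2.coeff_def fourier_coeff_def
proof (rule Bochner_Integration.integral_cong[OF refl])
  fix z assume "z \<in> space torus2_measure"
  from monomial2_neg[OF this, of i, symmetric]
  show "g z * cnj (monomial2 i z) = (case z of (w, u) \<Rightarrow>
      g (w, u) * torus_monomial (\<lambda>k. - fst i k) w * torus_monomial (\<lambda>k. - snd i k) u)"
    by (simp only:) (simp add: monomial2_def exponents_neg_def case_prod_beta' mult.assoc)
qed

text \<open>Equality is demanded on the torus alone: closure under products and real parts rests on
  coordinates of modulus 1.\<close>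

definition trig_polynomial :: "((nat \<Rightarrow> complex) \<times> (nat \<Rightarrow> complex) \<Rightarrow> complex) \<Rightarrow> bool" where
  "trig_polynomial g \<longleftrightarrow>
     (\<exists>p\<in>combinations finite_exponents monomial2. \<forall>z\<in>space torus2_measure. g z = p z)"

lemma trig_polynomial_add: "trig_polynomial f \<Longrightarrow> trig_polynomial g \<Longrightarrow> trig_polynomial (\<lambda>z. f z + g z)"
proof -
  assume "trig_polynomial f" "trig_polynomial g"
  then obtain p q where p: "p \<in> combinations finite_exponents monomial2" "\<forall>z\<in>space torus2_measure. f z = p z"
    and q: "q \<in> combinations finite_exponents monomial2" "\<forall>z\<in>space torus2_measure. g z = q z"
    unfolding trig_polynomial_def by (elim bexE)
  then show ?thesis
    unfolding trig_polynomial_def by (intro bexI[OF _ combinations_add[OF p(1) q(1)]]) simp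
qed

lemma trig_polynomial_scale: "trig_polynomial f \<Longrightarrow> trig_polynomial (\<lambda>z. c * f z)"
proof -
  assume "trig_polynomial f"
  then obtain p where p: "p \<in> combinations finite_exponents monomial2" "\<forall>z\<in>space torus2_measure. f z = p z"
    unfolding trig_polynomial_def by (elim bexE)
  then show ?thesis
    unfolding trig_polynomial_def by (intro bexI[OF _ combinations_scale[OF p(1), of c]]) simp
qed

lemma trig_polynomial_mult:
  assumes "trig_polynomial f" "trig_polynomial g" shows "trig_polynomial (\<lambda>z. f z * g z)"
proof -
  obtain F c where F: "finite F" "F \<subseteq> finite_exponents" "\<And>z. z \<in> space torus2_measure \<Longrightarrow> f z = (\<Sum>i\<in>F. c i * monomial2 i z)"
    using assms(1) by (auto simp: trig_polynomial_def combinations_def)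
  obtain G d where G: "finite G" "G \<subseteq> finite_exponents" "\<And>z. z \<in> space torus2_measure \<Longrightarrow> g z = (\<Sum>i\<in>G. d i * monomial2 i z)"
    using assms(2) by (auto simp: trig_polynomial_def combinations_def)
  have "(\<lambda>z. \<Sum>i\<in>F. \<Sum>j\<in>G. (c i * d j) * monomial2 (exponents_add i j) z) \<in> combinations finite_exponents monomial2"
    using F G by (intro combinations_sum combinations_scale combinations_base finite_exponents_add) auto
  moreover have "f z * g z = (\<Sum>i\<in>F. \<Sum>j\<in>G. (c i * d j) * monomial2 (exponents_add i j) z)"
    if z: "z \<in> space torus2_measure" for z
    unfolding F(3)[OF z] G(3)[OF z] sum_product
    using F(2) G(2) by (intro sum.cong refl) (auto simp: monomial2_add[OF z] subsetD)
  ultimately show ?thesis unfolding trig_polynomial_def by (intro bexI) auto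
qed

lemma trig_polynomial_monomial: "i \<in> finite_exponents \<Longrightarrow> trig_polynomial (monomial2 i)"
  unfolding trig_polynomial_def by (rule bexI[OF _ combinations_base]) auto

lemma trig_polynomial_cong:
  "trig_polynomial f \<Longrightarrow> (\<And>z. z \<in> space torus2_measure \<Longrightarrow> g z = f z) \<Longrightarrow> trig_polynomial g"
  unfolding trig_polynomial_def by simp

lemma trig_polynomial_const: "trig_polynomial (\<lambda>_. c)"
proof (rule trig_polynomial_cong)
  show "trig_polynomial (\<lambda>z. c * monomial2 ((\<lambda>_. 0), (\<lambda>_. 0)) z)"
    by (intro trig_polynomial_scale trig_polynomial_monomial) (simp add: finite_exponents_def)
qed (simp add: monomial2_def torus_monomial_def)

lemma trig_polynomial_Re_Im:
  assumes i: "i \<in> finite_exponents"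
  shows "trig_polynomial (\<lambda>z. of_real (Re (monomial2 i z)))" "trig_polynomial (\<lambda>z. of_real (Im (monomial2 i z)))"
proof -
  note m = trig_polynomial_monomial[OF i] trig_polynomial_monomial[OF finite_exponents_neg[OF i]]
  show "trig_polynomial (\<lambda>z. of_real (Re (monomial2 i z)))"
    by (rule trig_polynomial_cong[OF trig_polynomial_scale[OF trig_polynomial_add[OF m], of "1/2"]])
       (simp add: monomial2_neg complex_eq_iff)
  show "trig_polynomial (\<lambda>z. of_real (Im (monomial2 i z)))"
    by (rule trig_polynomial_cong[OF trig_polynomial_scale[OF trig_polynomial_add[OF m(1) trig_polynomial_scale[OF m(2), of "-1"]], of "- \<i> / 2"]])
       (simp add: monomial2_neg complex_eq_iff)
qed

definition unit_exponents :: "nat \<Rightarrow> nat \<Rightarrow> int" where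
  "unit_exponents k = (\<lambda>j. if j = k then 1 else 0)"

lemma torus_monomial_unit: "torus_monomial (unit_exponents k) w = w k"
proof -
  have "{i. unit_exponents k i \<noteq> 0} = {k}" by (auto simp: unit_exponents_def)
  then show ?thesis by (simp add: torus_monomial_def unit_exponents_def)
qed

lemma monomial2_unit:
  "monomial2 (unit_exponents k, (\<lambda>_. 0)) z = fst z k" "monomial2 ((\<lambda>_. 0), unit_exponents k) z = snd z k"
  by (simp_all add: monomial2_def torus_monomial_unit) (simp_all add: torus_monomial_def)

lemma unit_finite_exponents:
  "(unit_exponents k, (\<lambda>_. 0)) \<in> finite_exponents" "((\<lambda>_. 0), unit_exponents k) \<in> finite_exponents"
  by (simp_all add: finite_exponents_def unit_exponents_def)

text \<open>The real form of the trigonometric polynomials, as \<open>generating_algebra\<close> is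
  stated for real algebras. It contains the real and imaginary parts of all coordinates, hence
  generates the product \<sigma>-algebra.\<close>

inductive_set real_trig_polynomials :: "((nat \<Rightarrow> complex) \<times> (nat \<Rightarrow> complex) \<Rightarrow> real) set" where
  const: "(\<lambda>_. c) \<in> real_trig_polynomials"
| Re: "i \<in> finite_exponents \<Longrightarrow> (\<lambda>z. Re (monomial2 i z)) \<in> real_trig_polynomials"
| Im: "i \<in> finite_exponents \<Longrightarrow> (\<lambda>z. Im (monomial2 i z)) \<in> real_trig_polynomials"
| add: "f \<in> real_trig_polynomials \<Longrightarrow> g \<in> real_trig_polynomials \<Longrightarrow> (\<lambda>z. f z + g z) \<in> real_trig_polynomials"
| mult: "f \<in> real_trig_polynomials \<Longrightarrow> g \<in> real_trig_polynomials \<Longrightarrow> (\<lambda>z. f z * g z) \<in> real_trig_polynomials"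

lemma real_trig_polynomial:
  "g \<in> real_trig_polynomials \<Longrightarrow> trig_polynomial (\<lambda>z. complex_of_real (g z))"
  by (induction rule: real_trig_polynomials.induct)
     (auto intro: trig_polynomial_const trig_polynomial_Re_Im trig_polynomial_add trig_polynomial_mult)

lemma real_trig_polynomial_measurable:
  "g \<in> real_trig_polynomials \<Longrightarrow> g \<in> borel_measurable torus2_measure"
  by (induction rule: real_trig_polynomials.induct) auto

lemma real_trig_polynomial_bounded:
  "g \<in> real_trig_polynomials \<Longrightarrow> \<exists>B. \<forall>z\<in>space torus2_measure. \<bar>g z\<bar> \<le> B"
proof (induction rule: real_trig_polynomials.induct)
  case (add f g)
  then obtain A B where "\<And>z. z \<in> space torus2_measure \<Longrightarrow> \<bar>f z\<bar> \<le> A" "\<And>z. z \<in> space torus2_measure \<Longrightarrow> \<bar>g z\<bar> \<le> B" by auto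
  then show ?case by (intro exI[of _ "A + B"]) (auto intro: order_trans[OF abs_triangle_ineq add_mono])
next
  case (mult f g)
  then obtain A B where AB: "\<And>z. z \<in> space torus2_measure \<Longrightarrow> \<bar>f z\<bar> \<le> A" "\<And>z. z \<in> space torus2_measure \<Longrightarrow> \<bar>g z\<bar> \<le> B" by auto
  have "\<bar>f z * g z\<bar> \<le> A * B" if "z \<in> space torus2_measure" for z
    unfolding abs_mult using AB[OF that] by (intro mult_mono) auto
  then show ?case by blast
next
  case (Re i)
  then show ?case using norm_monomial2[of _ i] abs_Re_le_cmod by (intro exI[of _ 1]) (metis)
next
  case (Im i)
  then show ?case using norm_monomial2[of _ i] abs_Im_le_cmod by (intro exI[of _ 1]) (metis)
next
  case (const c)
  then show ?case by (intro exI[of _ "\<bar>c\<bar>"]) simp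
qed

text \<open>The density \<rho> gives approximation that survives multiplication by a function which
  is merely square integrable. The case \<rho> = 1 is the totality of the monomials.\<close>

lemma torus2_dense:
  assumes \<rho>: "integrable torus2_measure \<rho>" "\<And>z. \<rho> z \<ge> 0"
    and h[measurable]: "h \<in> borel_measurable torus2_measure"
    and hint: "integrable torus2_measure (\<lambda>z. \<rho> z * (cmod (h z))\<^sup>2)" and "\<epsilon> > 0"
  shows "\<exists>F c. finite F \<and> F \<subseteq> finite_exponents \<and>
    (\<integral>z. \<rho> z * (cmod (h z - (\<Sum>i\<in>F. c i * monomial2 i z)))\<^sup>2 \<partial>torus2_measure) < \<epsilon>"
proof -
  have [measurable]: "\<rho> \<in> borel_measurable torus2_measure" using \<rho>(1) by (rule borel_measurable_integrable)
  define \<mu> where "\<mu> = density torus2_measure \<rho>"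
  have sp: "space \<mu> = space torus2_measure" and st: "sets \<mu> = sets torus2_measure" by (simp_all add: \<mu>_def)
  interpret generating_algebra \<mu> real_trig_polynomials
  proof (intro generating_algebra.intro generating_algebra_axioms.intro finite_measureI)
    have "emeasure \<mu> (space \<mu>) = (\<integral>\<^sup>+z. ennreal (\<rho> z) \<partial>torus2_measure)"
      using sets.top[of torus2_measure] unfolding \<mu>_def
      by (subst emeasure_density) (auto intro!: nn_integral_cong)
    also have "\<dots> < \<infinity>" using \<rho> by (auto simp: integrable_iff_bounded)
    finally show "emeasure \<mu> (space \<mu>) \<noteq> \<infinity>" by simp
  next
    fix g assume g: "g \<in> real_trig_polynomials"
    show "\<exists>B. \<forall>x\<in>space \<mu>. \<bar>g x\<bar> \<le> B" using real_trig_polynomial_bounded[OF g] sp by simp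
    show "g \<in> borel_measurable \<mu>"
      using real_trig_polynomial_measurable[OF g] st by (simp cong: measurable_cong_sets)
  next
    fix N :: "((nat \<Rightarrow> complex) \<times> (nat \<Rightarrow> complex)) measure"
    assume N: "space N = space \<mu>" "\<And>g. g \<in> real_trig_polynomials \<Longrightarrow> g \<in> borel_measurable N"
    have m: "monomial2 i \<in> borel_measurable N" if "i \<in> finite_exponents" for i
      by (subst borel_measurable_complex_iff) (use N(2) that real_trig_polynomials.intros in blast)
    \<comment> \<open>The coordinates are monomials with unit exponents. Their measurability for
      \<open>N\<close> makes the identity a measurable map from \<open>N\<close> to the product
      space, which is the required inclusion.\<close>
    have f: "(\<lambda>z. fst z k) \<in> N \<rightarrow>\<^sub>M circle_measure" "(\<lambda>z. snd z k) \<in> N \<rightarrow>\<^sub>M circle_measure" for k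
      unfolding measurable_cong_sets[OF refl sets_circle]
      using m[OF unit_finite_exponents(1)[of k]] m[OF unit_finite_exponents(2)[of k]]
      by (auto intro!: measurable_restrict_space2 simp: monomial2_unit[abs_def] N(1) sp space_torus2)
    have "(\<lambda>z. (fst z, snd z)) \<in> N \<rightarrow>\<^sub>M torus2_measure"
      unfolding torus2_measure_def torus_measure_def
    proof (rule measurable_Pair)
      show "fst \<in> N \<rightarrow>\<^sub>M PiM UNIV (\<lambda>_. circle_measure)"
      proof -
        have "(\<lambda>z k. fst z k) \<in> space N \<rightarrow> (\<Pi>\<^sub>E k\<in>UNIV. space circle_measure)"
          by (auto simp: space_circle N(1) sp space_torus2)
        from measurable_PiM_single'[OF f(1) this] show ?thesis by simp
      qed
      show "snd \<in> N \<rightarrow>\<^sub>M PiM UNIV (\<lambda>_. circle_measure)"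
      proof -
        have "(\<lambda>z k. snd z k) \<in> space N \<rightarrow> (\<Pi>\<^sub>E k\<in>UNIV. space circle_measure)"
          by (auto simp: space_circle N(1) sp space_torus2)
        from measurable_PiM_single'[OF f(2) this] show ?thesis by simp
      qed
    qed
    then have id: "(\<lambda>z. z) \<in> N \<rightarrow>\<^sub>M torus2_measure" by simp
    show "sets \<mu> \<subseteq> sets N"
    proof
      fix A assume A: "A \<in> sets \<mu>"
      then have "(\<lambda>z. z) -` A \<inter> space N \<in> sets N" using measurable_sets[OF id] st by simp
      also have "(\<lambda>z. z) -` A \<inter> space N = A" using sets.sets_into_space[OF A] N(1) by auto
      finally show "A \<in> sets N" .
    qed
  qed (rule real_trig_polynomials.const real_trig_polynomials.add real_trig_polynomials.mult; assumption)+
  have "h \<in> L2 \<mu>"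
  proof -
    have "integrable \<mu> (\<lambda>z. (cmod (h z))\<^sup>2) \<longleftrightarrow> integrable torus2_measure (\<lambda>z. \<rho> z *\<^sub>R (cmod (h z))\<^sup>2)"
      unfolding \<mu>_def by (rule integrable_density) (auto simp: \<rho>(2))
    then show ?thesis using hint h by (simp add: L2_def measurable_cong_sets[OF st refl])
  qed
  from dense_complex[OF this \<open>\<epsilon> > 0\<close>] obtain g1 g2 where g: "g1 \<in> real_trig_polynomials" "g2 \<in> real_trig_polynomials"
    "(\<integral>z. (cmod (h z - Complex (g1 z) (g2 z)))\<^sup>2 \<partial>\<mu>) < \<epsilon>"
    by blast
  have "trig_polynomial (\<lambda>z. of_real (g1 z) + \<i> * of_real (g2 z))"
    by (intro trig_polynomial_add trig_polynomial_scale real_trig_polynomial g)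
  then obtain F c where F: "finite F" "F \<subseteq> finite_exponents"
    "\<And>z. z \<in> space torus2_measure \<Longrightarrow> Complex (g1 z) (g2 z) = (\<Sum>i\<in>F. c i * monomial2 i z)"
    by (auto simp: trig_polynomial_def combinations_def Complex_eq)
  have [measurable]: "(\<lambda>z. Complex (g1 z) (g2 z)) \<in> borel_measurable torus2_measure"
    using real_trig_polynomial_measurable[OF g(1)] real_trig_polynomial_measurable[OF g(2)]
    unfolding Complex_eq by measurable
  have "(\<integral>z. \<rho> z * (cmod (h z - (\<Sum>i\<in>F. c i * monomial2 i z)))\<^sup>2 \<partial>torus2_measure) =
      (\<integral>z. \<rho> z *\<^sub>R (cmod (h z - Complex (g1 z) (g2 z)))\<^sup>2 \<partial>torus2_measure)"
    by (rule Bochner_Integration.integral_cong) (auto simp: F(3))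
  also have "\<dots> = (\<integral>z. (cmod (h z - Complex (g1 z) (g2 z)))\<^sup>2 \<partial>\<mu>)"
    unfolding \<mu>_def by (rule integral_density[symmetric]) (auto simp: \<rho>(2))
  finally show ?thesis using g(3) F by (intro exI[of _ F] exI[of _ c]) auto
qed

section \<open>From inequalities for polynomials to inequalities almost everywhere\<close>

lemma finite_measure_torus2: "finite_measure torus2_measure"
  using prob_space_torus2 by (rule prob_space.finite_measure)

lemma monomial2_combination_bounded:
  assumes "finite F"
  shows "(\<lambda>z. \<Sum>i\<in>F. c i * monomial2 i z) \<in> borel_measurable torus2_measure"
    and "\<And>z. z \<in> space torus2_measure \<Longrightarrow> cmod (\<Sum>i\<in>F. c i * monomial2 i z) \<le> (\<Sum>i\<in>F. cmod (c i))"
proof -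
  show "(\<lambda>z. \<Sum>i\<in>F. c i * monomial2 i z) \<in> borel_measurable torus2_measure" by measurable
  show "cmod (\<Sum>i\<in>F. c i * monomial2 i z) \<le> (\<Sum>i\<in>F. cmod (c i))" if "z \<in> space torus2_measure" for z
    by (rule sum_norm_le) (simp add: norm_mult norm_monomial2[OF that])
qed

lemma L2_times_monomial2_combination:
  assumes "f \<in> L2 torus2_measure" "finite F"
  shows "(\<lambda>z. f z * (\<Sum>i\<in>F. c i * monomial2 i z)) \<in> L2 torus2_measure"
  by (rule L2_bounded_mult[OF assms(1) monomial2_combination_bounded(1)[OF assms(2)] AE_I2])
     (rule monomial2_combination_bounded(2)[OF assms(2)])

text \<open>The hypothesis is carried over to the indicator \<open>h\<close> of the set where the
  claim fails: approximation with the weight \<rho> approximates \<open>u * h\<close> and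
  \<open>v * h\<close> at once. On that set the squared modulus of \<open>u\<close> strictly exceeds
  that of \<open>v\<close>, so the set is null.\<close>

lemma torus2_comparison:
  assumes u: "u \<in> L2 torus2_measure" and v: "v \<in> L2 torus2_measure"
    and le: "\<And>F c. finite F \<Longrightarrow> F \<subseteq> finite_exponents \<Longrightarrow>
      (\<integral>z. (cmod (u z * (\<Sum>i\<in>F. c i * monomial2 i z)))\<^sup>2 \<partial>torus2_measure) \<le>
      (\<integral>z. (cmod (v z * (\<Sum>i\<in>F. c i * monomial2 i z)))\<^sup>2 \<partial>torus2_measure)"
  shows "AE z in torus2_measure. cmod (u z) \<le> cmod (v z)"
proof -
  let ?M = torus2_measure
  note [measurable] = L2_measurable[OF u] L2_measurable[OF v]
  note int = L2_integrable[OF u] L2_integrable[OF v]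
  define E where "E = {z \<in> space ?M. cmod (u z) > cmod (v z)}"
  have E[measurable]: "E \<in> sets ?M" unfolding E_def by measurable
  define h where "h = (\<lambda>z. indicator E z :: complex)"
  have h[measurable]: "h \<in> borel_measurable ?M" unfolding h_def by measurable
  have h1: "cmod (h z) \<le> 1" for z by (simp add: h_def indicator_def)
  define X where "X = (\<integral>z. (cmod (u z * h z))\<^sup>2 \<partial>?M)"
  define Y where "Y = (\<integral>z. (cmod (v z * h z))\<^sup>2 \<partial>?M)"
  have uh: "(\<lambda>z. u z * h z) \<in> L2 ?M" and vh: "(\<lambda>z. v z * h z) \<in> L2 ?M"
    by (rule L2_bounded_mult[OF u h AE_I2, of 1] L2_bounded_mult[OF v h AE_I2, of 1]; simp add: h1)+
  define \<rho> where "\<rho> = (\<lambda>z. (cmod (u z))\<^sup>2 + (cmod (v z))\<^sup>2)"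
  have \<rho>: "integrable ?M \<rho>" "\<And>z. \<rho> z \<ge> 0" using int by (auto simp: \<rho>_def)
  have \<rho>h: "integrable ?M (\<lambda>z. \<rho> z * (cmod (h z))\<^sup>2)"
    using L2_integrable[OF uh] L2_integrable[OF vh]
    by (simp add: \<rho>_def norm_mult power_mult_distrib distrib_right)
  \<comment> \<open>The weighted triangle inequality is used twice, from \<open>h\<close> to the
    polynomial for \<open>u\<close> and back for \<open>v\<close>. Afterwards \<epsilon> tends to 0
    before \<open>t\<close> does, which keeps \<open>1 / t\<close> harmless.\<close>
  have step: "X \<le> (1 + t) * ((1 + t) * Y + (1 + 1 / t) * \<epsilon>) + (1 + 1 / t) * \<epsilon>" if "t > 0" "\<epsilon> > 0" for t \<epsilon>
  proof -
    obtain F c where F: "finite F" "F \<subseteq> finite_exponents"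
      "(\<integral>z. \<rho> z * (cmod (h z - (\<Sum>i\<in>F. c i * monomial2 i z)))\<^sup>2 \<partial>?M) < \<epsilon>"
      using torus2_dense[OF \<rho> h \<rho>h \<open>\<epsilon> > 0\<close>] by blast
    define Q where "Q = (\<lambda>z. \<Sum>i\<in>F. c i * monomial2 i z)"
    have Qm[measurable]: "Q \<in> borel_measurable ?M"
      unfolding Q_def by (rule monomial2_combination_bounded(1)[OF F(1)])
    have uQ: "(\<lambda>z. u z * Q z) \<in> L2 ?M" and vQ: "(\<lambda>z. v z * Q z) \<in> L2 ?M"
      unfolding Q_def by (rule L2_times_monomial2_combination[OF u F(1)] L2_times_monomial2_combination[OF v F(1)])+
    have ud: "(\<lambda>z. u z * (h z - Q z)) \<in> L2 ?M" and vd: "(\<lambda>z. v z * (h z - Q z)) \<in> L2 ?M"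
      using L2_diff[OF uh uQ] L2_diff[OF vh vQ] by (simp_all add: right_diff_distrib)
    have \<rho>d: "integrable ?M (\<lambda>z. \<rho> z * (cmod (h z - Q z))\<^sup>2)"
      using L2_integrable[OF ud] L2_integrable[OF vd]
      by (simp add: \<rho>_def norm_mult power_mult_distrib distrib_right)
    have ue: "(\<integral>z. (cmod (u z * (h z - Q z)))\<^sup>2 \<partial>?M) \<le> \<epsilon>"
    proof -
      have "(\<integral>z. (cmod (u z * (h z - Q z)))\<^sup>2 \<partial>?M) \<le> (\<integral>z. \<rho> z * (cmod (h z - Q z))\<^sup>2 \<partial>?M)"
        using L2_integrable[OF ud] \<rho>d
        by (intro integral_mono) (auto simp: \<rho>_def norm_mult power_mult_distrib distrib_right)
      then show ?thesis using F(3) by (simp add: Q_def)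
    qed
    have ve: "(\<integral>z. (cmod (v z * (Q z - h z)))\<^sup>2 \<partial>?M) \<le> \<epsilon>"
    proof -
      have "(\<integral>z. (cmod (v z * (Q z - h z)))\<^sup>2 \<partial>?M) = (\<integral>z. (cmod (v z * (h z - Q z)))\<^sup>2 \<partial>?M)"
        by (simp add: norm_mult norm_minus_commute)
      also have "\<dots> \<le> (\<integral>z. \<rho> z * (cmod (h z - Q z))\<^sup>2 \<partial>?M)"
        using L2_integrable[OF vd] \<rho>d
        by (intro integral_mono) (auto simp: \<rho>_def norm_mult power_mult_distrib distrib_right)
      finally show ?thesis using F(3) by (simp add: Q_def)
    qed
    have "X = (\<integral>z. (cmod (u z * Q z + u z * (h z - Q z)))\<^sup>2 \<partial>?M)"
      by (simp add: X_def right_diff_distrib)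
    also have "\<dots> \<le> (1 + t) * (\<integral>z. (cmod (u z * Q z))\<^sup>2 \<partial>?M) + (1 + 1 / t) * (\<integral>z. (cmod (u z * (h z - Q z)))\<^sup>2 \<partial>?M)"
      by (rule integral_add_square_le_weighted[OF uQ ud \<open>t > 0\<close>])
    also have "\<dots> \<le> (1 + t) * (\<integral>z. (cmod (v z * Q z))\<^sup>2 \<partial>?M) + (1 + 1 / t) * \<epsilon>"
      using le[OF F(1,2), of c] ue \<open>t > 0\<close> unfolding Q_def[symmetric]
      by (intro add_mono mult_left_mono) (auto simp: Q_def)
    also have "(\<integral>z. (cmod (v z * Q z))\<^sup>2 \<partial>?M) = (\<integral>z. (cmod (v z * h z + v z * (Q z - h z)))\<^sup>2 \<partial>?M)"
      by (simp add: right_diff_distrib)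
    also have "\<dots> \<le> (1 + t) * Y + (1 + 1 / t) * (\<integral>z. (cmod (v z * (Q z - h z)))\<^sup>2 \<partial>?M)"
      unfolding Y_def using L2_diff[OF vQ vh]
      by (intro integral_add_square_le_weighted[OF vh _ \<open>t > 0\<close>]) (simp add: right_diff_distrib)
    also have "\<dots> \<le> (1 + t) * Y + (1 + 1 / t) * \<epsilon>"
      using ve \<open>t > 0\<close> by (intro add_left_mono mult_left_mono) auto
    finally show ?thesis using \<open>t > 0\<close> by (simp add: mult_left_mono)
  qed
  have step2: "X \<le> (1 + t) * ((1 + t) * Y)" if "t > 0" for t
  proof (rule field_le_epsilon)
    fix e :: real assume "e > 0"
    \<comment> \<open>The total factor of \<epsilon> in \<open>step\<close>, so that the choice
      \<open>e / k\<close> produces exactly \<open>e\<close>.\<close>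
    define k where "k = (1 + t) * (1 + 1 / t) + (1 + 1 / t)"
    have "k > 0" using that by (simp add: k_def add_pos_pos)
    have "X \<le> (1 + t) * ((1 + t) * Y + (1 + 1 / t) * (e / k)) + (1 + 1 / t) * (e / k)"
      using step[of t "e / k"] that \<open>e > 0\<close> \<open>k > 0\<close> by simp
    also have "\<dots> = (1 + t) * ((1 + t) * Y) + k * (e / k)"
    proof -
      have "(1 + t) * ((1 + t) * Y + s * r) + s * r = (1 + t) * ((1 + t) * Y) + ((1 + t) * s + s) * r" for s r
        by (simp add: algebra_simps)
      then show ?thesis unfolding k_def .
    qed
    also have "k * (e / k) = e" using \<open>k > 0\<close> by simp
    finally show "X \<le> (1 + t) * ((1 + t) * Y) + e" .
  qed
  have "X \<le> Y"
  proof (rule LIMSEQ_le_const)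
    have "(\<lambda>n. (1 + 1 / real (Suc n)) * ((1 + 1 / real (Suc n)) * Y)) \<longlonglongrightarrow> (1 + 0) * ((1 + 0) * Y)"
      by (intro tendsto_intros LIMSEQ_Suc[OF lim_1_over_n])
    then show "(\<lambda>n. (1 + 1 / real (Suc n)) * ((1 + 1 / real (Suc n)) * Y)) \<longlonglongrightarrow> Y" by simp
    show "\<exists>N. \<forall>n\<ge>N. X \<le> (1 + 1 / real (Suc n)) * ((1 + 1 / real (Suc n)) * Y)"
      using step2 by (intro exI[of _ 0]) auto
  qed
  define d where "d = (\<lambda>z. (cmod (u z * h z))\<^sup>2 - (cmod (v z * h z))\<^sup>2)"
  have d0: "d z \<ge> 0" for z
    by (auto simp: d_def h_def indicator_def E_def intro!: power_mono)
  have "integrable ?M d" unfolding d_def using L2_integrable[OF uh] L2_integrable[OF vh] by simp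
  moreover have "integral\<^sup>L ?M d = 0"
  proof -
    have "integral\<^sup>L ?M d = X - Y"
      unfolding d_def X_def Y_def using L2_integrable[OF uh] L2_integrable[OF vh] by simp
    moreover have "integral\<^sup>L ?M d \<ge> 0" using d0 by simp
    ultimately show ?thesis using \<open>X \<le> Y\<close> by simp
  qed
  ultimately have "AE z in ?M. d z = 0"
    using integral_nonneg_eq_0_iff_AE[of ?M d] d0 by simp
  with AE_space[of ?M] show ?thesis
  proof eventually_elim
    case (elim z)
    then have "\<not> cmod (u z) > cmod (v z)"
      using power_strict_mono[of "cmod (v z)" "cmod (u z)" 2] by (auto simp: d_def h_def E_def)
    then show ?case by simp
  qed
qed

section \<open>Bohr correspondence\<close>

abbreviation nth_prime :: "nat \<Rightarrow> nat" where
  "nth_prime \<equiv> enumerate {p. prime p}"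

lemma bij_nth_prime: "bij_betw nth_prime UNIV {p. prime p}"
  by (rule bij_enumerate[OF primes_infinite])

lemma prime_nth_prime: "prime (nth_prime k)"
  using bij_nth_prime by (auto simp: bij_betw_def)

lemma nth_prime_eq_iff: "nth_prime j = nth_prime k \<longleftrightarrow> j = k"
  using bij_nth_prime by (auto simp: bij_betw_def inj_on_def)

lemma nth_prime_exists: "prime p \<Longrightarrow> \<exists>k. p = nth_prime k"
  using bij_nth_prime by (auto simp: bij_betw_def)

lemma prime_exponents_nonneg: "prime_exponents n k \<ge> 0"
  by (simp add: prime_exponents_def)

lemma finite_prime_exponents:
  assumes "n \<ge> 1" shows "finite {k. prime_exponents n k \<noteq> 0}"
proof (rule finite_imageD)
  have "nth_prime ` {k. prime_exponents n k \<noteq> 0} \<subseteq> {p. p dvd n}"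
  proof safe
    fix k assume "prime_exponents n k \<noteq> 0"
    then show "nth_prime k dvd n"
      using not_dvd_imp_multiplicity_0[of "nth_prime k" n] by (auto simp: prime_exponents_def)
  qed
  then show "finite (nth_prime ` {k. prime_exponents n k \<noteq> 0})"
    by (rule finite_subset[OF _ finite_divisors_nat]) (use assms in auto)
qed (simp add: inj_on_def nth_prime_eq_iff)

lemma prime_exponents_mult:
  "m \<ge> 1 \<Longrightarrow> n \<ge> 1 \<Longrightarrow> prime_exponents (m * n) k = prime_exponents m k + prime_exponents n k"
  using prime_nth_prime[of k] by (simp add: prime_exponents_def prime_elem_multiplicity_mult_distrib)

lemma prime_exponents_le_imp_dvd:
  assumes "m \<ge> 1" "n \<ge> 1" "\<And>k. prime_exponents m k \<le> prime_exponents n k"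
  shows "m dvd n"
proof (rule multiplicity_le_imp_dvd)
  fix p :: nat assume "prime p"
  then obtain k where "p = nth_prime k" using nth_prime_exists by blast
  then show "multiplicity p m \<le> multiplicity p n" using assms(3)[of k] by (simp add: prime_exponents_def)
qed (use assms in auto)

lemma prime_exponents_inject:
  assumes "m \<ge> 1" "n \<ge> 1" "prime_exponents m = prime_exponents n" shows "m = n"
  using prime_exponents_le_imp_dvd[of m n] prime_exponents_le_imp_dvd[of n m] assms by (auto intro: dvd_antisym)

text \<open>With injectivity this identifies the positive integers with the finitely supported
  nonnegative exponents, so the Bohr transform merely relabels a basis.\<close>

lemma prime_exponents_surj:
  assumes fin: "finite {k. \<alpha> k \<noteq> 0}" and nonneg: "\<And>k. \<alpha> k \<ge> 0"
  obtains n where "n \<ge> 1" "prime_exponents n = \<alpha>"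
proof -
  define S where "S = nth_prime ` {k. \<alpha> k \<noteq> 0}"
  define n where "n = (\<Prod>p\<in>S. p ^ nat (\<alpha> (inv nth_prime p)))"
  have inv: "inv nth_prime (nth_prime k) = k" for k
    by (rule inv_f_f) (simp add: inj_on_def nth_prime_eq_iff)
  have S: "finite S" "\<And>p. p \<in> S \<Longrightarrow> prime p" using fin prime_nth_prime by (auto simp: S_def)
  have "n > 0" using S(2) unfolding n_def by (intro prod_pos) (auto intro: prime_gt_0_nat)
  moreover have "prime_exponents n k = \<alpha> k" for k
  proof -
    have "multiplicity (nth_prime k) n = (if nth_prime k \<in> S then nat (\<alpha> (inv nth_prime (nth_prime k))) else 0)"
      unfolding n_def by (rule multiplicity_prod_prime_powers[OF S prime_nth_prime])
    moreover have "nth_prime k \<in> S \<longleftrightarrow> \<alpha> k \<noteq> 0" by (auto simp: S_def nth_prime_eq_iff)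
    ultimately show ?thesis using nonneg[of k] by (auto simp: prime_exponents_def inv)
  qed
  ultimately show ?thesis using that[of n] by auto
qed

section \<open>Pairs of integers and analytic Fourier coefficients\<close>

definition pair_exponents :: "nat \<times> nat \<Rightarrow> exponents" where
  "pair_exponents i = (prime_exponents (fst i), prime_exponents (snd i))"

lemma pair_exponents_finite: "i \<in> index_pairs \<Longrightarrow> pair_exponents i \<in> finite_exponents"
  by (auto simp: pair_exponents_def finite_exponents_def index_pairs_def intro!: finite_prime_exponents)

lemma inj_on_pair_exponents: "inj_on pair_exponents index_pairs"
  by (auto simp: inj_on_def pair_exponents_def index_pairs_def intro: prime_exponents_inject)

definition nonneg_exponents :: "exponents \<Rightarrow> bool" where
  "nonneg_exponents i \<longleftrightarrow> (\<forall>k. fst i k \<ge> 0) \<and> (\<forall>k. snd i k \<ge> 0)"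

lemma pair_exponents_surj:
  assumes "i \<in> finite_exponents" "nonneg_exponents i"
  obtains j where "j \<in> index_pairs" "pair_exponents j = i"
proof -
  obtain m where "m \<ge> 1" "prime_exponents m = fst i"
    by (rule prime_exponents_surj[of "fst i"]) (use assms in \<open>auto simp: finite_exponents_def nonneg_exponents_def\<close>)
  moreover obtain n where "n \<ge> 1" "prime_exponents n = snd i"
    by (rule prime_exponents_surj[of "snd i"]) (use assms in \<open>auto simp: finite_exponents_def nonneg_exponents_def\<close>)
  ultimately show ?thesis using that[of "(m, n)"] by (auto simp: index_pairs_def pair_exponents_def)
qed

lemma torus2_coeff_negative:
  assumes "analytic_spectrum f" "i \<in> finite_exponents" "\<not> nonneg_exponents i"
  shows "torus2.coeff f i = 0"
  using assms unfolding torus2_coeff analytic_spectrum_def finite_exponents_def nonneg_exponents_def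
  by (auto simp: not_le)

lemma torus2_coeff_shift:
  assumes "i \<in> finite_exponents" "j \<in> finite_exponents"
  shows "torus2.coeff (\<lambda>z. f z * monomial2 j z) i = torus2.coeff f (exponents_add i (exponents_neg j))"
  unfolding torus2.coeff_def
  by (rule Bochner_Integration.integral_cong)
     (simp_all add: monomial2_add monomial2_neg finite_exponents_neg assms)

text \<open>In the divisible case the difference of the exponents is the exponent of the quotient.
  Otherwise some entry of the difference is negative, and analyticity of \<open>f\<close> supplies
  the zero of the matrix.\<close>

lemma torus2_coeff_toeplitz:
  assumes f: "analytic_spectrum f" and i: "i \<in> index_pairs" and k: "k \<in> index_pairs"
  shows "torus2.coeff f (exponents_add (pair_exponents k) (exponents_neg (pair_exponents i))) = toeplitz (bohr f) k i"
proof (cases "fst i dvd fst k \<and> snd i dvd snd k")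
  case True
  then obtain p q where pq: "fst k = fst i * p" "snd k = snd i * q" by (auto elim!: dvdE)
  have pos: "fst i \<ge> 1" "snd i \<ge> 1" "p \<ge> 1" "q \<ge> 1"
    using i k pq by (auto simp: index_pairs_def Suc_le_eq intro: ccontr)
  have "exponents_add (pair_exponents k) (exponents_neg (pair_exponents i)) = (prime_exponents p, prime_exponents q)"
    using pos by (simp add: exponents_add_def exponents_neg_def pair_exponents_def pq prime_exponents_mult fun_eq_iff)
  moreover have "toeplitz (bohr f) k i = fourier_coeff f (prime_exponents p) (prime_exponents q)"
    using True pos pq by (simp add: toeplitz_def bohr_def)
  ultimately show ?thesis by (simp add: torus2_coeff)
next
  case False
  have "\<not> nonneg_exponents (exponents_add (pair_exponents k) (exponents_neg (pair_exponents i)))"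
  proof
    assume "nonneg_exponents (exponents_add (pair_exponents k) (exponents_neg (pair_exponents i)))"
    then have "\<And>l. prime_exponents (fst i) l \<le> prime_exponents (fst k) l" "\<And>l. prime_exponents (snd i) l \<le> prime_exponents (snd k) l"
      by (auto simp: nonneg_exponents_def exponents_add_def exponents_neg_def pair_exponents_def)
    then have "fst i dvd fst k" "snd i dvd snd k"
      using i k by (auto simp: index_pairs_def intro!: prime_exponents_le_imp_dvd)
    with False show False by simp
  qed
  then have "torus2.coeff f (exponents_add (pair_exponents k) (exponents_neg (pair_exponents i))) = 0"
    by (intro torus2_coeff_negative f finite_exponents_add finite_exponents_neg pair_exponents_finite i k)
  moreover have "toeplitz (bohr f) k i = 0" by (simp only: toeplitz_def if_not_P[OF False])
  ultimately show ?thesis by simp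
qed

lemma torus2_total:
  assumes "g \<in> L2 torus2_measure" "\<epsilon> > 0"
  shows "\<exists>F c. finite F \<and> F \<subseteq> finite_exponents \<and>
    (\<integral>z. (cmod (g z - (\<Sum>i\<in>F. c i * monomial2 i z)))\<^sup>2 \<partial>torus2_measure) < \<epsilon>"
  using torus2_dense[OF finite_measure.integrable_const[OF finite_measure_torus2, of 1] _
      L2_measurable[OF assms(1)] _ assms(2)]
  by (simp add: L2_integrable[OF assms(1)])

section \<open>Products of f with analytic polynomials\<close>

definition monomial_sum :: "(nat \<times> nat) set \<Rightarrow> (nat \<times> nat \<Rightarrow> complex) \<Rightarrow> (nat \<Rightarrow> complex) \<times> (nat \<Rightarrow> complex) \<Rightarrow> complex" where
  "monomial_sum F b z = (\<Sum>j\<in>F. b j * monomial2 (pair_exponents j) z)"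

lemma monomial_sum_eq_combination:
  assumes F: "finite F" "F \<subseteq> index_pairs"
  obtains G c where "finite G" "G \<subseteq> finite_exponents" "monomial_sum F b = (\<lambda>z. \<Sum>i\<in>G. c i * monomial2 i z)"
    "(\<Sum>i\<in>G. (cmod (c i))\<^sup>2) = (\<Sum>j\<in>F. (cmod (b j))\<^sup>2)"
proof -
  define c where "c = b \<circ> inv_into F pair_exponents"
  have inj: "inj_on pair_exponents F" using inj_on_pair_exponents F(2) by (rule inj_on_subset)
  have cb: "c (pair_exponents j) = b j" if "j \<in> F" for j
    using that inj by (simp add: c_def inv_into_f_f)
  show ?thesis
  proof (rule that[of "pair_exponents ` F" c])
    show "monomial_sum F b = (\<lambda>z. \<Sum>i\<in>pair_exponents ` F. c i * monomial2 i z)"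
      by (auto simp: monomial_sum_def fun_eq_iff sum.reindex[OF inj] cb)
    show "(\<Sum>i\<in>pair_exponents ` F. (cmod (c i))\<^sup>2) = (\<Sum>j\<in>F. (cmod (b j))\<^sup>2)"
      by (simp add: sum.reindex[OF inj] cb)
  qed (use F pair_exponents_finite in auto)
qed

lemma monomial_sum_L2: "finite F \<Longrightarrow> F \<subseteq> index_pairs \<Longrightarrow> monomial_sum F b \<in> L2 torus2_measure"
  unfolding monomial_sum_def[abs_def] by (intro L2_sum monomial2_L2)

lemma monomial_sum_norm:
  assumes "finite F" "F \<subseteq> index_pairs"
  shows "L2_norm torus2_measure (monomial_sum F b) = sqrt (\<Sum>j\<in>F. (cmod (b j))\<^sup>2)"
  by (rule monomial_sum_eq_combination[OF assms, of b]) (simp add: torus2.norm_finite_combination)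

lemma times_monomial_sum_L2:
  assumes "f \<in> L2 torus2_measure" "finite F" "F \<subseteq> index_pairs"
  shows "(\<lambda>z. f z * monomial_sum F b z) \<in> L2 torus2_measure"
  by (rule monomial_sum_eq_combination[OF assms(2,3), of b]) (simp add: L2_times_monomial2_combination[OF assms(1)])

text \<open>Only exponents in the range of \<open>pair_exponents\<close> contribute: elsewhere some
  entry is negative, it stays negative after subtracting nonnegative exponents, and the coefficient
  of \<open>f\<close> there vanishes. What remains is the series of
  \<open>square_parseval\<close>.\<close>

lemma torus_parseval:
  assumes f: "f \<in> H2_torus" and F: "finite F" "F \<subseteq> index_pairs"
  shows "((\<lambda>k. (cmod (\<Sum>j\<in>F. b j * toeplitz (bohr f) k j))\<^sup>2) has_sum
    (L2_norm torus2_measure (\<lambda>z. f z * monomial_sum F b z))\<^sup>2) index_pairs"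
proof -
  have fL2: "f \<in> L2 torus2_measure" and an: "analytic_spectrum f" using f by (auto simp: H2_torus_def)
  define g where "g = (\<lambda>z. f z * monomial_sum F b z)"
  have g: "g \<in> L2 torus2_measure" unfolding g_def by (rule times_monomial_sum_L2[OF fL2 F])
  have fm: "(\<lambda>z. f z * monomial2 j z) \<in> L2 torus2_measure" for j
    by (rule L2_bounded_mult[OF fL2 monomial2_measurable AE_I2, of _ 1]) (simp add: norm_monomial2)
  have gc: "torus2.coeff g i = (\<Sum>j\<in>F. b j * torus2.coeff f (exponents_add i (exponents_neg (pair_exponents j))))"
    if i: "i \<in> finite_exponents" for i
  proof -
    have "g = (\<lambda>z. \<Sum>j\<in>F. b j * (f z * monomial2 (pair_exponents j) z))"
      by (simp add: g_def monomial_sum_def fun_eq_iff sum_distrib_left mult_ac)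
    then have "torus2.coeff g i = (\<Sum>j\<in>F. b j * torus2.coeff (\<lambda>z. f z * monomial2 (pair_exponents j) z) i)"
      by (simp only:) (rule torus2.coeff_sum[OF fm i])
    also have "\<dots> = (\<Sum>j\<in>F. b j * torus2.coeff f (exponents_add i (exponents_neg (pair_exponents j))))"
      using F i by (intro sum.cong refl) (auto simp: torus2_coeff_shift pair_exponents_finite subsetD)
    finally show ?thesis .
  qed
  have zero: "torus2.coeff g i = 0" if i: "i \<in> finite_exponents - pair_exponents ` index_pairs" for i
  proof -
    have "\<not> nonneg_exponents i" using i pair_exponents_surj[of i] by blast
    then have "\<not> nonneg_exponents (exponents_add i (exponents_neg (pair_exponents j)))" for j
      unfolding nonneg_exponents_def exponents_add_def exponents_neg_def pair_exponents_def
      using prime_exponents_nonneg by (simp) (meson order_trans)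
    then have "torus2.coeff f (exponents_add i (exponents_neg (pair_exponents j))) = 0" if "j \<in> F" for j
      using i that F by (intro torus2_coeff_negative an finite_exponents_add finite_exponents_neg pair_exponents_finite) auto
    then show ?thesis using i by (simp add: gc)
  qed
  have "((\<lambda>i. (cmod (torus2.coeff g i))\<^sup>2) has_sum (L2_norm torus2_measure g)\<^sup>2) finite_exponents"
    by (rule torus2.parseval[OF torus2_total[OF g] g])
  then have "((\<lambda>i. (cmod (torus2.coeff g i))\<^sup>2) has_sum (L2_norm torus2_measure g)\<^sup>2) (pair_exponents ` index_pairs)"
    by (rule has_sum_cong_neutral[THEN iffD1, rotated -1]) (use zero pair_exponents_finite in auto)
  then have "((\<lambda>k. (cmod (torus2.coeff g (pair_exponents k)))\<^sup>2) has_sum (L2_norm torus2_measure g)\<^sup>2) index_pairs"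
    by (simp add: has_sum_reindex[OF inj_on_pair_exponents] o_def)
  moreover have "torus2.coeff g (pair_exponents k) = (\<Sum>j\<in>F. b j * toeplitz (bohr f) k j)" if "k \<in> index_pairs" for k
    unfolding gc[OF pair_exponents_finite[OF that]]
    using F that by (intro sum.cong refl) (auto simp: torus2_coeff_toeplitz[OF an] subsetD)
  ultimately show ?thesis unfolding g_def by (simp cong: has_sum_cong)
qed

lemma shift_to_monomial_sum:
  assumes F: "finite F" "F \<subseteq> finite_exponents"
  obtains G b where "finite G" "G \<subseteq> index_pairs"
    "\<forall>z\<in>space torus2_measure. cmod (monomial_sum G b z) = cmod (\<Sum>i\<in>F. c i * monomial2 i z)"
proof -
  \<comment> \<open>Adding the sum of all absolute values makes every entry of every exponent
    nonnegative at once. The support stays finite, and the corresponding monomial has modulus 1 on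
    the torus.\<close>
  define \<sigma> :: exponents where "\<sigma> = ((\<lambda>k. \<Sum>i\<in>F. \<bar>fst i k\<bar>), (\<lambda>k. \<Sum>i\<in>F. \<bar>snd i k\<bar>))"
  have \<sigma>: "\<sigma> \<in> finite_exponents"
  proof -
    have "{k. (\<Sum>i\<in>F. \<bar>fst i k\<bar>) \<noteq> 0} \<subseteq> (\<Union>i\<in>F. {k. fst i k \<noteq> 0})"
      by (auto simp: sum_nonneg_eq_0_iff[OF F(1)])
    moreover have "{k. (\<Sum>i\<in>F. \<bar>snd i k\<bar>) \<noteq> 0} \<subseteq> (\<Union>i\<in>F. {k. snd i k \<noteq> 0})"
      by (auto simp: sum_nonneg_eq_0_iff[OF F(1)])
    moreover have "finite (\<Union>i\<in>F. {k. fst i k \<noteq> 0})" "finite (\<Union>i\<in>F. {k. snd i k \<noteq> 0})"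
      using F by (auto simp: finite_exponents_def)
    ultimately show ?thesis
      unfolding \<sigma>_def finite_exponents_def fst_conv snd_conv mem_Collect_eq by (blast intro: finite_subset)
  qed
  have "\<exists>j\<in>index_pairs. pair_exponents j = exponents_add i \<sigma>" if "i \<in> F" for i
  proof -
    have le: "\<bar>u i\<bar> \<le> (\<Sum>i\<in>F. \<bar>u i\<bar>)" for u :: "exponents \<Rightarrow> int"
      using member_le_sum[OF that, of "\<lambda>i. \<bar>u i\<bar>"] F(1) by simp
    have "nonneg_exponents (exponents_add i \<sigma>)"
      using le[of "\<lambda>i. fst i k" for k] le[of "\<lambda>i. snd i k" for k]
      by (auto simp: nonneg_exponents_def exponents_add_def \<sigma>_def) (smt (verit))+
    then show ?thesis
      using pair_exponents_surj[of "exponents_add i \<sigma>"] finite_exponents_add[OF _ \<sigma>] F that by blast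
  qed
  then obtain n where n: "\<And>i. i \<in> F \<Longrightarrow> n i \<in> index_pairs" "\<And>i. i \<in> F \<Longrightarrow> pair_exponents (n i) = exponents_add i \<sigma>"
    by metis
  have inj: "inj_on n F"
  proof (rule inj_onI)
    fix i j assume "i \<in> F" "j \<in> F" "n i = n j"
    then have "exponents_add i \<sigma> = exponents_add j \<sigma>" using n(2) by metis
    then show "i = j" by (auto simp: exponents_add_def fun_eq_iff prod_eq_iff)
  qed
  show ?thesis
  proof (rule that[of "n ` F" "c \<circ> inv_into F n"]; (intro ballI)?)
    fix z assume z: "z \<in> space torus2_measure"
    have "monomial_sum (n ` F) (c \<circ> inv_into F n) z = (\<Sum>i\<in>F. c i * monomial2 (exponents_add i \<sigma>) z)"
      unfolding monomial_sum_def sum.reindex[OF inj] by (intro sum.cong refl) (simp add: inv_into_f_f[OF inj] n(2))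
    also have "\<dots> = (\<Sum>i\<in>F. c i * monomial2 i z) * monomial2 \<sigma> z"
      unfolding sum_distrib_right using F(2)
      by (intro sum.cong refl) (auto simp: monomial2_add[OF z _ \<sigma>] subsetD mult.assoc)
    finally show "cmod (monomial_sum (n ` F) (c \<circ> inv_into F n) z) = cmod (\<Sum>i\<in>F. c i * monomial2 i z)"
      by (simp add: norm_mult norm_monomial2[OF z])
  qed (use F n in auto)
qed

lemma L2_norm_times_bounds:
  assumes f: "f \<in> L2 M" and g: "g \<in> L2 M" and fg: "(\<lambda>z. f z * g z) \<in> L2 M"
  shows "c \<ge> 0 \<Longrightarrow> AE z in M. c \<le> cmod (f z) \<Longrightarrow> c * L2_norm M g \<le> L2_norm M (\<lambda>z. f z * g z)"
    and "c \<ge> 0 \<Longrightarrow> AE z in M. cmod (f z) \<le> c \<Longrightarrow> L2_norm M (\<lambda>z. f z * g z) \<le> c * L2_norm M g"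
proof -
  have sq: "c * L2_norm M g = sqrt (\<integral>z. c\<^sup>2 * (cmod (g z))\<^sup>2 \<partial>M)" if "c \<ge> 0"
    using that by (simp add: L2_norm_def real_sqrt_mult)
  have int: "integrable M (\<lambda>z. c\<^sup>2 * (cmod (g z))\<^sup>2)" using L2_integrable[OF g] by simp
  show "c * L2_norm M g \<le> L2_norm M (\<lambda>z. f z * g z)" if "c \<ge> 0" "AE z in M. c \<le> cmod (f z)"
    unfolding sq[OF that(1)] unfolding L2_norm_def
  proof (intro real_sqrt_le_mono integral_mono_AE int L2_integrable[OF fg])
    show "AE z in M. c\<^sup>2 * (cmod (g z))\<^sup>2 \<le> (cmod (f z * g z))\<^sup>2"
      using that(2) by eventually_elim
        (use that(1) in \<open>auto simp: norm_mult power_mult_distrib intro!: mult_right_mono power_mono\<close>)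
  qed
  show "L2_norm M (\<lambda>z. f z * g z) \<le> c * L2_norm M g" if "c \<ge> 0" "AE z in M. cmod (f z) \<le> c"
    unfolding sq[OF that(1)] unfolding L2_norm_def
  proof (intro real_sqrt_le_mono integral_mono_AE int L2_integrable[OF fg])
    show "AE z in M. (cmod (f z * g z))\<^sup>2 \<le> c\<^sup>2 * (cmod (g z))\<^sup>2"
      using that(2) by eventually_elim
        (use that(1) in \<open>auto simp: norm_mult power_mult_distrib intro!: mult_right_mono power_mono\<close>)
  qed
qed

section \<open>Riesz bounds, bounds for f almost everywhere, and the constants\<close>

theorem theorem6p4:
  fixes \<phi> :: "real \<times> real \<Rightarrow> complex"
    and D :: "nat \<Rightarrow> nat \<Rightarrow> complex"
    and f :: "(nat \<Rightarrow> complex) \<times> (nat \<Rightarrow> complex) \<Rightarrow> complex"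
  assumes "\<phi> \<in> L2 square_measure"
    and "odd_periodic \<phi>"
    and "D = S_map \<phi>"
    and "f \<in> H2_torus" and "bohr f = D"
  shows "(riesz_sequence square_measure index_pairs (dilation \<phi>) \<longleftrightarrow>
            f \<in> Hinfty_torus \<and>
            (\<exists>\<epsilon>>0. \<exists>B\<in>sets torus2_measure. emeasure torus2_measure B = 1 \<and>
               (\<forall>z\<in>B. \<epsilon> \<le> cmod (f z)))) \<and>
         (\<forall>\<epsilon>>0. f \<in> Hinfty_torus \<and>
            (\<exists>B\<in>sets torus2_measure. emeasure torus2_measure B = 1 \<and>
               (\<forall>z\<in>B. \<epsilon> \<le> cmod (f z))) \<longrightarrow>
            (\<forall>F b. finite F \<and> F \<subseteq> index_pairs \<longrightarrow>
               \<epsilon> * sqrt (\<Sum>j\<in>F. (cmod (b j))\<^sup>2)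
                 \<le> L2_norm square_measure (\<lambda>p. \<Sum>j\<in>F. b j * dilation \<phi> j p) \<and>
               L2_norm square_measure (\<lambda>p. \<Sum>j\<in>F. b j * dilation \<phi> j p)
                 \<le> dirichlet_sup_norm D * sqrt (\<Sum>j\<in>F. (cmod (b j))\<^sup>2)))"
proof -
  let ?M = torus2_measure
  interpret T: prob_space torus2_measure by (rule prob_space_torus2)
  have fL2: "f \<in> L2 ?M" and an: "analytic_spectrum f" using assms(4) by (auto simp: H2_torus_def)
  note [measurable] = L2_measurable[OF fL2]
  define N where "N = (\<lambda>F b. L2_norm square_measure (\<lambda>p. \<Sum>j\<in>F. b j * dilation \<phi> j p))"
  have Nsum: "((\<lambda>k. (cmod (\<Sum>j\<in>F. b j * toeplitz D k j))\<^sup>2) has_sum (N F b)\<^sup>2) index_pairs"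
    if "finite F" "F \<subseteq> index_pairs" for F b
    unfolding N_def assms(3) by (rule square_parseval[OF assms(2,1) that])
  \<comment> \<open>Both squared norms are the sum of one and the same series, because
    \<open>bohr f\<close> and \<open>S_map \<phi>\<close> are both \<open>D\<close>.\<close>
  have Ntorus: "N F b = L2_norm ?M (\<lambda>z. f z * monomial_sum F b z)" if "finite F" "F \<subseteq> index_pairs" for F b
  proof -
    have "(N F b)\<^sup>2 = (L2_norm ?M (\<lambda>z. f z * monomial_sum F b z))\<^sup>2"
      using Nsum[OF that] torus_parseval[OF assms(4) that] unfolding assms(5) by (rule has_sum_unique)
    then show ?thesis by (rule power2_eq_imp_eq) (simp_all add: N_def)
  qed
  have lower: "\<epsilon> * sqrt (\<Sum>j\<in>F. (cmod (b j))\<^sup>2) \<le> N F b"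
    if "finite F" "F \<subseteq> index_pairs" "\<epsilon> > 0" "AE z in ?M. \<epsilon> \<le> cmod (f z)" for F b \<epsilon>
    unfolding Ntorus[OF that(1,2)] monomial_sum_norm[OF that(1,2), symmetric]
    using that by (intro L2_norm_times_bounds(1) fL2 monomial_sum_L2 times_monomial_sum_L2) auto
  have upper: "N F b \<le> C * sqrt (\<Sum>j\<in>F. (cmod (b j))\<^sup>2)"
    if "finite F" "F \<subseteq> index_pairs" "C \<ge> 0" "AE z in ?M. cmod (f z) \<le> C" for F b C
    unfolding Ntorus[OF that(1,2)] monomial_sum_norm[OF that(1,2), symmetric]
    using that by (intro L2_norm_times_bounds(2) fL2 monomial_sum_L2 times_monomial_sum_L2) auto
  have AE_B: "AE z in ?M. \<epsilon> \<le> cmod (f z)"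
    if "B \<in> sets ?M" "emeasure ?M B = 1" "\<forall>z\<in>B. \<epsilon> \<le> cmod (f z)" for B \<epsilon>
  proof -
    have "AE z in ?M. z \<in> B" using that by (subst T.AE_in_set_eq_1) (auto simp: T.emeasure_eq_measure)
    then show ?thesis by eventually_elim (use that in auto)
  qed
  have AE_C: "\<exists>C\<ge>0. AE z in ?M. cmod (f z) \<le> C" if H: "f \<in> Hinfty_torus"
  proof -
    obtain C where "AE z in ?M. cmod (f z) \<le> C" using H by (auto simp: Hinfty_torus_def Linfty_def)
    then have "AE z in ?M. cmod (f z) \<le> max 0 C" by eventually_elim auto
    then show ?thesis by (intro exI[of _ "max 0 C"]) auto
  qed
  have riesz_imp: "f \<in> Hinfty_torus \<and> (\<exists>\<epsilon>>0. \<exists>B\<in>sets ?M. emeasure ?M B = 1 \<and> (\<forall>z\<in>B. \<epsilon> \<le> cmod (f z)))"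
    if riesz: "riesz_sequence square_measure index_pairs (dilation \<phi>)"
  proof -
    obtain A C where AC: "0 < A" "A \<le> C"
      and "\<forall>F b. finite F \<and> F \<subseteq> index_pairs \<longrightarrow> A * sqrt (\<Sum>j\<in>F. (cmod (b j))\<^sup>2) \<le> N F b \<and>
        N F b \<le> C * sqrt (\<Sum>j\<in>F. (cmod (b j))\<^sup>2)"
      using riesz unfolding riesz_sequence_def by (elim conjE exE) (rule that, assumption, assumption, simp only: N_def)
    then have bounds: "A * sqrt (\<Sum>j\<in>F. (cmod (b j))\<^sup>2) \<le> N F b \<and> N F b \<le> C * sqrt (\<Sum>j\<in>F. (cmod (b j))\<^sup>2)"
      if "finite F" "F \<subseteq> index_pairs" for F b
      using that by simp
    have const: "(\<lambda>_. of_real k) \<in> L2 ?M" for k :: real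
      by (rule T.L2_bounded[of _ "\<bar>k\<bar>"]) auto
    \<comment> \<open>The Riesz bounds extended to all trigonometric polynomials, the form in which
      \<open>torus2_comparison\<close> can use them with a constant function on one side.\<close>
    have cmp: "A\<^sup>2 * (\<integral>z. (cmod (Q z))\<^sup>2 \<partial>?M) \<le> (\<integral>z. (cmod (f z * Q z))\<^sup>2 \<partial>?M) \<and>
        (\<integral>z. (cmod (f z * Q z))\<^sup>2 \<partial>?M) \<le> C\<^sup>2 * (\<integral>z. (cmod (Q z))\<^sup>2 \<partial>?M)"
      if FQ: "finite F" "F \<subseteq> finite_exponents" "Q = (\<lambda>z. \<Sum>i\<in>F. c i * monomial2 i z)" for F c Q
    proof -
      obtain G b where G: "finite G" "G \<subseteq> index_pairs"
        "\<forall>z\<in>space ?M. cmod (monomial_sum G b z) = cmod (\<Sum>i\<in>F. c i * monomial2 i z)"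
        by (rule shift_to_monomial_sum[OF FQ(1,2), of c])
      have "(\<integral>z. (cmod (Q z))\<^sup>2 \<partial>?M) = (L2_norm ?M (monomial_sum G b))\<^sup>2"
        unfolding L2_norm_square by (rule Bochner_Integration.integral_cong) (auto simp: G(3) FQ(3))
      then have Q: "(\<integral>z. (cmod (Q z))\<^sup>2 \<partial>?M) = (sqrt (\<Sum>j\<in>G. (cmod (b j))\<^sup>2))\<^sup>2"
        by (simp only: monomial_sum_norm[OF G(1,2)])
      have "(\<integral>z. (cmod (f z * Q z))\<^sup>2 \<partial>?M) = (L2_norm ?M (\<lambda>z. f z * monomial_sum G b z))\<^sup>2"
        unfolding L2_norm_square by (rule Bochner_Integration.integral_cong) (auto simp: G(3) FQ(3) norm_mult)
      then have fQ: "(\<integral>z. (cmod (f z * Q z))\<^sup>2 \<partial>?M) = (N G b)\<^sup>2"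
        by (simp only: Ntorus[OF G(1,2)])
      note b = bounds[OF G(1,2), of b]
      have "0 \<le> A * sqrt (\<Sum>j\<in>G. (cmod (b j))\<^sup>2)" using AC by (simp add: sum_nonneg)
      moreover have "0 \<le> N G b" by (simp add: N_def)
      ultimately show ?thesis
        unfolding Q fQ power_mult_distrib[symmetric] using b by (auto intro!: power_mono)
    qed
    have "AE z in ?M. cmod (of_real A) \<le> cmod (f z)"
    proof (rule torus2_comparison[OF const fL2])
      fix F c assume F: "finite F" "F \<subseteq> finite_exponents"
      show "(\<integral>z. (cmod (of_real A * (\<Sum>i\<in>F. c i * monomial2 i z)))\<^sup>2 \<partial>?M) \<le>
          (\<integral>z. (cmod (f z * (\<Sum>i\<in>F. c i * monomial2 i z)))\<^sup>2 \<partial>?M)"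
        using cmp[OF F refl, of c] by (simp only: norm_mult norm_of_real power_mult_distrib power2_abs) simp
    qed
    then have lo: "AE z in ?M. A \<le> cmod (f z)" using AC by simp
    have "AE z in ?M. cmod (f z) \<le> cmod (of_real C)"
    proof (rule torus2_comparison[OF fL2 const])
      fix F c assume F: "finite F" "F \<subseteq> finite_exponents"
      show "(\<integral>z. (cmod (f z * (\<Sum>i\<in>F. c i * monomial2 i z)))\<^sup>2 \<partial>?M) \<le>
          (\<integral>z. (cmod (of_real C * (\<Sum>i\<in>F. c i * monomial2 i z)))\<^sup>2 \<partial>?M)"
        using cmp[OF F refl, of c] by (simp only: norm_mult norm_of_real power_mult_distrib power2_abs) simp
    qed
    then have "f \<in> Hinfty_torus"
      using an by (auto simp: Hinfty_torus_def Linfty_def)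
    moreover have "\<exists>B\<in>sets ?M. emeasure ?M B = 1 \<and> (\<forall>z\<in>B. A \<le> cmod (f z))"
    proof (intro bexI[of _ "{z \<in> space ?M. A \<le> cmod (f z)}"] conjI)
      show "emeasure ?M {z \<in> space ?M. A \<le> cmod (f z)} = 1"
        using lo by (intro T.emeasure_eq_1_AE) auto
    qed auto
    ultimately show ?thesis using AC(1) by blast
  qed
  have imp_riesz: "riesz_sequence square_measure index_pairs (dilation \<phi>)"
    if f: "f \<in> Hinfty_torus" and \<epsilon>: "\<epsilon> > 0" "AE z in ?M. \<epsilon> \<le> cmod (f z)" for \<epsilon>
  proof -
    obtain C where C: "C \<ge> 0" "AE z in ?M. cmod (f z) \<le> C" using AE_C[OF f] by blast
    \<comment> \<open>\<open>riesz_sequence\<close> demands that the lower constant not exceed the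
      upper one, hence the maximum with \<epsilon>.\<close>
    then have C': "AE z in ?M. cmod (f z) \<le> max \<epsilon> C" by (auto elim: eventually_mono)
    have "\<epsilon> * sqrt (\<Sum>j\<in>F. (cmod (b j))\<^sup>2) \<le> N F b \<and> N F b \<le> max \<epsilon> C * sqrt (\<Sum>j\<in>F. (cmod (b j))\<^sup>2)"
      if "finite F \<and> F \<subseteq> index_pairs" for F b
      using that lower[of F \<epsilon> b] upper[of F "max \<epsilon> C" b] \<epsilon> C' by auto
    then have "0 < \<epsilon> \<and> \<epsilon> \<le> max \<epsilon> C \<and> (\<forall>F b. finite F \<and> F \<subseteq> index_pairs \<longrightarrow>
        \<epsilon> * sqrt (\<Sum>j\<in>F. (cmod (b j))\<^sup>2) \<le> N F b \<and> N F b \<le> max \<epsilon> C * sqrt (\<Sum>j\<in>F. (cmod (b j))\<^sup>2))"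
      using \<epsilon>(1) by simp
    then have "\<exists>A C. 0 < A \<and> A \<le> C \<and> (\<forall>F b. finite F \<and> F \<subseteq> index_pairs \<longrightarrow>
        A * sqrt (\<Sum>j\<in>F. (cmod (b j))\<^sup>2) \<le> N F b \<and> N F b \<le> C * sqrt (\<Sum>j\<in>F. (cmod (b j))\<^sup>2))"
      by (intro exI)
    moreover have "countable index_pairs" "\<forall>j\<in>index_pairs. dilation \<phi> j \<in> L2 square_measure"
      using dilation_isometry(1)[OF assms(2,1)] by auto
    ultimately show ?thesis
      unfolding riesz_sequence_def by (simp only: N_def)
  qed
  have sup: "N F b \<le> dirichlet_sup_norm D * sqrt (\<Sum>j\<in>F. (cmod (b j))\<^sup>2)"
    if f: "f \<in> Hinfty_torus" and F: "finite F" "F \<subseteq> index_pairs" for F b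
  proof -
    obtain C where C: "C \<ge> 0" "AE z in ?M. cmod (f z) \<le> C" using AE_C[OF f] by blast
    \<comment> \<open>The essential bound of \<open>f\<close> is an operator bound for convolution
      with \<open>D\<close>: Cauchy-Schwarz over the rows \<open>k\<close>, then partial sums of the
      series in \<open>Nsum\<close> against \<open>upper\<close>.\<close>
    have "multiplier_bound D C"
      unfolding multiplier_bound_def
    proof safe
      fix E K b c assume E: "finite E" "E \<subseteq> index_pairs" and K: "finite K" "K \<subseteq> index_pairs"
      have "cmod (\<Sum>k\<in>K. \<Sum>i\<in>E. toeplitz D k i * b i * c k) =
          cmod (\<Sum>k\<in>K. (\<Sum>i\<in>E. b i * toeplitz D k i) * c k)"
        unfolding sum_distrib_right by (simp add: mult_ac)
      also have "\<dots> \<le> (\<Sum>k\<in>K. \<bar>cmod (\<Sum>i\<in>E. b i * toeplitz D k i)\<bar> * \<bar>cmod (c k)\<bar>)"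
        by (rule order_trans[OF norm_sum]) (simp add: norm_mult)
      also have "\<dots> \<le> L2_set (\<lambda>k. cmod (\<Sum>i\<in>E. b i * toeplitz D k i)) K * L2_set (\<lambda>k. cmod (c k)) K"
        by (rule L2_set_mult_ineq)
      also have "L2_set (\<lambda>k. cmod (\<Sum>i\<in>E. b i * toeplitz D k i)) K \<le> N E b"
      proof -
        have "(\<Sum>k\<in>K. (cmod (\<Sum>i\<in>E. b i * toeplitz D k i))\<^sup>2) \<le> (N E b)\<^sup>2"
          by (rule has_sum_mono_neutral[OF has_sum_finite[OF K(1)] Nsum[OF E]]) (use K in auto)
        then have "L2_set (\<lambda>k. cmod (\<Sum>i\<in>E. b i * toeplitz D k i)) K \<le> sqrt ((N E b)\<^sup>2)"
          unfolding L2_set_def by (rule real_sqrt_le_mono)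
        then show ?thesis by (simp add: N_def)
      qed
      also have "N E b \<le> C * sqrt (\<Sum>i\<in>E. (cmod (b i))\<^sup>2)" by (rule upper[OF E C])
      finally show "cmod (\<Sum>k\<in>K. \<Sum>i\<in>E. toeplitz D k i * b i * c k)
          \<le> C * sqrt (\<Sum>i\<in>E. (cmod (b i))\<^sup>2) * sqrt (\<Sum>k\<in>K. (cmod (c k))\<^sup>2)"
        by (simp add: L2_set_def mult_right_mono sum_nonneg)
    qed
    \<comment> \<open>Column \<open>(1, 1)\<close> of the matrix consists of the coefficients of
      \<open>D\<close>, so \<open>Nsum\<close> for this single index is their square
      summability.\<close>
    moreover have "(\<lambda>i. (cmod (D (fst i) (snd i)))\<^sup>2) summable_on index_pairs"
      using Nsum[of "{(1, 1)}" "\<lambda>_. 1"] by (auto simp: toeplitz_def index_pairs_def intro: has_sum_imp_summable)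
    ultimately have M: "multiplier_bound D (dirichlet_sup_norm D)"
      by (rule multiplier_bound_dirichlet_sup_norm)
    let ?m = "dirichlet_sup_norm D" and ?s = "sqrt (\<Sum>j\<in>F. (cmod (b j))\<^sup>2)"
    have m0: "?m \<ge> 0"
      using order_trans[OF norm_ge_zero multiplier_bound_entry[OF M, of "(1,1)"]] by (auto simp: index_pairs_def)
    define v where "v = (\<lambda>k. \<Sum>j\<in>F. b j * toeplitz D k j)"
    \<comment> \<open>The bilinear bound is tested with \<open>c\<close> the conjugate of the
      convolution \<open>v\<close> itself on \<open>K\<close>. Cancelling one factor
      \<open>x\<close> gives a bound for its norm that is uniform in \<open>K\<close>, and the
      finite sums determine \<open>N F b\<close>.\<close>
    have fin: "(\<Sum>k\<in>K. (cmod (v k))\<^sup>2) \<le> (?m * ?s)\<^sup>2" if K: "finite K" "K \<subseteq> index_pairs" for K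
    proof -
      define x where "x = sqrt (\<Sum>k\<in>K. (cmod (v k))\<^sup>2)"
      have x0: "x \<ge> 0" by (simp add: x_def sum_nonneg)
      have x2: "x * x = (\<Sum>k\<in>K. (cmod (v k))\<^sup>2)" by (simp add: x_def sum_nonneg)
      have "(\<Sum>k\<in>K. \<Sum>i\<in>F. toeplitz D k i * b i * cnj (v k)) = (\<Sum>k\<in>K. v k * cnj (v k))"
        by (simp only: sum_distrib_right[symmetric] v_def mult.commute[of "toeplitz D _ _"])
      also have "\<dots> = of_real (x * x)" by (simp add: x2 complex_norm_square del: of_real_power)
      finally have "cmod (of_real (x * x)) \<le> ?m * ?s * sqrt (\<Sum>k\<in>K. (cmod (cnj (v k)))\<^sup>2)"
        using M[unfolded multiplier_bound_def, rule_format, of F K b "\<lambda>k. cnj (v k)"] F K by simp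
      then have "x * x \<le> (?m * ?s) * x" using x0 by (simp add: norm_mult x_def[symmetric])
      then have "x \<le> ?m * ?s"
        using x0 m0 by (cases "x = 0") (auto simp: sum_nonneg)
      then have "x\<^sup>2 \<le> (?m * ?s)\<^sup>2" using x0 by (intro power_mono)
      then show ?thesis using x2 by (simp add: power2_eq_square)
    qed
    have "(N F b)\<^sup>2 \<le> (?m * ?s)\<^sup>2"
      using has_sum_le_finite_sums[OF Nsum[OF F, of b]] fin by (simp add: v_def)
    then show ?thesis by (rule power2_le_imp_le) (use m0 in \<open>simp add: sum_nonneg\<close>)
  qed
  have "riesz_sequence square_measure index_pairs (dilation \<phi>)"
    if H: "f \<in> Hinfty_torus \<and> (\<exists>\<epsilon>>0. \<exists>B\<in>sets ?M. emeasure ?M B = 1 \<and> (\<forall>z\<in>B. \<epsilon> \<le> cmod (f z)))"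
  proof -
    obtain \<epsilon> B where "f \<in> Hinfty_torus" "\<epsilon> > 0" "B \<in> sets ?M" "emeasure ?M B = 1" "\<forall>z\<in>B. \<epsilon> \<le> cmod (f z)"
      using H by (elim conjE exE bexE)
    then show ?thesis by (intro imp_riesz[of \<epsilon>] AE_B)
  qed
  with riesz_imp have iff: "riesz_sequence square_measure index_pairs (dilation \<phi>) \<longleftrightarrow>
      f \<in> Hinfty_torus \<and> (\<exists>\<epsilon>>0. \<exists>B\<in>sets ?M. emeasure ?M B = 1 \<and> (\<forall>z\<in>B. \<epsilon> \<le> cmod (f z)))"
    by (rule iffI)
  have bounds: "\<epsilon> * sqrt (\<Sum>j\<in>F. (cmod (b j))\<^sup>2) \<le> N F b \<and> N F b \<le> dirichlet_sup_norm D * sqrt (\<Sum>j\<in>F. (cmod (b j))\<^sup>2)"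
    if \<epsilon>: "\<epsilon> > 0" and H: "f \<in> Hinfty_torus \<and> (\<exists>B\<in>sets ?M. emeasure ?M B = 1 \<and> (\<forall>z\<in>B. \<epsilon> \<le> cmod (f z)))"
      and F: "finite F \<and> F \<subseteq> index_pairs" for \<epsilon> F b
  proof -
    obtain B where B: "B \<in> sets ?M" "emeasure ?M B = 1" "\<forall>z\<in>B. \<epsilon> \<le> cmod (f z)"
      using H by (elim conjE bexE)
    from F H show ?thesis
      by (elim conjE, intro conjI lower[OF _ _ \<epsilon> AE_B[OF B]] sup)
  qed
  show ?thesis
    by (rule conjI[OF iff], intro allI impI) (rule bounds[unfolded N_def])
qed

end
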